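(* Consider the closed-loop process $(x_t,\Delta_t)$ of a scalar linear system controlled over an erasure channel with the adaptive quantizer described in the context, with parameters $K,p,\alpha,\delta,L$ satisfying $$0<\alpha<1,\quad \delta>0,\quad \alpha>|a|2^{-R'},\quad \alpha(|a|+\delta)^{p^{-1}-1}<1,\quad \alpha L\ge1,$$ where $R'=\log_2 K$. Suppose that the quantizer bin sizes are such that their base-2 logarithms are integer multiples of some scalar $s>0$, and that $\log_2(H(\cdot))$ takes values in integer multiples of $s$. Then the process $(x_t,\Delta_t)$ forms a positive Harris recurrent Markov chain, with a unique invariant probability measure $\pi$. If, moreover, the integers taken are relatively prime, i.e. $\log_2\alpha=-\tilde A s$ and $\log_2(|a|+\delta)=\tilde B s$ with $\gcd(\tilde A,\tilde B)=1$, then the invariant probability measure is independent of the value of the integer multiplying $s$, i.e. of the integer $\log_2(\Delta_0)/s$.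
   Context: System: $x_{t+1}=ax_t+bu_t+d_t$, $t\ge0$, with $|a|\ge1$, $b\ne0$, $x_0\in\mathbb{R}$ a given initial condition, and $\{d_t\}$ i.i.d. zero-mean Gaussian (with positive variance). The erasure process $\{\Upsilon_t\}$ is an i.i.d. $\{0,1\}$-valued sequence with $p=\mathsf{E}[\Upsilon_t]\in(0,1]$; $\Upsilon_t=1$ means error-free transmission at time $t$ and $\Upsilon_t=0$ means erasure. The channel is memoryless: $\{\Upsilon_t\}$ is independent of $\{d_t\}$, and the pairs $(d_t,\Upsilon_t)$ are i.i.d. Quantizer: $K\ge2$ is an even integer, $R=\log_2(K+1)$, $R'=\log_2K$. For bin size $\Delta>0$, $Q_K^\Delta(x)=(k-\tfrac12(K+1))\Delta$ if $x\in[(k-1-\tfrac12K)\Delta,(k-\tfrac12K)\Delta)$, $k=1,\dots,K$; $Q_K^\Delta(x)=\tfrac12(K-1)\Delta$ if $x=\tfrac12K\Delta$; $Q_K^\Delta(x)=0$ if $x\notin[-\tfrac12K\Delta,\tfrac12K\Delta]$. Control and bin update, with constants $\alpha,\delta,L>0$: $\hat x_t=\Upsilon_tQ_K^{\Delta_t}(x_t)$, $u_t=-\frac ab\hat x_t$, $h_t=\dfrac{x_t}{\Delta_t2^{R'-1}}$, $\Delta_{t+1}=\Delta_tH(\Delta_t,|h_t|,\Upsilon_t)$, with $\Delta_0\ge L$, where $H(\Delta,h,\upsilon)=|a|+\delta$ if $|h|>1$ or $\upsilon=0$; $H(\Delta,h,\upsilon)=\alpha$ if $|h|\le1$, $\upsilon=1$,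 $\Delta\ge L$; $H(\Delta,h,\upsilon)=1$ if $|h|\le1$, $\upsilon=1$, $\Delta<L$. Then $\Delta_t\ge L':=\alpha L$ for all $t$. Under the integer-multiple assumption write $\log_2\alpha=-\tilde As$, $\log_2(|a|+\delta)=\tilde Bs$, $\log_2\Delta_0=n_0s$ with $\tilde A,\tilde B\in\mathbb{N}$, $n_0\in\mathbb{Z}$. The state space of $(x_t,\Delta_t)$ is $\mathbb{R}\times\{2^{sn}: n\in\mathbb{N},\ sn\ge\log_2L',\ n=n_0-N_{\tilde A}\tilde A+N_{\tilde B}\tilde B\text{ for some }N_{\tilde A},N_{\tilde B}\in\mathbb{N}\}$ (the admissible bin sizes), where $\mathbb{N}$ includes $0$. Positive Harris recurrent: there is a nontrivial sigma-finite measure $\varphi$ such that from every state every set $B$ with $\varphi(B)>0$ is hit in finite time with probability one, and an invariant probability measure exists. *)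

theory Defs
  imports "HOL-Probability.Probability"
begin

section \<open>General state space Markov chains\<close>

text \<open>
  The state space is given by a measure \<open>S\<close>, of which only the carrier and the sigma-algebra
  matter; \<open>P z\<close> is the law of the next state when the present state is \<open>z\<close>.
\<close>

definition history :: "'w measure \<Rightarrow> 'z measure \<Rightarrow> (nat \<Rightarrow> 'w \<Rightarrow> 'z) \<Rightarrow> nat \<Rightarrow> 'w measure" where
  "history M S X t = sigma (space M) (\<Union>i\<le>t. {X i -` B \<inter> space M |B. B \<in> sets S})"

definition markov_chain ::
  "'w measure \<Rightarrow> 'z measure \<Rightarrow> ('z \<Rightarrow> 'z measure) \<Rightarrow> (nat \<Rightarrow> 'w \<Rightarrow> 'z) \<Rightarrow> bool" where
  "markov_chain M S P X \<longleftrightarrow>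
     prob_space M \<and>
     P \<in> S \<rightarrow>\<^sub>M prob_algebra S \<and>
     (\<forall>t. X t \<in> M \<rightarrow>\<^sub>M S) \<and>
     (\<forall>t. \<forall>B\<in>sets S. AE \<omega> in M.
        real_cond_exp M (history M S X t) (indicator (X (Suc t) -` B \<inter> space M)) \<omega>
          = measure (P (X t \<omega>)) B)"

definition invariant_prob :: "'z measure \<Rightarrow> ('z \<Rightarrow> 'z measure) \<Rightarrow> 'z measure \<Rightarrow> bool" where
  "invariant_prob S P \<pi> \<longleftrightarrow>
     prob_space \<pi> \<and> sets \<pi> = sets S \<and>
     (\<forall>B\<in>sets S. emeasure \<pi> B = (\<integral>\<^sup>+ z. emeasure (P z) B \<partial>\<pi>))"

text \<open>
  Here \<open>X z\<close> is the chain started from the state \<open>z\<close>; the chains for the different initial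
  states live on one probability space \<open>M\<close> (no joint law is prescribed).
\<close>

definition positive_harris_recurrent ::
  "'w measure \<Rightarrow> 'z measure \<Rightarrow> ('z \<Rightarrow> 'z measure) \<Rightarrow> ('z \<Rightarrow> nat \<Rightarrow> 'w \<Rightarrow> 'z) \<Rightarrow> bool" where
  "positive_harris_recurrent M S P X \<longleftrightarrow>
     (\<forall>z\<in>space S. markov_chain M S P (X z) \<and> (\<forall>\<omega>\<in>space M. X z 0 \<omega> = z)) \<and>
     (\<exists>\<phi>. sets \<phi> = sets S \<and> sigma_finite_measure \<phi> \<and> emeasure \<phi> (space \<phi>) \<noteq> 0 \<and>
        (\<forall>z\<in>space S. \<forall>B\<in>sets S. emeasure \<phi> B > 0 \<longrightarrow>
           (AE \<omega> in M. \<exists>t\<ge>1. X z t \<omega> \<in> B))) \<and>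
     (\<exists>\<pi>. invariant_prob S P \<pi>)"

section \<open>The closed loop with the adaptive quantizer\<close>

text \<open>
  The bins are pairwise disjoint, so at most one summand is nonzero; outside
  \<open>[-K\<Delta>/2, K\<Delta>/2]\<close> (the overflow region) the value is \<open>0\<close>.
\<close>

definition quantizer :: "nat \<Rightarrow> real \<Rightarrow> real \<Rightarrow> real" where
  "quantizer K \<Delta> x =
     (if x = real K / 2 * \<Delta> then (real K - 1) / 2 * \<Delta>
      else \<Sum>k=1..K. if x \<in> {(real k - 1 - real K / 2) * \<Delta> ..< (real k - real K / 2) * \<Delta>}
                     then (real k - (real K + 1) / 2) * \<Delta> else 0)"

definition zoom :: "real \<Rightarrow> real \<Rightarrow> real \<Rightarrow> real \<Rightarrow> real \<Rightarrow> real \<Rightarrow> bool \<Rightarrow> real" where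
  "zoom a \<alpha> \<delta> L \<Delta> h \<upsilon> =
     (if h > 1 \<or> \<not> \<upsilon> then \<bar>a\<bar> + \<delta> else if \<Delta> \<ge> L then \<alpha> else 1)"

text \<open>
  One transition from the state \<open>(x, \<Delta>)\<close> under the disturbance \<open>w\<close>; the erasure variable is
  \<open>True\<close> for an error-free transmission and \<open>False\<close> for an erasure.
\<close>

definition step ::
  "real \<Rightarrow> real \<Rightarrow> nat \<Rightarrow> real \<Rightarrow> real \<Rightarrow> real \<Rightarrow> real \<times> real \<Rightarrow> real \<times> bool \<Rightarrow> real \<times> real" where
  "step a b K \<alpha> \<delta> L = (\<lambda>(x, \<Delta>) (w, \<upsilon>).
     let xhat = of_bool \<upsilon> * quantizer K \<Delta> x;
         u = - (a / b) * xhat;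
         h = x / (\<Delta> * 2 powr (log 2 (real K) - 1))
     in (a * x + b * u + w, \<Delta> * zoom a \<alpha> \<delta> L \<Delta> \<bar>h\<bar> \<upsilon>))"

primrec closed_loop ::
  "real \<Rightarrow> real \<Rightarrow> nat \<Rightarrow> real \<Rightarrow> real \<Rightarrow> real \<Rightarrow> (nat \<Rightarrow> 'w \<Rightarrow> real) \<Rightarrow> (nat \<Rightarrow> 'w \<Rightarrow> bool)
     \<Rightarrow> real \<times> real \<Rightarrow> nat \<Rightarrow> 'w \<Rightarrow> real \<times> real" where
  "closed_loop a b K \<alpha> \<delta> L d \<Upsilon> z 0 = (\<lambda>\<omega>. z)"
| "closed_loop a b K \<alpha> \<delta> L d \<Upsilon> z (Suc t) =
     (\<lambda>\<omega>. step a b K \<alpha> \<delta> L (closed_loop a b K \<alpha> \<delta> L d \<Upsilon> z t \<omega>) (d t \<omega>, \<Upsilon> t \<omega>))"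

text \<open>Here \<open>A\<close>, \<open>B\<close>, \<open>n\<^sub>0\<close> are the integers multiplying \<open>s\<close> in the base-2 logarithms of
  \<open>1 / \<alpha>\<close>, \<open>\<bar>a\<bar> + \<delta>\<close> and the initial bin size.\<close>

definition admissible_bins :: "real \<Rightarrow> real \<Rightarrow> real \<Rightarrow> nat \<Rightarrow> nat \<Rightarrow> int \<Rightarrow> real set" where
  "admissible_bins s \<alpha> L A B n\<^sub>0 =
     {2 powr (s * real n) |n :: nat. s * real n \<ge> log 2 (\<alpha> * L) \<and>
        (\<exists>N\<^sub>A N\<^sub>B :: nat. int n = n\<^sub>0 - int N\<^sub>A * int A + int N\<^sub>B * int B)}"

definition state_space :: "real \<Rightarrow> real \<Rightarrow> real \<Rightarrow> nat \<Rightarrow> nat \<Rightarrow> int \<Rightarrow> (real \<times> real) measure" where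
  "state_space s \<alpha> L A B n\<^sub>0 = borel \<Otimes>\<^sub>M count_space (admissible_bins s \<alpha> L A B n\<^sub>0)"

text \<open>One-step transition law, for \<open>N(0, \<sigma>\<^sup>2)\<close> disturbances and success probability \<open>p\<close>.\<close>

definition closed_loop_kernel ::
  "real \<Rightarrow> real \<Rightarrow> nat \<Rightarrow> real \<Rightarrow> real \<Rightarrow> real \<Rightarrow> real \<Rightarrow> real \<Rightarrow> (real \<times> real) measure
     \<Rightarrow> real \<times> real \<Rightarrow> (real \<times> real) measure" where
  "closed_loop_kernel a b K \<alpha> \<delta> L \<sigma> p S z =
     distr (density lborel (normal_density 0 \<sigma>) \<Otimes>\<^sub>M measure_pmf (bernoulli_pmf p)) S
       (step a b K \<alpha> \<delta> L z)"

end

theory Submission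
  imports Defs
begin

text \<open>
  The function \<open>V (x, \<Delta>) = ln \<Delta> + c \<cdot> \<phi> h\<close>, where \<open>h\<close> is the plant state relative to the quantizer range
  and \<open>\<phi> h\<close> counts the zoom-out steps that a state beyond that range still needs, is a one-step
  Lyapunov function off a compact set: in range, \<open>ln \<Delta>\<close> drifts by
  \<open>p ln \<alpha> + (1 - p) ln (\<bar>a\<bar> + \<delta>) < 0\<close> up to an error of order \<open>1 / \<Delta>\<close>; out of range, the gain
  \<open>ln (\<bar>a\<bar> + \<delta>)\<close> is outweighed by \<open>c\<close>, since \<open>\<phi>\<close> drops by one up to an error of order \<open>1 / \<bar>x\<bar>\<close>.

  A bin size \<open>\<Delta>\<close> below \<open>L\<close> is kept after a successful in-range transmission, so the in-range states with
  this bin size form a small set \<open>C\<close> with a one-step minorization \<open>P \<ge> \<epsilon> 1\<^sub>C \<otimes> \<nu>\<close>. From every compact set,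
  \<open>C\<close> is reached in boundedly many steps with probability bounded below: overflowing \<open>k\<close> times from
  the deadband and zooming in again moves the level by \<open>k B\<close> modulo \<open>A\<close>. With \<open>R = P - \<epsilon> 1\<^sub>C \<otimes> \<nu>\<close>, the
  invariant law is the normalization of \<open>\<Sum>n. \<nu> R\<^sup>n\<close>. For coprime \<open>A\<close> and \<open>B\<close> every level is
  admissible, so the state space and the kernel do not depend on \<open>n\<^sub>0\<close>.
\<close>

section \<open>Iterated kernels\<close>

text \<open>\<open>\<phi>\<close> jumps from 0 to 1 at the boundary of the range, so that every
  overflow step, even the last, lowers it by one. The risk is that tiny noise at the boundary costs
  a whole unit. The condition \<open>\<alpha> > \<bar>a\<bar> / K\<close> removes it: after an
  in-range step the relative size without noise is at most some \<open>\<theta> < 1\<close>, so the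
  noise must bridge a gap of order \<Delta>, and the expected rise of \<open>\<phi>\<close> is of
  order 1 / \<Delta>. The condition \<open>\<alpha> * L \<ge> 1\<close> keeps every bin size at
  least 1, hence ln \<Delta> nonnegative. The bin below L that a success preserves yields a
  minorization in one step; regeneration then works with the chain itself and no skeleton chain
  enters. Recurrence is wanted from every state, so V is finite everywhere and a maximum principle
  replaces almost-everywhere arguments: a surviving mass that loses a fixed fraction at each visit
  to C dies out. Applied to mass killed on a target set this gives recurrence; applied to
  \<open>R\<close> it gives the weight of the regeneration series and the uniqueness of the
  invariant law.\<close>

primrec kernel_iter :: "('z \<Rightarrow> 'z measure) \<Rightarrow> nat \<Rightarrow> ('z \<Rightarrow> ennreal) \<Rightarrow> 'z \<Rightarrow> ennreal" where
  "kernel_iter Q 0 f = f"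
| "kernel_iter Q (Suc n) f = (\<lambda>z. \<integral>\<^sup>+ y. kernel_iter Q n f y \<partial>Q z)"

text \<open>The definition splits off the first transition; the survival and occupation arguments
  below split off the last one.\<close>

lemma kernel_iter_Suc2: "kernel_iter Q (Suc n) f = kernel_iter Q n (\<lambda>z. \<integral>\<^sup>+ y. f y \<partial>Q z)"
  by (induction n) simp_all

lemma space_subkernel:
  assumes "Q \<in> S \<rightarrow>\<^sub>M subprob_algebra S" "z \<in> space S"
  shows "space (Q z) = space S"
  using sets_kernel[OF assms] by (rule sets_eq_imp_space_eq)

lemma borel_measurable_kernel_int:
  assumes "Q \<in> S \<rightarrow>\<^sub>M subprob_algebra S" "f \<in> borel_measurable S"
  shows "(\<lambda>z. \<integral>\<^sup>+ y. f y \<partial>Q z) \<in> borel_measurable S"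
  using measurable_compose[OF assms(1) nn_integral_measurable_subprob_algebra[OF assms(2)]] .

lemma borel_measurable_subkernel:
  assumes "Q \<in> S \<rightarrow>\<^sub>M subprob_algebra S" "f \<in> borel_measurable S" "z \<in> space S"
  shows "f \<in> borel_measurable (Q z)"
  using assms(2) measurable_cong_sets[OF sets_kernel[OF assms(1,3)] refl] by auto

lemma borel_measurable_kernel_iter:
  assumes "Q \<in> S \<rightarrow>\<^sub>M subprob_algebra S" "f \<in> borel_measurable S"
  shows "kernel_iter Q n f \<in> borel_measurable S"
  by (induction n) (use assms borel_measurable_kernel_int in auto)

lemma kernel_iter_mono:
  assumes Q: "Q \<in> S \<rightarrow>\<^sub>M subprob_algebra S" and "\<And>z. z \<in> space S \<Longrightarrow> f z \<le> g z" "z \<in> space S"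
  shows "kernel_iter Q n f z \<le> kernel_iter Q n g z"
  using assms(3)
proof (induction n arbitrary: z)
  case (Suc n)
  then show ?case
    by (auto intro!: nn_integral_mono simp: space_subkernel[OF Q])
qed (simp add: assms)

lemma kernel_iter_cong:
  assumes Q: "Q \<in> S \<rightarrow>\<^sub>M subprob_algebra S" and "\<And>z. z \<in> space S \<Longrightarrow> f z = g z" "z \<in> space S"
  shows "kernel_iter Q n f z = kernel_iter Q n g z"
  by (intro antisym kernel_iter_mono[OF Q]) (use assms in auto)

lemma kernel_iter_add:
  assumes Q: "Q \<in> S \<rightarrow>\<^sub>M subprob_algebra S" and f: "f \<in> borel_measurable S"
    and g: "g \<in> borel_measurable S" and "z \<in> space S"
  shows "kernel_iter Q n (\<lambda>z. f z + g z) z = kernel_iter Q n f z + kernel_iter Q n g z"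
  using assms(4)
proof (induction n arbitrary: z)
  case (Suc n)
  have "kernel_iter Q (Suc n) (\<lambda>z. f z + g z) z
     = (\<integral>\<^sup>+ y. kernel_iter Q n f y + kernel_iter Q n g y \<partial>Q z)"
    using Suc by (auto intro!: nn_integral_cong simp: space_subkernel[OF Q])
  also have "\<dots> = kernel_iter Q (Suc n) f z + kernel_iter Q (Suc n) g z"
    using Suc.prems by (simp add: nn_integral_add borel_measurable_subkernel[OF Q]
        borel_measurable_kernel_iter[OF Q] f g)
  finally show ?case .
qed simp

lemma kernel_iter_cmult:
  assumes Q: "Q \<in> S \<rightarrow>\<^sub>M subprob_algebra S" and f: "f \<in> borel_measurable S" and "z \<in> space S"
  shows "kernel_iter Q n (\<lambda>z. c * f z) z = c * kernel_iter Q n f z"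
  using assms(3)
proof (induction n arbitrary: z)
  case (Suc n)
  have "kernel_iter Q (Suc n) (\<lambda>z. c * f z) z = (\<integral>\<^sup>+ y. c * kernel_iter Q n f y \<partial>Q z)"
    using Suc by (auto intro!: nn_integral_cong simp: space_subkernel[OF Q])
  also have "\<dots> = c * kernel_iter Q (Suc n) f z"
    using Suc.prems by (simp add: nn_integral_cmult borel_measurable_subkernel[OF Q]
        borel_measurable_kernel_iter[OF Q] f)
  finally show ?case .
qed simp

lemma kernel_iter_suminf:
  assumes Q: "Q \<in> S \<rightarrow>\<^sub>M subprob_algebra S" and f: "\<And>i. f i \<in> borel_measurable S"
    and "z \<in> space S"
  shows "kernel_iter Q n (\<lambda>z. \<Sum>i. f i z) z = (\<Sum>i. kernel_iter Q n (f i) z)"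
  using assms(3)
proof (induction n arbitrary: z)
  case (Suc n)
  have "kernel_iter Q (Suc n) (\<lambda>z. \<Sum>i. f i z) z = (\<integral>\<^sup>+ y. (\<Sum>i. kernel_iter Q n (f i) y) \<partial>Q z)"
    using Suc by (auto intro!: nn_integral_cong simp: space_subkernel[OF Q])
  also have "\<dots> = (\<Sum>i. kernel_iter Q (Suc n) (f i) z)"
    using Suc.prems by (simp add: nn_integral_suminf borel_measurable_subkernel[OF Q]
        borel_measurable_kernel_iter[OF Q] f)
  finally show ?case .
qed simp

lemma kernel_iter_SUP:
  assumes Q: "Q \<in> S \<rightarrow>\<^sub>M subprob_algebra S" and f: "\<And>i. f i \<in> borel_measurable S"
    and inc: "incseq f" and "z \<in> space S"
  shows "kernel_iter Q n (\<lambda>z. SUP i. f i z) z = (SUP i. kernel_iter Q n (f i) z)"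
  using assms(4)
proof (induction n arbitrary: z)
  case (Suc n)
  have mono: "kernel_iter Q n (f i) z \<le> kernel_iter Q n (f j) z" if "i \<le> j" "z \<in> space S" for i j z
    using inc that by (intro kernel_iter_mono[OF Q]) (auto simp: incseq_def le_fun_def)
  have "kernel_iter Q (Suc n) (\<lambda>z. SUP i. f i z) z = (\<integral>\<^sup>+ y. (SUP i. kernel_iter Q n (f i) y) \<partial>Q z)"
    using Suc by (auto intro!: nn_integral_cong simp: space_subkernel[OF Q])
  also have "\<dots> = (SUP i. kernel_iter Q (Suc n) (f i) z)"
    unfolding kernel_iter.simps
    using Suc.prems by (intro nn_integral_monotone_convergence_SUP_AE)
      (auto simp: borel_measurable_subkernel[OF Q] borel_measurable_kernel_iter[OF Q] f
        space_subkernel[OF Q] intro!: mono)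
  finally show ?case .
qed simp

lemma kernel_iter_le_one:
  assumes Q: "Q \<in> S \<rightarrow>\<^sub>M subprob_algebra S" and "\<And>z. z \<in> space S \<Longrightarrow> f z \<le> 1" and "z \<in> space S"
  shows "kernel_iter Q n f z \<le> 1"
  using assms(3)
proof (induction n arbitrary: z)
  case (Suc n)
  interpret subprob_space "Q z" using subprob_space_kernel[OF Q Suc.prems] .
  show ?case
    using Suc by (auto intro!: nn_integral_le_const AE_I2 simp: space_subkernel[OF Q])
qed (use assms in auto)

lemma nn_integral_subkernel_le:
  assumes "sets M = sets N" "\<And>A. A \<in> sets N \<Longrightarrow> emeasure M A \<le> emeasure N A"
  shows "nn_integral M f \<le> nn_integral N f"
  by (rule nn_integral_mono_measure) (use assms in \<open>auto simp: le_measure\<close>)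

text \<open>Induction over measurable functions lifts an identity between measures of sets to
  integrals, in the form \<open>M = M1 + c * M2\<close> in which the transition kernel is later
  split.\<close>

lemma nn_integral_add_measure:
  assumes "sets M1 = sets M" "sets M2 = sets M" and f: "f \<in> borel_measurable M"
    and "\<And>A. A \<in> sets M \<Longrightarrow> emeasure M A = emeasure M1 A + c * emeasure M2 A"
  shows "(\<integral>\<^sup>+x. f x \<partial>M) = (\<integral>\<^sup>+x. f x \<partial>M1) + c * (\<integral>\<^sup>+x. f x \<partial>M2)"
proof -
  have sp: "space M1 = space M" "space M2 = space M"
    using assms by (auto dest: sets_eq_imp_space_eq)
  have m: "g \<in> borel_measurable M1" "g \<in> borel_measurable M2" if "g \<in> borel_measurable M"
    for g :: "'a \<Rightarrow> ennreal"
    using that assms(1,2) measurable_cong_sets by blast+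
  show ?thesis using f
  proof (induction rule: borel_measurable_induct)
    case (cong f g)
    have "nn_integral M f = nn_integral M g" "nn_integral M1 f = nn_integral M1 g"
       "nn_integral M2 f = nn_integral M2 g"
      using cong(3) by (auto intro!: nn_integral_cong simp: sp)
    then show ?case using cong by simp
  next
    case (set A)
    then show ?case using assms by (simp add: nn_integral_indicator)
  next
    case (mult u c)
    then show ?case using assms by (simp add: nn_integral_cmult m algebra_simps)
  next
    case (add u v)
    then show ?case using assms by (simp add: nn_integral_add m algebra_simps)
  next
    case (seq U)
    have inc: "incseq (\<lambda>i. c * nn_integral M2 (U i))" "incseq (\<lambda>i. nn_integral M1 (U i))"
      using seq(3) by (auto simp: incseq_def le_fun_def intro!: mult_left_mono nn_integral_mono)
    have "(\<integral>\<^sup>+x. (SUP i. U i) x \<partial>M) = (SUP i. nn_integral M (U i))"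
      using seq(1,3) by (simp add: nn_integral_monotone_convergence_SUP image_comp)
    also have "\<dots> = (SUP i. nn_integral M1 (U i) + c * nn_integral M2 (U i))"
      using seq by simp
    also have "\<dots> = (SUP i. nn_integral M1 (U i)) + c * (SUP i. nn_integral M2 (U i))"
      using inc by (simp add: ennreal_SUP_add SUP_mult_left_ennreal)
    also have "\<dots> = (\<integral>\<^sup>+x. (SUP i. U i) x \<partial>M1) + c * (\<integral>\<^sup>+x. (SUP i. U i) x \<partial>M2)"
      using seq(3) m[OF seq(1)] by (simp add: nn_integral_monotone_convergence_SUP image_comp)
    finally show ?case .
  qed
qed

section \<open>Drift to a small set\<close>

lemma ennreal_suminf_finite_imp_tendsto_0:
  fixes f :: "nat \<Rightarrow> ennreal"
  assumes "(\<Sum>n. f n) < \<infinity>"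
  shows "f \<longlonglongrightarrow> 0"
proof -
  have fin: "f n < \<top>" for n
    using assms sum_le_suminf[of f "{n}"] by (auto simp: less_top[symmetric] top_unique)
  have eq: "f n = ennreal (enn2real (f n))" for n
    using fin[of n] by simp
  have "summable (\<lambda>n. enn2real (f n))"
    using assms eq by (intro summable_suminf_not_top) (auto simp: less_top)
  then have "(\<lambda>n. enn2real (f n)) \<longlonglongrightarrow> 0"
    by (rule summable_LIMSEQ_zero)
  then have "(\<lambda>n. ennreal (enn2real (f n))) \<longlonglongrightarrow> 0"
    using tendsto_ennrealI[of _ 0] by simp
  then show ?thesis using eq by simp
qed

text \<open>\<open>avoid S P C n z\<close> is the probability that the chain started at \<open>z\<close> stays off \<open>C\<close> up to and
  including time \<open>n\<close>.\<close>

primrec avoid :: "'z measure \<Rightarrow> ('z \<Rightarrow> 'z measure) \<Rightarrow> 'z set \<Rightarrow> nat \<Rightarrow> 'z \<Rightarrow> ennreal" where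
  "avoid S P C 0 = indicator (space S - C)"
| "avoid S P C (Suc n) = (\<lambda>z. indicator (space S - C) z * (\<integral>\<^sup>+ y. avoid S P C n y \<partial>P z))"

lemma borel_measurable_avoid:
  assumes "P \<in> S \<rightarrow>\<^sub>M subprob_algebra S" "C \<in> sets S"
  shows "avoid S P C n \<in> borel_measurable S"
  by (induction n) (use assms borel_measurable_kernel_int[OF assms(1)] in auto)

text \<open>The Foster-Lyapunov setting. \<open>V\<close> is finite at every state because hitting
  is claimed from every state. A negative \<open>b\<close> counts as 0 through
  \<open>ennreal\<close>.\<close>

locale drift_to_small_set =
  fixes S :: "'z measure" and P :: "'z \<Rightarrow> 'z measure" and C :: "'z set"
    and \<nu> :: "'z measure" and \<epsilon> b :: real and V :: "'z \<Rightarrow> ennreal"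
  assumes P_prob: "P \<in> S \<rightarrow>\<^sub>M prob_algebra S"
    and C_sets: "C \<in> sets S" and C_nonempty: "C \<noteq> {}"
    and \<nu>_prob: "prob_space \<nu>" and \<nu>_sets: "sets \<nu> = sets S"
    and \<epsilon>_pos: "\<epsilon> > 0"
    and minorization: "\<And>z A. z \<in> C \<Longrightarrow> A \<in> sets S \<Longrightarrow> ennreal \<epsilon> * emeasure \<nu> A \<le> emeasure (P z) A"
    and V_meas: "V \<in> borel_measurable S" and V_finite: "\<And>z. z \<in> space S \<Longrightarrow> V z < \<infinity>"
    and drift: "\<And>z. z \<in> space S \<Longrightarrow> (\<integral>\<^sup>+ y. V y \<partial>P z) + 1 \<le> V z + ennreal b * indicator C z"
begin

lemma C_subset: "C \<subseteq> space S"
  using C_sets sets.sets_into_space by blast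

lemma P_subprob: "P \<in> S \<rightarrow>\<^sub>M subprob_algebra S"
  using P_prob by (rule measurable_prob_algebraD)

lemma prob_space_P: "z \<in> space S \<Longrightarrow> prob_space (P z)"
  using measurable_space[OF P_prob] by (auto simp: space_prob_algebra)

lemma space_P: "z \<in> space S \<Longrightarrow> space (P z) = space S"
  by (rule space_subkernel[OF P_subprob])

lemma sets_P: "z \<in> space S \<Longrightarrow> sets (P z) = sets S"
  by (rule sets_kernel[OF P_subprob])

lemma space_\<nu>: "space \<nu> = space S"
  using \<nu>_sets by (rule sets_eq_imp_space_eq)

lemma emeasure_P_space: "z \<in> space S \<Longrightarrow> emeasure (P z) (space S) = 1"
  using prob_space.emeasure_space_1[OF prob_space_P] space_P by metis

lemma emeasure_\<nu>_space: "emeasure \<nu> (space S) = 1"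
  using prob_space.emeasure_space_1[OF \<nu>_prob] space_\<nu> by metis

lemma \<epsilon>_le_1: "\<epsilon> \<le> 1"
proof -
  obtain z where "z \<in> C" using C_nonempty by blast
  then have "ennreal \<epsilon> * emeasure \<nu> (space S) \<le> emeasure (P z) (space S)"
    by (intro minorization) auto
  then show ?thesis
    using \<open>z \<in> C\<close> C_subset by (auto simp: emeasure_P_space emeasure_\<nu>_space)
qed

lemma borel_measurable_\<nu>: "f \<in> borel_measurable S \<Longrightarrow> f \<in> borel_measurable \<nu>"
  using measurable_cong_sets[OF \<nu>_sets refl] by blast

text \<open>Off \<open>C\<close> each step costs at least one unit of \<open>V\<close>, and from a
  state of \<open>C\<close> all terms vanish because \<open>avoid\<close> also looks at time 0. So
  \<open>V\<close> dominates the expected number of steps before \<open>C\<close> is hit.\<close>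

lemma sum_avoid_le_V: "z \<in> space S \<Longrightarrow> (\<Sum>k<n. avoid S P C k z) \<le> V z"
proof (induction n arbitrary: z)
  case (Suc n)
  show ?case
  proof (cases "z \<in> C")
    case True
    then have "avoid S P C k z = 0" for k by (cases k) auto
    then show ?thesis by simp
  next
    case False
    have "(\<Sum>k<Suc n. avoid S P C k z) = avoid S P C 0 z + (\<Sum>k<n. avoid S P C (Suc k) z)"
      by (rule sum.lessThan_Suc_shift)
    also have "\<dots> = 1 + (\<Sum>k<n. \<integral>\<^sup>+ y. avoid S P C k y \<partial>P z)"
      using False Suc.prems by simp
    also have "(\<Sum>k<n. \<integral>\<^sup>+ y. avoid S P C k y \<partial>P z) = (\<integral>\<^sup>+ y. (\<Sum>k<n. avoid S P C k y) \<partial>P z)"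
      using borel_measurable_subkernel[OF P_subprob borel_measurable_avoid[OF P_subprob C_sets] Suc.prems]
      by (intro nn_integral_sum[symmetric]) auto
    also have "\<dots> \<le> (\<integral>\<^sup>+ y. V y \<partial>P z)"
      by (intro nn_integral_mono Suc) (simp add: space_P[OF Suc.prems])
    also have "1 + (\<integral>\<^sup>+ y. V y \<partial>P z) \<le> V z"
      using drift[OF Suc.prems] False by (simp add: add.commute)
    finally show ?thesis by (simp add: add_left_mono)
  qed
qed simp

lemma avoid_tendsto_0:
  assumes "z \<in> space S"
  shows "(\<lambda>n. avoid S P C n z) \<longlonglongrightarrow> 0"
proof (rule ennreal_suminf_finite_imp_tendsto_0)
  have "(\<Sum>n. avoid S P C n z) \<le> V z"
    by (intro suminf_le_const) (use sum_avoid_le_V[OF assms] in auto)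
  then show "(\<Sum>n. avoid S P C n z) < \<infinity>"
    using V_finite[OF assms] by auto
qed

text \<open>A maximum principle: a bounded function that is subharmonic off \<open>C\<close> is dominated by its
  bound on \<open>C\<close>, because \<open>C\<close> is reached almost surely.\<close>

lemma subharmonic_le:
  assumes "m < \<infinity>" and w: "w \<in> borel_measurable S" and wm: "\<And>z. z \<in> space S \<Longrightarrow> w z \<le> m"
    and wC: "\<And>z. z \<in> C \<Longrightarrow> w z \<le> m'"
    and sub: "\<And>z. z \<in> space S \<Longrightarrow> w z \<le> (\<integral>\<^sup>+ y. w y \<partial>P z)" and z: "z \<in> space S"
  shows "w z \<le> m'"
proof -
  \<comment> \<open>The bound \<open>m'\<close> on \<open>C\<close> is carried back along
    \<open>n\<close> steps; paths that have not yet met \<open>C\<close> contribute at most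
    \<open>m\<close>.\<close>
  have *: "w z \<le> m' + m * avoid S P C n z" if "z \<in> space S" for n z
    using that
  proof (induction n arbitrary: z)
    case 0
      then show ?case
      using wC[of z] add_increasing[of m' "w z" m] wm[of z] by (cases "z \<in> C") auto
  next
    case (Suc n)
    show ?case
    proof (cases "z \<in> C")
      case True
      then show ?thesis using wC[of z] by auto
    next
      case False
      interpret prob_space "P z" using prob_space_P[OF Suc.prems] .
      have "w z \<le> (\<integral>\<^sup>+ y. w y \<partial>P z)" using sub Suc by blast
      also have "\<dots> \<le> (\<integral>\<^sup>+ y. m' + m * avoid S P C n y \<partial>P z)"
        using Suc by (intro nn_integral_mono) (simp add: space_P)
      also have "\<dots> = m' + m * (\<integral>\<^sup>+ y. avoid S P C n y \<partial>P z)"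
        using borel_measurable_subkernel[OF P_subprob borel_measurable_avoid[OF P_subprob C_sets] Suc.prems]
        by (subst nn_integral_add) (auto simp: nn_integral_cmult emeasure_space_1)
      finally show ?thesis using False Suc.prems by simp
    qed
  qed
  have "(\<lambda>n. m' + m * avoid S P C n z) \<longlonglongrightarrow> m' + m * 0"
    using avoid_tendsto_0[OF z] assms(1)
    by (intro tendsto_add tendsto_const ennreal_tendsto_cmult) auto
  then show ?thesis
    using LIMSEQ_le_const[of _ "m'" "w z"] * z by auto
qed

text \<open>Let \<open>w\<close> be the decreasing limit of the masses that survive under
  \<open>Q\<close>. A bound \<open>\<theta> ^ n\<close> on all states becomes
  \<open>\<theta> ^ Suc n\<close> on \<open>C\<close>, where \<open>Q\<close> loses the fraction
  \<open>1 - \<theta>\<close>, and the maximum principle extends it to all states. Hence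
  \<open>w = 0\<close>. This serves both for chains killed on a target set and for the residual
  kernel.\<close>

lemma subkernel_iter_tendsto_0:
  assumes Q: "Q \<in> S \<rightarrow>\<^sub>M subprob_algebra S"
    and le: "\<And>z A. z \<in> space S \<Longrightarrow> A \<in> sets S \<Longrightarrow> emeasure (Q z) A \<le> emeasure (P z) A"
    and \<theta>: "\<And>z. z \<in> C \<Longrightarrow> emeasure (Q z) (space S) \<le> ennreal \<theta>" "0 \<le> \<theta>" "\<theta> < 1"
    and z: "z \<in> space S"
  shows "(\<lambda>n. kernel_iter Q n (\<lambda>_. 1) z) \<longlonglongrightarrow> 0"
proof -
  let ?w = "\<lambda>n. kernel_iter Q n (\<lambda>_. 1)"
  define w where "w z = (INF n. ?w n z)" for z
  have dec: "?w (Suc n) z \<le> ?w n z" if "z \<in> space S" for n z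
  proof -
    have "?w (Suc n) z = kernel_iter Q n (\<lambda>z. \<integral>\<^sup>+y. 1 \<partial>Q z) z"
      by (simp only: kernel_iter_Suc2)
    also have "\<dots> \<le> ?w n z"
      using that by (intro kernel_iter_mono[OF Q])
        (auto intro!: subprob_space.subprob_emeasure_le_1 subprob_space_kernel[OF Q])
    finally show ?thesis .
  qed
  have le1: "?w n z \<le> 1" if "z \<in> space S" for n z
    by (rule kernel_iter_le_one[OF Q _ that]) simp
  have w_meas[measurable]: "w \<in> borel_measurable S"
    unfolding w_def using borel_measurable_kernel_iter[OF Q, of "\<lambda>_. 1"] by auto
  \<comment> \<open>Limit and integral may be exchanged for a decreasing sequence because the first
    integral is at most 1. So \<open>w\<close> is subharmonic for \<open>Q\<close>, and hence for
    the larger kernel \<open>P\<close>.\<close>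
  have int: "w z \<le> (\<integral>\<^sup>+ y. w y \<partial>Q z)" if "z \<in> space S" for z
  proof -
    interpret subprob_space "Q z" using subprob_space_kernel[OF Q that] .
    have "(\<integral>\<^sup>+ y. w y \<partial>Q z) = (INF n. \<integral>\<^sup>+ y. ?w n y \<partial>Q z)"
      unfolding w_def
    proof (rule nn_integral_monotone_convergence_INF_AE)
      show "AE y in Q z. ?w (Suc n) y \<le> ?w n y" for n
        by (rule AE_I2) (simp only: space_subkernel[OF Q that] dec)
      show "?w n \<in> borel_measurable (Q z)" for n
        by (intro borel_measurable_subkernel[OF Q _ that] borel_measurable_kernel_iter[OF Q]) simp
      show "(\<integral>\<^sup>+ y. ?w 0 y \<partial>Q z) < \<infinity>"
        using emeasure_space_le_1 by (simp add: less_top[symmetric] top_unique)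
    qed
    also have "\<dots> = (INF n. ?w (Suc n) z)" by simp
    also have "\<dots> \<ge> w z"
      unfolding w_def by (intro INF_greatest INF_lower) auto
    finally show ?thesis .
  qed
  have step: "w z \<le> ennreal (\<theta> ^ n)" if "z \<in> space S" for n z
    using that
  proof (induction n arbitrary: z)
    case 0
    then show ?case using le1[of z 0] INF_lower[of 0 UNIV "\<lambda>n. ?w n z"] unfolding w_def by simp
  next
    case (Suc n)
    show ?case
    proof (rule subharmonic_le[of "ennreal (\<theta> ^ n)" w, OF _ w_meas _ _ _ Suc.prems])
      show "w z \<le> ennreal (\<theta> ^ Suc n)" if "z \<in> C" for z
      proof -
        have zS: "z \<in> space S" using that C_subset by auto
        have "w z \<le> (\<integral>\<^sup>+ y. w y \<partial>Q z)" using int zS .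
        also have "\<dots> \<le> (\<integral>\<^sup>+ y. ennreal (\<theta> ^ n) \<partial>Q z)"
          by (intro nn_integral_mono Suc) (simp add: space_subkernel[OF Q zS])
        also have "\<dots> = ennreal (\<theta> ^ n) * emeasure (Q z) (space S)"
          by (simp add: space_subkernel[OF Q zS])
        also have "\<dots> \<le> ennreal (\<theta> ^ n) * ennreal \<theta>"
          using \<theta>(1)[OF that] by (rule mult_left_mono) simp
        finally show ?thesis using \<theta>(2) by (simp add: ennreal_mult' mult.commute)
      qed
      show "w z \<le> (\<integral>\<^sup>+ y. w y \<partial>P z)" if "z \<in> space S" for z
        using int[OF that] nn_integral_subkernel_le[of "Q z" "P z" w] le[OF that]
        by (auto simp: sets_kernel[OF Q that] sets_P[OF that])
    qed (use Suc in auto)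
  qed
  have "(\<lambda>n. ennreal (\<theta> ^ n)) \<longlonglongrightarrow> 0"
    using \<theta>(2,3) tendsto_ennrealI[OF LIMSEQ_realpow_zero[of \<theta>]] by simp
  then have "w z \<le> 0"
    using step[OF z] by (intro LIMSEQ_le_const) auto
  moreover have "(\<lambda>n. ?w n z) \<longlonglongrightarrow> w z"
    unfolding w_def using dec[OF z] by (intro LIMSEQ_INF decseq_SucI)
  ultimately show ?thesis by simp
qed

text \<open>Killing on \<open>B\<close> removes at least the mass
  \<open>\<epsilon> * measure \<nu> B\<close> from each transition out of \<open>C\<close>, so
  survival tends to 0. This is what qualifies \<open>\<nu>\<close> itself as the measure whose
  positive sets are hit from everywhere.\<close>

lemma avoid_set_tendsto_0:
  assumes B: "B \<in> sets S" "emeasure \<nu> B > 0" and z: "z \<in> space S"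
  shows "(\<lambda>n. kernel_iter (\<lambda>z. density (P z) (indicator (space S - B))) n (\<lambda>_. 1) z) \<longlonglongrightarrow> 0"
proof -
  let ?Q = "\<lambda>z. density (P z) (indicator (space S - B))"
  let ?\<theta> = "1 - \<epsilon> * measure \<nu> B"
  interpret \<nu>: prob_space \<nu> using \<nu>_prob .
  have em: "emeasure (?Q z) A = emeasure (P z) (A - B)" if "z \<in> space S" "A \<in> sets S" for z A
  proof -
    have "emeasure (?Q z) A = (\<integral>\<^sup>+ y. indicator (space S - B) y * indicator A y \<partial>P z)"
      using that B sets_P by (subst emeasure_density) (auto intro!: borel_measurable_indicator)
    also have "\<dots> = (\<integral>\<^sup>+ y. indicator (A - B) y \<partial>P z)"
      using that space_P by (intro nn_integral_cong) (auto split: split_indicator)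
    finally show ?thesis using that B sets_P by (simp add: nn_integral_indicator)
  qed
  have le: "emeasure (?Q z) A \<le> emeasure (P z) A" if "z \<in> space S" "A \<in> sets S" for z A
    unfolding em[OF that] using that sets_P by (intro emeasure_mono) auto
  have pos: "0 < measure \<nu> B" "measure \<nu> B \<le> 1"
    using B by (auto simp: \<nu>.emeasure_eq_measure)
  show ?thesis
  proof (rule subkernel_iter_tendsto_0[OF _ le _ _ _ z])
    show "?Q \<in> S \<rightarrow>\<^sub>M subprob_algebra S"
    proof (rule measurable_subprob_algebra)
      fix z assume zS: "z \<in> space S"
      interpret prob_space "P z" using prob_space_P[OF zS] .
      show "subprob_space (?Q z)"
      proof
        show "emeasure (?Q z) (space (?Q z)) \<le> 1"
          using le[OF zS, of "space S"] emeasure_P_space[OF zS] by (simp add: space_P[OF zS])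
        show "space (?Q z) \<noteq> {}" using not_empty by simp
      qed
      show "sets (?Q z) = sets S" using sets_P[OF zS] by simp
    next
      fix A assume A: "A \<in> sets S"
      have "(\<lambda>z. emeasure (P z) (A - B)) \<in> borel_measurable S"
        using A B by (intro measurable_emeasure_kernel[OF P_subprob]) auto
      then show "(\<lambda>z. emeasure (?Q z) A) \<in> borel_measurable S"
        by (rule measurable_cong[THEN iffD2, rotated]) (simp add: em A)
    qed
    show "emeasure (?Q z) (space S) \<le> ennreal ?\<theta>" if "z \<in> C" for z
    proof -
      have zS: "z \<in> space S" using that C_subset by auto
      interpret prob_space "P z" using prob_space_P[OF zS] .
      have "ennreal (\<epsilon> * measure \<nu> B) \<le> emeasure (P z) B"
        using minorization[OF that B(1)] \<epsilon>_pos by (simp add: ennreal_mult' \<nu>.emeasure_eq_measure)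
      then have "\<epsilon> * measure \<nu> B \<le> prob B"
        by (simp add: emeasure_eq_measure)
      then have "prob (space S - B) \<le> ?\<theta>"
        using prob_compl[of B] B sets_P[OF zS] space_P[OF zS] by simp
      then show ?thesis
        using em[OF zS, of "space S"] by (simp add: emeasure_eq_measure ennreal_leI)
    qed
    show "0 \<le> ?\<theta>" using pos \<epsilon>_pos \<epsilon>_le_1 by (simp add: mult_le_one)
    show "?\<theta> < 1" using pos \<epsilon>_pos by simp
  qed
qed

end

section \<open>Existence and uniqueness of the invariant law\<close>

context drift_to_small_set
begin

text \<open>The case distinction stands for the factor \<open>indicator C z\<close>: on
  \<open>C\<close> the minorization makes the difference a genuine subtraction of measures.\<close>

definition R :: "'z \<Rightarrow> 'z measure" where
  "R z = (if z \<in> C then diff_measure (P z) (scale_measure (ennreal \<epsilon>) \<nu>) else P z)"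

lemma sets_R: "z \<in> space S \<Longrightarrow> sets (R z) = sets S"
  by (simp add: R_def sets_P)

lemma emeasure_R:
  assumes z: "z \<in> space S" and A: "A \<in> sets S"
  shows "emeasure (R z) A = emeasure (P z) A - ennreal \<epsilon> * indicator C z * emeasure \<nu> A"
proof (cases "z \<in> C")
  case True
  interpret P: prob_space "P z" using prob_space_P[OF z] .
  interpret \<nu>: prob_space \<nu> using \<nu>_prob .
  have "finite_measure (scale_measure (ennreal \<epsilon>) \<nu>)"
    by (rule finite_measureI) (simp add: space_scale_measure \<nu>.emeasure_space_1)
  then show ?thesis
    using A True minorization[OF True]
    using emeasure_diff_measure[OF P.finite_measure_axioms, of "scale_measure (ennreal \<epsilon>) \<nu>" A]
    by (simp add: R_def sets_P[OF z] \<nu>_sets)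
qed (simp add: R_def)

text \<open>Subtraction on \<open>ennreal\<close> is truncated; the minorization lets the subtracted
  part be added back, and this additive form is the one used in the sequel.\<close>

lemma emeasure_P_decomp:
  assumes z: "z \<in> space S" and A: "A \<in> sets S"
  shows "emeasure (P z) A = emeasure (R z) A + ennreal \<epsilon> * indicator C z * emeasure \<nu> A"
proof -
  have "ennreal \<epsilon> * indicator C z * emeasure \<nu> A \<le> emeasure (P z) A"
    using minorization[OF _ A] by (cases "z \<in> C") auto
  then show ?thesis
    unfolding emeasure_R[OF assms] by (simp add: diff_add_cancel_ennreal)
qed

lemma R_subprob: "R \<in> S \<rightarrow>\<^sub>M subprob_algebra S"
proof (rule measurable_subprob_algebra)
  fix z assume z: "z \<in> space S"
  interpret P: prob_space "P z" using prob_space_P[OF z] .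
  have sp: "space (R z) = space S" using sets_R[OF z] by (rule sets_eq_imp_space_eq)
  show "sets (R z) = sets S" using sets_R[OF z] .
  show "subprob_space (R z)"
  proof
    have "emeasure (R z) (space S) \<le> emeasure (P z) (space S)"
      using emeasure_P_decomp[OF z, of "space S"] by simp
    then show "emeasure (R z) (space (R z)) \<le> 1"
      using emeasure_P_space[OF z] by (simp add: sp)
    show "space (R z) \<noteq> {}" using z sp by auto
  qed
next
  fix A assume A: "A \<in> sets S"
  have "(\<lambda>z. emeasure (P z) A - ennreal \<epsilon> * indicator C z * emeasure \<nu> A) \<in> borel_measurable S"
    using A C_sets measurable_emeasure_kernel[OF P_subprob A] by measurable
  then show "(\<lambda>z. emeasure (R z) A) \<in> borel_measurable S"
    by (rule measurable_cong[THEN iffD2, rotated]) (simp add: emeasure_R A)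
qed

lemma nn_integral_P_decomp:
  assumes z: "z \<in> space S" and f: "f \<in> borel_measurable S"
  shows "(\<integral>\<^sup>+ y. f y \<partial>P z) = (\<integral>\<^sup>+ y. f y \<partial>R z) + ennreal \<epsilon> * indicator C z * (\<integral>\<^sup>+ y. f y \<partial>\<nu>)"
  using z f emeasure_P_decomp[OF z]
  by (intro nn_integral_add_measure)
    (auto simp: sets_P sets_R \<nu>_sets borel_measurable_subkernel[OF P_subprob])

text \<open>Each transition out of \<open>C\<close> under \<open>R\<close> keeps only the mass
  \<open>1 - \<epsilon>\<close>, so the residual chain cannot survive forever.\<close>

lemma R_iter_one_tendsto_0:
  assumes "z \<in> space S"
  shows "(\<lambda>n. kernel_iter R n (\<lambda>_. 1) z) \<longlonglongrightarrow> 0"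
proof (rule subkernel_iter_tendsto_0[OF R_subprob _ _ _ _ assms])
  show "emeasure (R z) A \<le> emeasure (P z) A" if "z \<in> space S" "A \<in> sets S" for z A
    using emeasure_P_decomp[OF that] by simp
  show "emeasure (R z) (space S) \<le> ennreal (1 - \<epsilon>)" if "z \<in> C" for z
  proof -
    have "z \<in> space S" using that C_subset by auto
    then show ?thesis
      using \<epsilon>_pos \<epsilon>_le_1 that
      by (simp add: emeasure_R emeasure_P_space emeasure_\<nu>_space ennreal_minus[of \<epsilon> 1, simplified])
  qed
qed (use \<epsilon>_pos \<epsilon>_le_1 in auto)

lemma R_iter_int_tendsto_0:
  assumes \<pi>: "finite_measure \<pi>" "sets \<pi> = sets S" and f: "f \<in> borel_measurable S"
    and f1: "\<And>z. z \<in> space S \<Longrightarrow> f z \<le> 1"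
  shows "(\<lambda>n. \<integral>\<^sup>+ z. kernel_iter R n f z \<partial>\<pi>) \<longlonglongrightarrow> 0"
proof -
  have sp: "space \<pi> = space S" using \<pi>(2) by (rule sets_eq_imp_space_eq)
  have m: "kernel_iter R n f \<in> borel_measurable \<pi>" for n
    using borel_measurable_kernel_iter[OF R_subprob f] measurable_cong_sets[OF \<pi>(2) refl] by blast
  have lim: "(\<lambda>n. kernel_iter R n f z) \<longlonglongrightarrow> 0" if "z \<in> space S" for z
    using R_iter_one_tendsto_0[OF that]
    by (rule tendsto_sandwich[OF _ _ tendsto_const, rotated 2])
      (auto intro!: always_eventually kernel_iter_mono[OF R_subprob _ that] f1)
  have "(\<lambda>n. \<integral>\<^sup>+ z. kernel_iter R n f z \<partial>\<pi>) \<longlonglongrightarrow> (\<integral>\<^sup>+ z. 0 \<partial>\<pi>)"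
  proof (rule nn_integral_dominated_convergence[where w="\<lambda>_. 1"])
    show "AE z in \<pi>. kernel_iter R n f z \<le> 1" for n
      using kernel_iter_le_one[OF R_subprob f1] by (intro AE_I2) (simp add: sp)
    show "(\<integral>\<^sup>+ z. 1 \<partial>\<pi>) < \<infinity>"
      using finite_measure.emeasure_finite[OF \<pi>(1)] by (simp add: less_top)
    show "AE z in \<pi>. (\<lambda>n. kernel_iter R n f z) \<longlonglongrightarrow> 0"
      using lim by (intro AE_I2) (simp add: sp)
  qed (use m in auto)
  then show ?thesis by simp
qed

text \<open>The expected number of visits before regeneration, from the regeneration law \<open>\<nu>\<close>.\<close>

definition occ :: "('z \<Rightarrow> ennreal) \<Rightarrow> ennreal" where
  "occ f = (\<Sum>n. \<integral>\<^sup>+ z. kernel_iter R n f z \<partial>\<nu>)"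

definition \<mu> :: "'z measure" where
  "\<mu> = measure_of (space S) (sets S) (\<lambda>A. occ (indicator A))"

lemma borel_measurable_R_iter_\<nu>:
  "f \<in> borel_measurable S \<Longrightarrow> kernel_iter R n f \<in> borel_measurable \<nu>"
  by (intro borel_measurable_\<nu> borel_measurable_kernel_iter[OF R_subprob])

lemma occ_cong:
  assumes "\<And>z. z \<in> space S \<Longrightarrow> f z = g z"
  shows "occ f = occ g"
  unfolding occ_def
  by (intro suminf_cong nn_integral_cong kernel_iter_cong[OF R_subprob]) (use assms space_\<nu> in auto)

lemma occ_suminf:
  assumes "\<And>i. f i \<in> borel_measurable S"
  shows "occ (\<lambda>z. \<Sum>i. f i z) = (\<Sum>i. occ (f i))"
proof -
  have "occ (\<lambda>z. \<Sum>i. f i z) = (\<Sum>n. \<integral>\<^sup>+ z. (\<Sum>i. kernel_iter R n (f i) z) \<partial>\<nu>)"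
    unfolding occ_def
    by (intro suminf_cong nn_integral_cong kernel_iter_suminf[OF R_subprob]) (use assms space_\<nu> in auto)
  also have "\<dots> = (\<Sum>n. \<Sum>i. \<integral>\<^sup>+ z. kernel_iter R n (f i) z \<partial>\<nu>)"
    using borel_measurable_R_iter_\<nu>[OF assms] by (simp add: nn_integral_suminf)
  \<comment> \<open>Both series are read as integrals over the counting measure, so the exchange is
    Tonelli's theorem.\<close>
  also have "\<dots> = (\<Sum>i. \<Sum>n. \<integral>\<^sup>+ z. kernel_iter R n (f i) z \<partial>\<nu>)"
    unfolding nn_integral_count_space_nat[symmetric]
    by (rule pair_sigma_finite.Fubini')
      (auto intro!: pair_sigma_finite.intro sigma_finite_measure_count_space simp: pair_measure_countable)
  finally show ?thesis unfolding occ_def .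
qed

lemma sets_\<mu>: "sets \<mu> = sets S" and space_\<mu>: "space \<mu> = space S"
  by (simp_all add: \<mu>_def)

lemma emeasure_\<mu>:
  assumes "A \<in> sets S"
  shows "emeasure \<mu> A = occ (indicator A)"
  unfolding \<mu>_def
proof (rule emeasure_measure_of_sigma)
  have z0: "kernel_iter R n (\<lambda>_. 0) = (\<lambda>_. 0)" for n
    by (induction n) auto
  have "occ (indicator {}) = 0"
    unfolding occ_def by (simp add: indicator_def[abs_def] z0)
  then show "positive (sets S) (\<lambda>A. occ (indicator A))"
    by (simp add: positive_def)
  show "countably_additive (sets S) (\<lambda>A. occ (indicator A))"
  proof (rule countably_additiveI)
    fix F :: "nat \<Rightarrow> 'z set" assume F: "range F \<subseteq> sets S" "disjoint_family F"
    have "(\<Sum>i. occ (indicator (F i))) = occ (\<lambda>z. \<Sum>i. indicator (F i) z)"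
      using F by (intro occ_suminf[symmetric]) auto
    also have "\<dots> = occ (indicator (\<Union>i. F i))"
      by (simp add: suminf_indicator[OF F(2)])
    finally show "(\<Sum>i. occ (indicator (F i))) = occ (indicator (\<Union>i. F i))" .
  qed
qed (use assms in \<open>auto intro: sets.sigma_algebra_axioms\<close>)

text \<open>\<open>\<mu>\<close> was built from indicators only; the extension to functions is
  needed because invariance evaluates \<open>occ\<close> at the function sending \<open>z\<close> to
  the \<open>R z\<close>-mass of a set.\<close>

lemma nn_integral_\<mu>:
  assumes "f \<in> borel_measurable S"
  shows "(\<integral>\<^sup>+ z. f z \<partial>\<mu>) = occ f"
  using assms
proof (induction rule: borel_measurable_induct)
  case (cong f g)
  have "occ f = occ g" using cong(3) by (rule occ_cong)
  moreover have "nn_integral \<mu> f = nn_integral \<mu> g"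
    using cong(3) by (intro nn_integral_cong) (simp add: space_\<mu>)
  ultimately show ?case using cong by simp
next
  case (set A)
  then show ?case by (simp add: emeasure_\<mu> sets_\<mu> nn_integral_indicator)
next
  case (mult u c)
  have "occ (\<lambda>z. c * u z) = (\<Sum>n. \<integral>\<^sup>+ z. c * kernel_iter R n u z \<partial>\<nu>)"
    unfolding occ_def using mult
    by (intro suminf_cong nn_integral_cong kernel_iter_cmult[OF R_subprob]) (auto simp: space_\<nu>)
  also have "\<dots> = c * occ u"
    unfolding occ_def using mult
    by (simp add: nn_integral_cmult borel_measurable_R_iter_\<nu>)
  also have "\<dots> = c * nn_integral \<mu> u" using mult by simp
  also have "\<dots> = (\<integral>\<^sup>+ z. c * u z \<partial>\<mu>)"
    using mult measurable_cong_sets[OF sets_\<mu> refl] by (intro nn_integral_cmult[symmetric]) blast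
  finally show ?case by simp
next
  case (add u v)
  have "occ (\<lambda>z. v z + u z) = (\<Sum>n. \<integral>\<^sup>+ z. kernel_iter R n v z + kernel_iter R n u z \<partial>\<nu>)"
    unfolding occ_def using add
    by (intro suminf_cong nn_integral_cong kernel_iter_add[OF R_subprob]) (auto simp: space_\<nu>)
  also have "\<dots> = occ v + occ u"
    unfolding occ_def using add
    by (simp add: nn_integral_add borel_measurable_R_iter_\<nu> suminf_add)
  also have "\<dots> = nn_integral \<mu> v + nn_integral \<mu> u" using add by simp
  also have "\<dots> = (\<integral>\<^sup>+ z. v z + u z \<partial>\<mu>)"
    using add measurable_cong_sets[OF sets_\<mu> refl] by (intro nn_integral_add[symmetric]) blast+
  finally show ?case by simp
next
  case (seq U)
  have inc: "kernel_iter R n (U i) z \<le> kernel_iter R n (U j) z" if "i \<le> j" "z \<in> space S" for i j n z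
    using seq(3) that by (intro kernel_iter_mono[OF R_subprob]) (auto simp: incseq_def le_fun_def)
  have "occ (SUP i. U i) = (\<Sum>n. \<integral>\<^sup>+ z. (SUP i. kernel_iter R n (U i) z) \<partial>\<nu>)"
    unfolding occ_def
    using kernel_iter_SUP[OF R_subprob seq(1,3)]
    by (intro suminf_cong nn_integral_cong) (auto simp: space_\<nu> SUP_apply[abs_def])
  also have "\<dots> = (\<Sum>n. SUP i. \<integral>\<^sup>+ z. kernel_iter R n (U i) z \<partial>\<nu>)"
    using seq(1) inc
    by (intro suminf_cong nn_integral_monotone_convergence_SUP_AE)
      (auto simp: space_\<nu> borel_measurable_R_iter_\<nu>)
  also have "\<dots> = (SUP i. occ (U i))"
    unfolding occ_def using inc
    by (intro ennreal_suminf_SUP_eq) (auto simp: incseq_def space_\<nu> intro!: nn_integral_mono)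
  also have "\<dots> = (SUP i. nn_integral \<mu> (U i))" using seq by simp
  also have "\<dots> = (\<integral>\<^sup>+ z. (SUP i. U i z) \<partial>\<mu>)"
    using seq(1,3) measurable_cong_sets[OF sets_\<mu> refl]
    by (intro nn_integral_monotone_convergence_SUP[symmetric]) auto
  also have "\<dots> = (\<integral>\<^sup>+ z. (SUP i. U i) z \<partial>\<mu>)" by (simp add: image_comp)
  finally show ?case by (rule sym)
qed

section \<open>Regeneration identities and the invariant law\<close>

lemma P_one: "z \<in> space S \<Longrightarrow> (\<integral>\<^sup>+ y. 1 \<partial>R z) + ennreal \<epsilon> * indicator C z = 1"
  using nn_integral_P_decomp[of z "\<lambda>_. 1"] emeasure_P_space[of z] emeasure_\<nu>_space
  by (simp add: space_P space_\<nu>)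

text \<open>Each step of the residual chain either survives or regenerates, the latter with
  probability \<open>\<epsilon>\<close> on \<open>C\<close>. So the mass 1 of \<open>\<nu>\<close>
  splits into survival for \<open>n\<close> steps and regeneration at some time
  \<open>k < n\<close>.\<close>

lemma sum_R_iter_C:
  "1 = (\<integral>\<^sup>+ z. kernel_iter R n (\<lambda>_. 1) z \<partial>\<nu>)
     + (\<Sum>k<n. \<integral>\<^sup>+ z. kernel_iter R k (\<lambda>z. ennreal \<epsilon> * indicator C z) z \<partial>\<nu>)"
proof (induction n)
  case 0
  then show ?case using emeasure_\<nu>_space by (simp add: space_\<nu>)
next
  case (Suc n)
  let ?c = "\<lambda>z. ennreal \<epsilon> * indicator C z :: ennreal"
  have c: "?c \<in> borel_measurable S" using C_sets by auto
  have o: "(\<lambda>z. \<integral>\<^sup>+ y. 1 \<partial>R z) \<in> borel_measurable S"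
    by (rule borel_measurable_kernel_int[OF R_subprob]) auto
  have "(\<integral>\<^sup>+ z. kernel_iter R n (\<lambda>_. 1) z \<partial>\<nu>)
     = (\<integral>\<^sup>+ z. kernel_iter R n (\<lambda>z. (\<integral>\<^sup>+ y. 1 \<partial>R z) + ?c z) z \<partial>\<nu>)"
    using P_one by (intro nn_integral_cong kernel_iter_cong[OF R_subprob]) (auto simp: space_\<nu>)
  also have "\<dots> = (\<integral>\<^sup>+ z. kernel_iter R n (\<lambda>z. (\<integral>\<^sup>+ y. 1 \<partial>R z)) z + kernel_iter R n ?c z \<partial>\<nu>)"
    by (intro nn_integral_cong kernel_iter_add[OF R_subprob o c]) (auto simp: space_\<nu>)
  also have "\<dots> = (\<integral>\<^sup>+ z. kernel_iter R (Suc n) (\<lambda>_. 1) z \<partial>\<nu>) + (\<integral>\<^sup>+ z. kernel_iter R n ?c z \<partial>\<nu>)"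
    unfolding kernel_iter_Suc2
    by (rule nn_integral_add) (rule borel_measurable_R_iter_\<nu>[OF o] borel_measurable_R_iter_\<nu>[OF c])+
  finally show ?case using Suc by (simp add: ac_simps)
qed

text \<open>Survival vanishes in the limit, so a cycle ends almost surely: the regeneration
  probabilities, whose sum is \<open>\<epsilon>\<close> times the \<open>\<mu>\<close>-mass of
  \<open>C\<close>, exhaust the mass of \<open>\<nu>\<close>.\<close>

lemma occ_C: "ennreal \<epsilon> * emeasure \<mu> C = 1"
proof -
  let ?c = "\<lambda>z. ennreal \<epsilon> * indicator C z :: ennreal"
  let ?r = "\<lambda>n. \<integral>\<^sup>+ z. kernel_iter R n (\<lambda>_. 1) z \<partial>\<nu>"
  let ?s = "\<lambda>n. \<integral>\<^sup>+ z. kernel_iter R n ?c z \<partial>\<nu>"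
  have "?r \<longlonglongrightarrow> 0"
    using prob_space.finite_measure[OF \<nu>_prob] \<nu>_sets by (intro R_iter_int_tendsto_0) auto
  moreover have "(\<lambda>n. \<Sum>k<n. ?s k) \<longlonglongrightarrow> (\<Sum>k. ?s k)"
    by (rule summable_LIMSEQ) auto
  ultimately have "(\<lambda>n. ?r n + (\<Sum>k<n. ?s k)) \<longlonglongrightarrow> 0 + (\<Sum>k. ?s k)"
    by (rule tendsto_add)
  then have "1 = (\<Sum>k. ?s k)"
    unfolding sum_R_iter_C[symmetric] by (simp add: LIMSEQ_const_iff)
  also have "\<dots> = occ ?c" by (simp add: occ_def)
  also have "\<dots> = (\<integral>\<^sup>+ z. ?c z \<partial>\<mu>)" using C_sets by (intro nn_integral_\<mu>[symmetric]) auto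
  also have "\<dots> = ennreal \<epsilon> * emeasure \<mu> C"
    using C_sets sets_\<mu> by (simp add: nn_integral_cmult_indicator)
  finally show ?thesis by simp
qed

text \<open>A single state of \<open>C\<close> suffices: its transition law dominates
  \<open>\<epsilon>\<close> times \<open>\<nu>\<close>, and the drift inequality bounds the integral
  of \<open>V\<close> under that law.\<close>

lemma V_int_finite: "(\<integral>\<^sup>+ z. V z \<partial>\<nu>) < \<infinity>"
proof -
  obtain z where z: "z \<in> C" using C_nonempty by blast
  then have zS: "z \<in> space S" using C_subset by auto
  have "ennreal \<epsilon> * (\<integral>\<^sup>+ z. V z \<partial>\<nu>) \<le> (\<integral>\<^sup>+ y. V y \<partial>P z)"
    using nn_integral_P_decomp[OF zS V_meas] z by simp
  also have "\<dots> \<le> (\<integral>\<^sup>+ y. V y \<partial>P z) + 1" by simp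
  also have "\<dots> \<le> V z + ennreal b" using drift[OF zS] z by simp
  also have "\<dots> < \<infinity>" using V_finite[OF zS] by (simp add: less_top)
  finally show ?thesis
    using \<epsilon>_pos by (auto simp: ennreal_mult_less_top)
qed

text \<open>The drift inequality telescopes as in \<open>sum_avoid_le_V\<close>, now along
  \<open>R\<close>. Visits to \<open>C\<close> pay back \<open>b\<close>; they are counted in units
  of the regeneration weight \<open>\<epsilon>\<close> so that \<open>sum_R_iter_C\<close> can bound
  their total.\<close>

lemma R_iter_sum_le:
  assumes "z \<in> space S"
  shows "(\<Sum>k<n. kernel_iter R k (\<lambda>_. 1) z)
    \<le> V z + ennreal (b / \<epsilon>) * (\<Sum>k<n. kernel_iter R k (\<lambda>z. ennreal \<epsilon> * indicator C z) z)"
  using assms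
proof (induction n arbitrary: z)
  case (Suc n)
  let ?c = "\<lambda>z. ennreal \<epsilon> * indicator C z :: ennreal"
  let ?k = "\<lambda>k f. kernel_iter R k f" and ?e = "ennreal (b / \<epsilon>)"
  have c: "?c \<in> borel_measurable S" using C_sets by auto
  have m: "kernel_iter R k f \<in> borel_measurable (R z)" if "f \<in> borel_measurable S" for k f
    by (intro borel_measurable_subkernel[OF R_subprob] borel_measurable_kernel_iter[OF R_subprob]
        that Suc.prems)
  \<comment> \<open>For negative \<open>b\<close> both sides vanish, since \<open>ennreal\<close>
    cuts off at 0.\<close>
  have be: "ennreal b * indicator C z = ?e * ?c z"
    using \<epsilon>_pos by (cases "b \<ge> 0") (simp_all add: ennreal_mult'' [symmetric] ennreal_neg divide_nonpos_pos split: split_indicator)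
  have RV: "(\<integral>\<^sup>+ y. V y \<partial>R z) + 1 \<le> V z + ?e * ?c z"
  proof -
    have "(\<integral>\<^sup>+ y. V y \<partial>R z) \<le> (\<integral>\<^sup>+ y. V y \<partial>P z)"
      using nn_integral_P_decomp[OF Suc.prems V_meas] by simp
    then have "(\<integral>\<^sup>+ y. V y \<partial>R z) + 1 \<le> (\<integral>\<^sup>+ y. V y \<partial>P z) + 1" by (rule add_right_mono)
    also note drift[OF Suc.prems]
    finally show ?thesis by (simp add: be)
  qed
  have "(\<Sum>k<Suc n. ?k k (\<lambda>_. 1) z) = 1 + (\<Sum>k<n. \<integral>\<^sup>+ y. ?k k (\<lambda>_. 1) y \<partial>R z)"
    by (subst sum.lessThan_Suc_shift) simp
  also have "(\<Sum>k<n. \<integral>\<^sup>+ y. ?k k (\<lambda>_. 1) y \<partial>R z) = (\<integral>\<^sup>+ y. (\<Sum>k<n. ?k k (\<lambda>_. 1) y) \<partial>R z)"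
    using m by (intro nn_integral_sum[symmetric]) auto
  also have "\<dots> \<le> (\<integral>\<^sup>+ y. V y + ?e * (\<Sum>k<n. ?k k ?c y) \<partial>R z)"
    using Suc by (intro nn_integral_mono) (simp add: space_subkernel[OF R_subprob])
  also have "\<dots> = (\<integral>\<^sup>+ y. V y \<partial>R z) + ?e * (\<integral>\<^sup>+ y. (\<Sum>k<n. ?k k ?c y) \<partial>R z)"
    using m[OF c] borel_measurable_subkernel[OF R_subprob V_meas Suc.prems]
    by (simp add: nn_integral_add nn_integral_cmult)
  also have "(\<integral>\<^sup>+ y. (\<Sum>k<n. ?k k ?c y) \<partial>R z) = (\<Sum>k<n. ?k (Suc k) ?c z)"
    using m[OF c] by (simp add: nn_integral_sum)
  finally have "(\<Sum>k<Suc n. ?k k (\<lambda>_. 1) z)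
      \<le> ((\<integral>\<^sup>+ y. V y \<partial>R z) + 1) + ?e * (\<Sum>k<n. ?k (Suc k) ?c z)"
    by (simp add: ac_simps)
  also have "\<dots> \<le> V z + ?e * ?c z + ?e * (\<Sum>k<n. ?k (Suc k) ?c z)"
    using RV by (rule add_right_mono)
  also have "\<dots> = V z + ?e * (\<Sum>k<Suc n. ?k k ?c z)"
    by (subst sum.lessThan_Suc_shift) (simp add: ac_simps distrib_left)
  finally show ?case .
qed simp

text \<open>The total mass is the expected length of a cycle. It is at most the
  \<open>\<nu>\<close>-integral of \<open>V\<close> plus \<open>ennreal (b / \<epsilon>)\<close>,
  because the regeneration probabilities within a cycle sum to at most 1.\<close>

lemma emeasure_\<mu>_space_finite: "emeasure \<mu> (space S) < \<infinity>"
proof -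
  let ?c = "\<lambda>z. ennreal \<epsilon> * indicator C z :: ennreal" and ?e = "ennreal (b / \<epsilon>)"
  have c: "?c \<in> borel_measurable S" using C_sets by auto
  have "(\<Sum>k<n. \<integral>\<^sup>+ z. kernel_iter R k (\<lambda>_. 1) z \<partial>\<nu>) \<le> (\<integral>\<^sup>+ z. V z \<partial>\<nu>) + ?e" for n
  proof -
    have "(\<Sum>k<n. \<integral>\<^sup>+ z. kernel_iter R k (\<lambda>_. 1) z \<partial>\<nu>)
        = (\<integral>\<^sup>+ z. (\<Sum>k<n. kernel_iter R k (\<lambda>_. 1) z) \<partial>\<nu>)"
      using borel_measurable_R_iter_\<nu> by (intro nn_integral_sum[symmetric]) auto
    also have "\<dots> \<le> (\<integral>\<^sup>+ z. V z + ?e * (\<Sum>k<n. kernel_iter R k ?c z) \<partial>\<nu>)"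
      using R_iter_sum_le by (intro nn_integral_mono) (auto simp: space_\<nu>)
    also have "\<dots> = (\<integral>\<^sup>+ z. V z \<partial>\<nu>) + ?e * (\<Sum>k<n. \<integral>\<^sup>+ z. kernel_iter R k ?c z \<partial>\<nu>)"
      using borel_measurable_R_iter_\<nu>[OF c] borel_measurable_\<nu>[OF V_meas]
      by (simp add: nn_integral_add nn_integral_cmult nn_integral_sum)
    also have "(\<Sum>k<n. \<integral>\<^sup>+ z. kernel_iter R k ?c z \<partial>\<nu>) \<le> 1"
      using sum_R_iter_C[of n] add_increasing[OF zero_le order_refl] by metis
    finally show ?thesis by (simp add: add_left_mono mult_left_mono)
  qed
  then have "(\<Sum>k. \<integral>\<^sup>+ z. kernel_iter R k (\<lambda>_. 1) z \<partial>\<nu>) \<le> (\<integral>\<^sup>+ z. V z \<partial>\<nu>) + ?e"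
    by (intro suminf_le_const) auto
  also have "(\<Sum>k. \<integral>\<^sup>+ z. kernel_iter R k (\<lambda>_. 1) z \<partial>\<nu>) = occ (indicator (space S))"
    unfolding occ_def[symmetric] by (rule occ_cong) simp
  finally show ?thesis
    using V_int_finite by (auto simp: emeasure_\<mu> less_top intro: le_less_trans)
qed

text \<open>Applying \<open>P\<close> shifts the series that defines \<open>\<mu>\<close> by one
  index through \<open>R\<close>. The missing first term is \<open>\<nu>\<close>, and the
  regeneration part restores it with weight 1 by \<open>occ_C\<close>.\<close>

lemma \<mu>_invariant:
  assumes A: "A \<in> sets S"
  shows "(\<integral>\<^sup>+ z. emeasure (P z) A \<partial>\<mu>) = emeasure \<mu> A"
proof -
  let ?R = "\<lambda>z. \<integral>\<^sup>+ y. indicator A y \<partial>R z" and ?i = "\<lambda>n. \<integral>\<^sup>+ z. kernel_iter R n (indicator A) z \<partial>\<nu>"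
  have RA: "?R \<in> borel_measurable S"
    using A by (intro borel_measurable_kernel_int[OF R_subprob]) auto
  have mm: "g \<in> borel_measurable \<mu>" if "g \<in> borel_measurable S" for g :: "'z \<Rightarrow> ennreal"
    using measurable_cong_sets[OF sets_\<mu> refl] that by blast
  have "(\<integral>\<^sup>+ z. emeasure (P z) A \<partial>\<mu>)
     = (\<integral>\<^sup>+ z. ?R z + (ennreal \<epsilon> * emeasure \<nu> A) * indicator C z \<partial>\<mu>)"
    using A by (intro nn_integral_cong)
      (simp add: space_\<mu> emeasure_P_decomp sets_R nn_integral_indicator ac_simps)
  also have "\<dots> = (\<integral>\<^sup>+ z. ?R z \<partial>\<mu>) + (ennreal \<epsilon> * emeasure \<nu> A) * emeasure \<mu> C"
    using mm[OF RA] C_sets sets_\<mu> by (subst nn_integral_add) (auto simp: nn_integral_cmult_indicator)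
  also have "(ennreal \<epsilon> * emeasure \<nu> A) * emeasure \<mu> C = emeasure \<nu> A"
    using occ_C by (metis mult.assoc mult.commute mult_1)
  also have "(\<integral>\<^sup>+ z. ?R z \<partial>\<mu>) = (\<Sum>n. ?i (Suc n))"
    unfolding nn_integral_\<mu>[OF RA] occ_def kernel_iter_Suc2 ..
  also have "(\<Sum>n. ?i (Suc n)) + emeasure \<nu> A = (\<Sum>n. ?i n)"
    using A \<nu>_sets suminf_offset[of ?i 1] by (simp add: nn_integral_indicator)
  also have "\<dots> = emeasure \<mu> A" using A by (simp add: emeasure_\<mu> occ_def)
  finally show ?thesis .
qed

text \<open>Iterating \<open>\<pi> = \<pi> R + \<epsilon> \<pi>(C) \<nu>\<close> produces the
  partial sums of \<open>\<mu>\<close> and a remainder \<open>\<pi> R^n\<close>, which vanishes.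
  Every invariant law is therefore a multiple of \<open>\<mu>\<close>, and only the factor remains
  to be fixed.\<close>

lemma invariant_prob_eq:
  assumes "invariant_prob S P \<pi>" and A: "A \<in> sets S"
  shows "emeasure \<pi> A = ennreal \<epsilon> * emeasure \<pi> C * emeasure \<mu> A"
proof -
  have \<pi>: "prob_space \<pi>" and s: "sets \<pi> = sets S"
    and inv: "\<And>B. B \<in> sets S \<Longrightarrow> emeasure \<pi> B = (\<integral>\<^sup>+ z. emeasure (P z) B \<partial>\<pi>)"
    using assms(1) unfolding invariant_prob_def by auto
  interpret prob_space \<pi> using \<pi> .
  have sp: "space \<pi> = space S" using s by (rule sets_eq_imp_space_eq)
  have bm: "g \<in> borel_measurable \<pi>" if "g \<in> borel_measurable S" for g :: "'z \<Rightarrow> ennreal"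
    using measurable_cong_sets[OF s refl] that by blast
  let ?f = "\<lambda>n. kernel_iter R n (indicator A)"
  let ?c = "ennreal \<epsilon> * emeasure \<pi> C"
  have fm: "?f n \<in> borel_measurable S" for n
    using A by (intro borel_measurable_kernel_iter[OF R_subprob]) auto
  have P\<pi>: "P \<in> \<pi> \<rightarrow>\<^sub>M subprob_algebra S"
    using P_subprob measurable_cong_sets[OF s refl] by blast
  have "sets (\<pi> \<bind> P) = sets S"
    using sets_P sp not_empty by (intro sets_bind) auto
  \<comment> \<open>Invariance is given for sets; in the form \<open>\<pi> = \<pi> \<bind> P\<close>
    it applies to integrals of functions.\<close>
  then have bind: "\<pi> = \<pi> \<bind> P"
    using inv s not_empty by (intro measure_eqI) (simp_all add: emeasure_bind[OF _ P\<pi>])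
  have int: "(\<integral>\<^sup>+ z. f z \<partial>\<pi>) = (\<integral>\<^sup>+ z. (\<integral>\<^sup>+ y. f y \<partial>R z) \<partial>\<pi>) + ?c * (\<integral>\<^sup>+ z. f z \<partial>\<nu>)"
    if f: "f \<in> borel_measurable S" for f
  proof -
    have "(\<integral>\<^sup>+ z. f z \<partial>\<pi>) = (\<integral>\<^sup>+ z. f z \<partial>(\<pi> \<bind> P))" using bind by simp
    also have "\<dots> = (\<integral>\<^sup>+ z. (\<integral>\<^sup>+ y. f y \<partial>P z) \<partial>\<pi>)"
      using f P_subprob not_empty measurable_cong_sets[OF s refl] by (intro nn_integral_bind[where B=S]) blast+
    also have "\<dots> = (\<integral>\<^sup>+ z. (\<integral>\<^sup>+ y. f y \<partial>R z) + (ennreal \<epsilon> * (\<integral>\<^sup>+ z. f z \<partial>\<nu>)) * indicator C z \<partial>\<pi>)"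
      by (intro nn_integral_cong) (simp add: sp nn_integral_P_decomp[OF _ f] ac_simps)
    also have "\<dots> = (\<integral>\<^sup>+ z. (\<integral>\<^sup>+ y. f y \<partial>R z) \<partial>\<pi>) + (ennreal \<epsilon> * (\<integral>\<^sup>+ z. f z \<partial>\<nu>)) * emeasure \<pi> C"
      using bm[OF borel_measurable_kernel_int[OF R_subprob f]] C_sets s
      by (subst nn_integral_add) (auto simp: nn_integral_cmult_indicator)
    finally show ?thesis by (simp add: ac_simps)
  qed
  have sum: "emeasure \<pi> A = (\<integral>\<^sup>+ z. ?f n z \<partial>\<pi>) + ?c * (\<Sum>k<n. \<integral>\<^sup>+ z. ?f k z \<partial>\<nu>)" for n
  proof (induction n)
    case 0
    then show ?case using A s by (simp add: nn_integral_indicator)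
  next
    case (Suc n)
    then show ?case using int[OF fm[of n]] by (simp add: distrib_left ac_simps)
  qed
  have "(\<lambda>n. \<integral>\<^sup>+ z. ?f n z \<partial>\<pi>) \<longlonglongrightarrow> 0"
    using A s finite_measure_axioms by (intro R_iter_int_tendsto_0) (auto split: split_indicator)
  moreover have "(\<lambda>n. ?c * (\<Sum>k<n. \<integral>\<^sup>+ z. ?f k z \<partial>\<nu>)) \<longlonglongrightarrow> ?c * (\<Sum>k. \<integral>\<^sup>+ z. ?f k z \<partial>\<nu>)"
    by (intro ennreal_tendsto_cmult summable_LIMSEQ) (auto simp: emeasure_eq_measure ennreal_mult_less_top)
  ultimately have "(\<lambda>n. (\<integral>\<^sup>+ z. ?f n z \<partial>\<pi>) + ?c * (\<Sum>k<n. \<integral>\<^sup>+ z. ?f k z \<partial>\<nu>))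
      \<longlonglongrightarrow> 0 + ?c * (\<Sum>k. \<integral>\<^sup>+ z. ?f k z \<partial>\<nu>)"
    by (rule tendsto_add)
  then have "emeasure \<pi> A = ?c * (\<Sum>k. \<integral>\<^sup>+ z. ?f k z \<partial>\<nu>)"
    unfolding sum[symmetric] by (simp add: LIMSEQ_const_iff)
  then show ?thesis using A by (simp add: emeasure_\<mu> occ_def)
qed

theorem ex1_invariant_prob: "\<exists>!\<pi>. invariant_prob S P \<pi>"
proof (rule ex_ex1I)
  let ?m = "emeasure \<mu> (space S)"
  have fin: "?m < \<infinity>" by (rule emeasure_\<mu>_space_finite)
  have pos: "?m \<noteq> 0"
  proof
    assume "?m = 0"
    then have "emeasure \<mu> C = 0"
      using C_subset emeasure_mono[of C "space S" \<mu>] by (simp add: sets_\<mu>)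
    then show False using occ_C by simp
  qed
  define \<pi> where "\<pi> = scale_measure (1 / ?m) \<mu>"
  have "prob_space \<pi>"
    using fin pos by (intro prob_spaceI)
      (simp add: \<pi>_def space_scale_measure space_\<mu> ennreal_divide_times ennreal_divide_self)
  moreover have "emeasure \<pi> B = (\<integral>\<^sup>+ z. emeasure (P z) B \<partial>\<pi>)" if B: "B \<in> sets S" for B
  proof -
    have "(\<lambda>z. emeasure (P z) B) \<in> borel_measurable \<mu>"
      using measurable_emeasure_kernel[OF P_subprob B] measurable_cong_sets[OF sets_\<mu> refl] by blast
    then show ?thesis
      using \<mu>_invariant[OF B] by (simp add: \<pi>_def nn_integral_scale_measure)
  qed
  ultimately show "\<exists>\<pi>. invariant_prob S P \<pi>"
    unfolding invariant_prob_def by (auto simp: \<pi>_def sets_\<mu>)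
next
  fix \<pi> \<pi>' assume inv: "invariant_prob S P \<pi>" "invariant_prob S P \<pi>'"
  let ?m = "emeasure \<mu> (space S)" and ?c = "\<lambda>\<pi>. ennreal \<epsilon> * emeasure \<pi> C"
  have c: "?c \<pi> * ?m = 1" if "invariant_prob S P \<pi>" for \<pi>
  proof -
    have "emeasure \<pi> (space \<pi>) = 1" "sets \<pi> = sets S"
      using that prob_space.emeasure_space_1 unfolding invariant_prob_def by auto
    then show ?thesis
      using invariant_prob_eq[OF that, of "space S"] sets_eq_imp_space_eq[of \<pi> S] by simp
  qed
  \<comment> \<open>Both factors are inverses of the same mass \<open>?m\<close>; associativity
    shows that they agree without a division in \<open>ennreal\<close>.\<close>
  have "?c \<pi> = ?c \<pi> * (?m * ?c \<pi>')" using c[OF inv(2)] by (simp add: mult.commute)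
  also have "\<dots> = ?c \<pi>'" using c[OF inv(1)] by (simp add: mult.assoc[symmetric])
  finally have "?c \<pi> = ?c \<pi>'" .
  then have "emeasure \<pi> A = emeasure \<pi>' A" if "A \<in> sets S" for A
    using invariant_prob_eq[OF _ that] inv by simp
  then show "\<pi> = \<pi>'"
    using inv unfolding invariant_prob_def by (intro measure_eqI) auto
qed

end

section \<open>Uniform reachability\<close>

lemma avoid_le_one:
  assumes P: "P \<in> S \<rightarrow>\<^sub>M subprob_algebra S" and "z \<in> space S"
  shows "avoid S P C n z \<le> 1"
  using assms(2)
proof (induction n arbitrary: z)
  case (Suc n)
  interpret subprob_space "P z" using subprob_space_kernel[OF P Suc.prems] .
  have "(\<integral>\<^sup>+ y. avoid S P C n y \<partial>P z) \<le> 1"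
    using Suc by (intro nn_integral_le_const AE_I2) (auto simp: space_subkernel[OF P])
  then show ?case by (auto split: split_indicator)
qed (auto split: split_indicator)

lemma avoid_Suc_le:
  assumes P: "P \<in> S \<rightarrow>\<^sub>M subprob_algebra S" and "z \<in> space S"
  shows "avoid S P C (Suc n) z \<le> avoid S P C n z"
  using assms(2)
proof (induction n arbitrary: z)
  case 0
  interpret subprob_space "P z" using subprob_space_kernel[OF P 0] .
  have "(\<integral>\<^sup>+ y. indicator (space S - C) y \<partial>P z) \<le> 1"
    by (intro nn_integral_le_const AE_I2) (auto split: split_indicator)
  then show ?case by (auto split: split_indicator)
next
  case (Suc n)
  have "(\<integral>\<^sup>+ y. avoid S P C (Suc n) y \<partial>P z) \<le> (\<integral>\<^sup>+ y. avoid S P C n y \<partial>P z)"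
    using Suc by (intro nn_integral_mono) (auto simp: space_subkernel[OF P])
  then show ?case unfolding avoid.simps(2)[of _ _ _ "Suc n"] avoid.simps(2)[of _ _ _ n]
    by (intro mult_left_mono) auto
qed

lemma avoid_antimono:
  assumes P: "P \<in> S \<rightarrow>\<^sub>M subprob_algebra S" and "z \<in> space S" "m \<le> n"
  shows "avoid S P C n z \<le> avoid S P C m z"
  using assms(3)
  by (rule lift_Suc_antimono_le[rotated]) (rule avoid_Suc_le[OF P assms(2)])

text \<open>One time bound and one probability serve all of \<open>F\<close>; hitting state by state
  would not give a bounded correction of the Lyapunov function. The bound
  \<open>\<gamma> \<le> 1\<close> keeps \<open>ennreal (1 - \<gamma>)\<close> free of
  truncation.\<close>

definition uniformly_reaches :: "'z measure \<Rightarrow> ('z \<Rightarrow> 'z measure) \<Rightarrow> 'z set \<Rightarrow> 'z set \<Rightarrow> bool" where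
  "uniformly_reaches S P C F \<longleftrightarrow>
    (\<exists>n. \<exists>\<gamma>>0. \<gamma> \<le> 1 \<and> (\<forall>z\<in>F \<inter> space S. avoid S P C n z \<le> ennreal (1 - \<gamma>)))"

lemma uniformly_reaches_self: "uniformly_reaches S P C C"
  unfolding uniformly_reaches_def by (intro exI[of _ 0] exI[of _ 1]) auto

lemma uniformly_reaches_subset:
  "uniformly_reaches S P C F \<Longrightarrow> F' \<subseteq> F \<Longrightarrow> uniformly_reaches S P C F'"
  unfolding uniformly_reaches_def by blast

lemma uniformly_reaches_Un:
  assumes P: "P \<in> S \<rightarrow>\<^sub>M subprob_algebra S"
    and "uniformly_reaches S P C F" "uniformly_reaches S P C F'"
  shows "uniformly_reaches S P C (F \<union> F')"
proof -
  obtain n \<gamma> n' \<gamma>' where *: "0 < \<gamma>" "\<gamma> \<le> 1" "\<forall>z\<in>F \<inter> space S. avoid S P C n z \<le> ennreal (1 - \<gamma>)"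
     "0 < \<gamma>'" "\<gamma>' \<le> 1" "\<forall>z\<in>F' \<inter> space S. avoid S P C n' z \<le> ennreal (1 - \<gamma>')"
    using assms(2,3) unfolding uniformly_reaches_def by blast
  have "avoid S P C (max n n') z \<le> ennreal (1 - min \<gamma> \<gamma>')" if z: "z \<in> (F \<union> F') \<inter> space S" for z
  proof (cases "z \<in> F")
    case True
    have "avoid S P C (max n n') z \<le> avoid S P C n z" using z by (intro avoid_antimono[OF P]) auto
    also have "\<dots> \<le> ennreal (1 - \<gamma>)" using * True z by auto
    also have "\<dots> \<le> ennreal (1 - min \<gamma> \<gamma>')" by (intro ennreal_leI) auto
    finally show ?thesis .
  next
    case False
    have "avoid S P C (max n n') z \<le> avoid S P C n' z" using z by (intro avoid_antimono[OF P]) auto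
    also have "\<dots> \<le> ennreal (1 - \<gamma>')" using * False z by auto
    also have "\<dots> \<le> ennreal (1 - min \<gamma> \<gamma>')" by (intro ennreal_leI) auto
    finally show ?thesis .
  qed
  then show ?thesis
    unfolding uniformly_reaches_def using *
    by (intro exI[of _ "max n n'"] exI[of _ "min \<gamma> \<gamma>'"]) auto
qed

lemma uniformly_reaches_UN:
  assumes P: "P \<in> S \<rightarrow>\<^sub>M subprob_algebra S" and "finite I"
    and "\<And>i. i \<in> I \<Longrightarrow> uniformly_reaches S P C (F i)"
  shows "uniformly_reaches S P C (\<Union>i\<in>I. F i)"
  using assms(2,3)
proof (induction I)
  case empty
  show ?case unfolding uniformly_reaches_def by (intro exI[of _ 0] exI[of _ 1]) auto
next
  case (insert i I)
  then show ?case using uniformly_reaches_Un[OF P, of C "F i"] by auto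
qed

text \<open>Backward propagation: jumping into \<open>F'\<close> with probability \<open>c\<close>
  and then meeting \<open>C\<close> with probability \<open>\<gamma>\<close> succeeds with at least
  the product. All reachability claims are chains of such steps.\<close>

lemma uniformly_reaches_step:
  assumes P: "P \<in> S \<rightarrow>\<^sub>M subprob_algebra S" and C: "C \<in> sets S"
    and F': "uniformly_reaches S P C F'" "F' \<in> sets S"
    and c: "c > 0" "\<And>z. z \<in> F \<Longrightarrow> z \<in> space S \<Longrightarrow> emeasure (P z) F' \<ge> ennreal c"
  shows "uniformly_reaches S P C F"
proof -
  obtain n \<gamma> where *: "0 < \<gamma>" "\<gamma> \<le> 1" "\<forall>z\<in>F' \<inter> space S. avoid S P C n z \<le> ennreal (1 - \<gamma>)"
    using F' unfolding uniformly_reaches_def by blast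
  \<comment> \<open>The given \<open>c\<close> can exceed 1 when \<open>F\<close> contains no state;
    the cut keeps \<open>\<gamma> * ?c \<le> 1\<close>.\<close>
  let ?c = "min c 1"
  have "avoid S P C (Suc n) z \<le> ennreal (1 - \<gamma> * ?c)" if z: "z \<in> F \<inter> space S" for z
  proof -
    interpret subprob_space "P z" using subprob_space_kernel[OF P] z by blast
    have sp: "space (P z) = space S" "sets (P z) = sets S"
      using sets_kernel[OF P] space_subkernel[OF P] z by auto
    have am: "avoid S P C n \<in> borel_measurable (P z)"
      using borel_measurable_subkernel[OF P borel_measurable_avoid[OF P C]] z by auto
    have pF: "?c \<le> measure (P z) F'"
      using c(2)[of z] z c(1) by (auto simp: emeasure_eq_measure)
    have "avoid S P C (Suc n) z \<le> (\<integral>\<^sup>+ y. avoid S P C n y \<partial>P z)"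
      by (auto split: split_indicator)
    also have "\<dots> \<le> (\<integral>\<^sup>+ y. ennreal (1 - \<gamma>) * indicator F' y + indicator (space S - F') y \<partial>P z)"
      using * avoid_le_one[OF P] by (intro nn_integral_mono) (auto simp: sp split: split_indicator)
    also have "\<dots> = ennreal (1 - \<gamma>) * emeasure (P z) F' + emeasure (P z) (space S - F')"
      using F'(2) sp by (subst nn_integral_add) (auto simp: nn_integral_cmult_indicator)
    also have "\<dots> = ennreal ((1 - \<gamma>) * measure (P z) F' + (measure (P z) (space S) - measure (P z) F'))"
      using * F'(2) sp finite_measure_Diff[of "space S" F'] sets.sets_into_space[OF F'(2)]
        measure_nonneg[of "P z" "space S - F'"]
      by (subst ennreal_plus) (auto simp: emeasure_eq_measure ennreal_mult' )
    also have "\<dots> \<le> ennreal (1 - \<gamma> * ?c)"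
    proof (rule ennreal_leI)
      have "\<gamma> * ?c \<le> \<gamma> * measure (P z) F'" using pF * by (intro mult_left_mono) auto
      then show "(1 - \<gamma>) * measure (P z) F' + (measure (P z) (space S) - measure (P z) F') \<le> 1 - \<gamma> * ?c"
        unfolding left_diff_distrib using subprob_measure_le_1[of "space S"] by linarith
    qed
    finally show ?thesis .
  qed
  then show ?thesis
    unfolding uniformly_reaches_def using * c(1)
    by (intro exI[of _ "Suc n"] exI[of _ "\<gamma> * ?c"]) (auto simp: mult_le_one)
qed

text \<open>Adding a multiple of the truncated expected hitting time of \<open>C\<close> to a Lyapunov function that
  drifts to \<open>D\<close> yields one that drifts to \<open>C\<close>.\<close>

lemma drift_transfer:
  assumes P: "P \<in> S \<rightarrow>\<^sub>M subprob_algebra S" and Pp: "\<And>z. z \<in> space S \<Longrightarrow> prob_space (P z)"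
    and C: "C \<in> sets S" and D: "uniformly_reaches S P C D" and b: "b \<ge> 0"
    and V: "V \<in> borel_measurable S" and Vfin: "\<And>z. z \<in> space S \<Longrightarrow> V z < \<infinity>"
    and drift: "\<And>z. z \<in> space S \<Longrightarrow> (\<integral>\<^sup>+ y. V y \<partial>P z) + 1 \<le> V z + ennreal b * indicator D z"
  obtains V' b' where "V' \<in> borel_measurable S" "\<And>z. z \<in> space S \<Longrightarrow> V' z < \<infinity>"
    "\<And>z. z \<in> space S \<Longrightarrow> (\<integral>\<^sup>+ y. V' y \<partial>P z) + 1 \<le> V' z + ennreal b' * indicator C z"
proof -
  obtain N \<gamma> where \<gamma>: "0 < \<gamma>" "\<gamma> \<le> 1" "\<forall>z\<in>D \<inter> space S. avoid S P C N z \<le> ennreal (1 - \<gamma>)"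
    using D unfolding uniformly_reaches_def by blast
  \<comment> \<open>The truncated hitting time \<open>G\<close> below falls in mean by at least
    \<open>\<gamma>\<close> on \<open>D\<close> off \<open>C\<close>; the scaling makes this fall
    cancel the excess \<open>b\<close>.\<close>
  define c where "c = b / \<gamma>"
  have c: "c \<ge> 0" "c * \<gamma> = b" using \<gamma> b by (auto simp: c_def)
  define q where "q = avoid S P C"
  define G where "G z = (\<Sum>k<N. q k z)" for z
  have qm: "q k \<in> borel_measurable S" for k unfolding q_def by (rule borel_measurable_avoid[OF P C])
  have Gm: "G \<in> borel_measurable S" unfolding G_def using qm by auto
  have GN: "G z \<le> ennreal (real N)" if "z \<in> space S" for z
  proof -
    have "G z \<le> (\<Sum>k<N. 1)"
      unfolding G_def q_def by (intro sum_mono avoid_le_one[OF P that])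
    then show ?thesis by (simp add: ennreal_of_nat_eq_real_of_nat)
  qed
  have PG: "(\<integral>\<^sup>+ y. G y \<partial>P z) \<le> ennreal (real N)" if z: "z \<in> space S" for z
  proof -
    interpret prob_space "P z" using Pp z .
    show ?thesis using GN by (intro nn_integral_le_const AE_I2) (auto simp: space_subkernel[OF P z])
  qed
  \<comment> \<open>Shifting the sum drops the time-0 term, which is 1 off \<open>C\<close>, and
    adds \<open>q N z\<close>. As \<open>q N z\<close> is at most 1, and at most
    \<open>1 - \<gamma>\<close> on \<open>D\<close>, the function \<open>G\<close> never rises in
    mean off \<open>C\<close>.\<close>
  have PG1: "(\<integral>\<^sup>+ y. G y \<partial>P z) + 1 = G z + q N z" if z: "z \<in> space S" "z \<notin> C" for z
  proof -
    have "(\<integral>\<^sup>+ y. G y \<partial>P z) = (\<Sum>k<N. \<integral>\<^sup>+ y. q k y \<partial>P z)"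
      unfolding G_def using borel_measurable_subkernel[OF P qm z(1)] by (intro nn_integral_sum) auto
    also have "\<dots> = (\<Sum>k<N. q (Suc k) z)" using z by (simp add: q_def)
    finally have "(\<integral>\<^sup>+ y. G y \<partial>P z) + 1 = (\<Sum>k<N. q (Suc k) z) + q 0 z" using z by (simp add: q_def)
    also have "\<dots> = (\<Sum>k<Suc N. q k z)" by (subst sum.lessThan_Suc_shift) (simp add: add.commute)
    finally show ?thesis by (simp add: G_def)
  qed
  define V' where "V' z = V z + ennreal c * G z" for z
  \<comment> \<open>On \<open>C\<close> the correction may rise, but its mean after a step is at
    most \<open>c * real N\<close>, which goes into the constant.\<close>
  define b' where "b' = b + c * real N"
  show ?thesis
  proof (rule that[of V' b'])
    show "V' \<in> borel_measurable S" unfolding V'_def using V Gm by auto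
    show "V' z < \<infinity>" if "z \<in> space S" for z
      using Vfin[OF that] GN[OF that] by (auto simp: V'_def ennreal_mult_less_top intro: le_less_trans)
    fix z assume z: "z \<in> space S"
    have "(\<integral>\<^sup>+ y. V' y \<partial>P z) + 1 = ((\<integral>\<^sup>+ y. V y \<partial>P z) + 1) + ennreal c * (\<integral>\<^sup>+ y. G y \<partial>P z)"
      unfolding V'_def using borel_measurable_subkernel[OF P V z] borel_measurable_subkernel[OF P Gm z]
      by (simp add: nn_integral_add nn_integral_cmult ac_simps)
    also have "\<dots> \<le> V z + ennreal b * indicator D z + ennreal c * (\<integral>\<^sup>+ y. G y \<partial>P z)"
      using drift[OF z] by (rule add_right_mono)
    also have "\<dots> \<le> V' z + ennreal b' * indicator C z"
    proof (cases "z \<in> C")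
      case True
      have "ennreal b * indicator D z \<le> ennreal b" by (auto split: split_indicator)
      moreover have "ennreal c * (\<integral>\<^sup>+ y. G y \<partial>P z) \<le> ennreal c * ennreal (real N)"
        using PG[OF z] by (rule mult_left_mono) simp
      ultimately have "V z + ennreal b * indicator D z + ennreal c * (\<integral>\<^sup>+ y. G y \<partial>P z)
         \<le> V z + (ennreal b + ennreal c * ennreal (real N))"
        by (simp add: add_mono add.assoc)
      also have "ennreal b + ennreal c * ennreal (real N) = ennreal b'"
        using b c by (simp add: b'_def ennreal_mult)
      also have "V z + ennreal b' \<le> V' z + ennreal b'" unfolding V'_def by (intro add_right_mono) simp
      finally show ?thesis using True by simp
    next
      case False
      have "ennreal b * indicator D z + ennreal c * (\<integral>\<^sup>+ y. G y \<partial>P z) \<le> ennreal c * G z"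
      proof (cases "z \<in> D")
        case True
        have "(\<integral>\<^sup>+ y. G y \<partial>P z) + ennreal \<gamma> + q N z \<le> (\<integral>\<^sup>+ y. G y \<partial>P z) + (ennreal \<gamma> + ennreal (1 - \<gamma>))"
          using \<gamma>(3) True z by (simp add: add.assoc add_left_mono q_def)
        also have "ennreal \<gamma> + ennreal (1 - \<gamma>) = 1" using \<gamma> by (simp flip: ennreal_plus)
        also note PG1[OF z False]
        finally have "q N z + ((\<integral>\<^sup>+ y. G y \<partial>P z) + ennreal \<gamma>) \<le> q N z + G z"
          by (simp add: ac_simps)
        then have "(\<integral>\<^sup>+ y. G y \<partial>P z) + ennreal \<gamma> \<le> G z"
          using avoid_le_one[OF P z, of C N]
          unfolding ennreal_add_left_cancel_le by (auto simp: q_def top_unique)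
        then have "ennreal c * ((\<integral>\<^sup>+ y. G y \<partial>P z) + ennreal \<gamma>) \<le> ennreal c * G z"
          by (rule mult_left_mono) simp
        moreover have "ennreal c * ennreal \<gamma> = ennreal b" using c \<gamma> by (simp flip: ennreal_mult')
        ultimately show ?thesis using True by (simp add: distrib_left ac_simps)
      next
        case D: False
        have "(\<integral>\<^sup>+ y. G y \<partial>P z) + 1 \<le> G z + 1"
          unfolding PG1[OF z False] using avoid_le_one[OF P z, of C N] by (simp add: q_def add_left_mono)
        then have "(\<integral>\<^sup>+ y. G y \<partial>P z) \<le> G z" by simp
        then show ?thesis using D by (simp add: mult_left_mono)
      qed
      then have "V z + (ennreal b * indicator D z + ennreal c * (\<integral>\<^sup>+ y. G y \<partial>P z)) \<le> V' z"
        unfolding V'_def by (rule add_left_mono)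
      then show ?thesis using False by (simp add: add.assoc)
    qed
    finally show "(\<integral>\<^sup>+ y. V' y \<partial>P z) + 1 \<le> V' z + ennreal b' * indicator C z" .
  qed
qed

section \<open>Chains driven by independent noise\<close>

lemma space_history: "space (history M S X t) = space M"
  by (simp add: history_def space_measure_of_conv)

lemma sets_history:
  "sets (history M S X t) = sigma_sets (space M) (\<Union>i\<le>t. {X i -` B \<inter> space M |B. B \<in> sets S})"
  unfolding history_def by (rule sets_measure_of) auto

locale driven_chain = prob_space M for M :: "'w measure" +
  fixes N :: "'n measure" and \<zeta> :: "'n measure" and \<xi> :: "nat \<Rightarrow> 'w \<Rightarrow> 'n"
    and S :: "'z measure" and F :: "'z \<Rightarrow> 'n \<Rightarrow> 'z" and X :: "nat \<Rightarrow> 'w \<Rightarrow> 'z" and z :: 'z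
  assumes indep: "\<And>t. indep_vars (\<lambda>_. N) \<xi> {..t}"
    and law: "\<And>t. distr M N (\<xi> t) = \<zeta>"
    and F_meas: "(\<lambda>(x, w). F x w) \<in> S \<Otimes>\<^sub>M N \<rightarrow>\<^sub>M S"
    and z: "z \<in> space S"
    and X_0: "\<And>\<omega>. X 0 \<omega> = z" and X_Suc: "\<And>t \<omega>. X (Suc t) \<omega> = F (X t \<omega>) (\<xi> t \<omega>)"
begin

text \<open>Generated by the noise before time \<open>t\<close>, this sigma-algebra contains the
  history of the chain. Independence from \<open>\<xi> t\<close> can be read off here, whereas the
  history is known only through the states.\<close>

definition past :: "nat \<Rightarrow> 'w measure" where
  "past t = vimage_algebra (space M) (\<lambda>\<omega>. \<lambda>i\<in>{..<t}. \<xi> i \<omega>) (Pi\<^sub>M {..<t} (\<lambda>_. N))"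

lemma space_past: "space (past t) = space M"
  by (simp add: past_def)

lemma \<xi>_meas: "\<xi> t \<in> M \<rightarrow>\<^sub>M N"
  using indep[of t] by (simp add: indep_vars_def)

lemma sets_\<zeta>: "sets \<zeta> = sets N"
  using law[of 0] by auto

lemma prob_space_\<zeta>: "prob_space \<zeta>"
  using prob_space_distr[OF \<xi>_meas] law by metis

lemma past_space: "(\<lambda>\<omega>. \<lambda>i\<in>J. \<xi> i \<omega>) \<in> space M \<rightarrow> space (Pi\<^sub>M J (\<lambda>_. N))"
  by (intro Pi_I measurable_space[OF measurable_restrict[OF \<xi>_meas]])

lemma \<xi>_past: "i < t \<Longrightarrow> \<xi> i \<in> past t \<rightarrow>\<^sub>M N"
proof -
  assume i: "i < t"
  have "(\<lambda>\<omega>. \<lambda>i\<in>{..<t}. \<xi> i \<omega>) \<in> past t \<rightarrow>\<^sub>M Pi\<^sub>M {..<t} (\<lambda>_. N)"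
    unfolding past_def by (intro measurable_vimage_algebra1 past_space)
  from measurable_compose[OF this measurable_component_singleton[of i]] i
  show ?thesis by simp
qed

lemma X_past: "s \<le> t \<Longrightarrow> X s \<in> past t \<rightarrow>\<^sub>M S"
proof (induction s)
  case 0
  have "(\<lambda>\<omega>. z) \<in> past t \<rightarrow>\<^sub>M S" using z by simp
  also have "(\<lambda>\<omega>. z) = X 0" by (simp add: X_0 fun_eq_iff)
  finally show ?case .
next
  case (Suc s)
  have "(\<lambda>\<omega>. (X s \<omega>, \<xi> s \<omega>)) \<in> past t \<rightarrow>\<^sub>M S \<Otimes>\<^sub>M N"
    using Suc \<xi>_past by (intro measurable_Pair) auto
  from measurable_compose[OF this F_meas] show ?case
    by (simp add: X_Suc[abs_def])
qed

lemma history_subset_past: "sets (history M S X t) \<subseteq> sets (past t)"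
proof -
  have "sigma_sets (space (past t)) (\<Union>i\<le>t. {X i -` B \<inter> space M |B. B \<in> sets S}) \<subseteq> sets (past t)"
  proof (rule sets.sigma_sets_subset, clarify)
    fix i B assume "i \<le> t" "B \<in> sets S"
    then show "X i -` B \<inter> space M \<in> sets (past t)"
      using measurable_sets[OF X_past[of i t], of B] by (simp only: space_past)
  qed
  then show ?thesis
    unfolding sets_history space_past .
qed

lemma past_subset: "sets (past t) \<subseteq> events"
proof -
  have "(\<lambda>\<omega>. \<lambda>i\<in>{..<t}. \<xi> i \<omega>) \<in> M \<rightarrow>\<^sub>M Pi\<^sub>M {..<t} (\<lambda>_. N)"
    using \<xi>_meas by (intro measurable_restrict) auto
  then show ?thesis
    unfolding past_def by (subst sets_vimage_algebra2) (auto simp: measurable_def)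
qed

lemma id_past: "(\<lambda>\<omega>. \<omega>) \<in> M \<rightarrow>\<^sub>M past t"
  using past_subset by (intro measurableI) (auto simp: space_past sets.Int_space_eq2)

lemma X_meas: "X t \<in> M \<rightarrow>\<^sub>M S"
  using measurable_compose[OF id_past X_past[OF order_refl]] .

text \<open>A past event depends only on the noise block \<open>{..<t}\<close>, which is disjoint
  from \<open>{t}\<close>.\<close>

lemma prob_past_next:
  assumes A: "A \<in> sets (past t)" and B: "B \<in> sets N"
  shows "prob (A \<inter> (\<xi> t -` B \<inter> space M)) = prob A * prob (\<xi> t -` B \<inter> space M)"
proof -
  let ?r = "\<lambda>J \<omega>. \<lambda>i\<in>J. \<xi> i \<omega>" and ?N = "\<lambda>A. Pi\<^sub>M A (\<lambda>_. N)"
  obtain E where E: "E \<in> sets (?N {..<t})" "A = ?r {..<t} -` E \<inter> space M"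
    using A unfolding past_def sets_vimage_algebra2[OF past_space] by blast
  let ?B = "(\<lambda>w. w t) -` B \<inter> space (?N {t})"
  have B': "?B \<in> sets (?N {t})"
    using B by (intro measurable_sets[OF measurable_component_singleton]) auto
  have \<xi>B: "\<xi> t -` B \<inter> space M = ?r {t} -` ?B \<inter> space M"
    using measurable_space[OF \<xi>_meas] by (auto simp: space_PiM)
  have "indep_var (?N {..<t}) (?r {..<t}) (?N {t}) (?r {t})"
    by (rule indep_var_restrict[OF indep[of t]]) auto
  from indep_varD[OF this E(1) B']
  have "prob ((\<lambda>\<omega>. (?r {..<t} \<omega>, ?r {t} \<omega>)) -` (E \<times> ?B) \<inter> space M)
    = prob A * prob (\<xi> t -` B \<inter> space M)"
    unfolding \<xi>B E(2) .
  also have "(\<lambda>\<omega>. (?r {..<t} \<omega>, ?r {t} \<omega>)) -` (E \<times> ?B) \<inter> space M = A \<inter> (\<xi> t -` B \<inter> space M)"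
    unfolding \<xi>B E(2) by auto
  finally show ?thesis .
qed

text \<open>The Markov property in integrated form. The identity map into \<open>past t\<close> is
  treated as a random variable: jointly with \<open>\<xi> t\<close> it has a product law, and
  Tonelli's theorem integrates out the new noise while the state at time \<open>t\<close> is
  frozen.\<close>

lemma nn_integral_next:
  assumes A: "A \<in> sets (past t)" and f: "f \<in> borel_measurable S"
  shows "(\<integral>\<^sup>+ \<omega>. indicator A \<omega> * f (X (Suc t) \<omega>) \<partial>M)
    = (\<integral>\<^sup>+ \<omega>. indicator A \<omega> * (\<integral>\<^sup>+ y. f y \<partial>distr \<zeta> S (F (X t \<omega>))) \<partial>M)"
proof -
  interpret \<zeta>: prob_space \<zeta> by (rule prob_space_\<zeta>)
  let ?g = "\<lambda>(\<omega>, w). indicator A \<omega> * f (F (X t \<omega>) w)"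
  have "(\<lambda>(\<omega>, w). (X t \<omega>, w)) \<in> past t \<Otimes>\<^sub>M N \<rightarrow>\<^sub>M S \<Otimes>\<^sub>M N"
    using X_past[OF order_refl, of t] by measurable
  from measurable_compose[OF this measurable_compose[OF F_meas f]]
  have "(\<lambda>p. f (F (X t (fst p)) (snd p))) \<in> borel_measurable (past t \<Otimes>\<^sub>M N)"
    by (simp add: split_beta' comp_def)
  moreover have "(\<lambda>p. indicator A (fst p) :: ennreal) \<in> borel_measurable (past t \<Otimes>\<^sub>M N)"
    using A by measurable
  ultimately have g: "?g \<in> borel_measurable (past t \<Otimes>\<^sub>M N)"
    by (auto simp: split_beta')
  have J: "distr M (past t \<Otimes>\<^sub>M N) (\<lambda>\<omega>. (\<omega>, \<xi> t \<omega>)) = distr M (past t) (\<lambda>\<omega>. \<omega>) \<Otimes>\<^sub>M \<zeta>"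
  proof (rule pair_measure_eqI[symmetric])
    show "sigma_finite_measure \<zeta>" ..
    interpret D: prob_space "distr M (past t) (\<lambda>\<omega>. \<omega>)" using id_past by (rule prob_space_distr)
    show "sigma_finite_measure (distr M (past t) (\<lambda>\<omega>. \<omega>))" ..
    show "sets (distr M (past t) (\<lambda>\<omega>. \<omega>) \<Otimes>\<^sub>M \<zeta>) = sets (distr M (past t \<Otimes>\<^sub>M N) (\<lambda>\<omega>. (\<omega>, \<xi> t \<omega>)))"
      unfolding sets_distr by (intro sets_pair_measure_cong) (auto simp: sets_\<zeta>)
    fix A B assume "A \<in> sets (distr M (past t) (\<lambda>\<omega>. \<omega>))" "B \<in> sets \<zeta>"
    then have AB: "A \<in> sets (past t)" "B \<in> sets N" by (auto simp: sets_\<zeta>)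
    have "emeasure (distr M (past t \<Otimes>\<^sub>M N) (\<lambda>\<omega>. (\<omega>, \<xi> t \<omega>))) (A \<times> B)
        = emeasure M ((\<lambda>\<omega>. (\<omega>, \<xi> t \<omega>)) -` (A \<times> B) \<inter> space M)"
      using AB id_past \<xi>_meas by (intro emeasure_distr measurable_Pair) auto
    also have "(\<lambda>\<omega>. (\<omega>, \<xi> t \<omega>)) -` (A \<times> B) \<inter> space M = A \<inter> (\<xi> t -` B \<inter> space M)"
      by auto
    also have "emeasure M \<dots> = emeasure M A * emeasure M (\<xi> t -` B \<inter> space M)"
      using prob_past_next[OF AB] by (simp add: emeasure_eq_measure ennreal_mult'')
    also have "emeasure M (\<xi> t -` B \<inter> space M) = emeasure \<zeta> B"
      using AB \<xi>_meas law[of t] emeasure_distr[of "\<xi> t" M N B] by simp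
    also have "emeasure M A = emeasure (distr M (past t) (\<lambda>\<omega>. \<omega>)) A"
      using AB id_past sets.sets_into_space[OF AB(1)] by (subst emeasure_distr) (auto simp: space_past Int_absorb2)
    finally show "emeasure (distr M (past t) (\<lambda>\<omega>. \<omega>)) A * emeasure \<zeta> B
      = emeasure (distr M (past t \<Otimes>\<^sub>M N) (\<lambda>\<omega>. (\<omega>, \<xi> t \<omega>))) (A \<times> B)" by simp
  qed
  have s: "sets (distr M (past t) (\<lambda>\<omega>. \<omega>) \<Otimes>\<^sub>M \<zeta>) = sets (past t \<Otimes>\<^sub>M N)"
    by (intro sets_pair_measure_cong) (auto simp: sets_\<zeta>)
  have "(\<integral>\<^sup>+ \<omega>. indicator A \<omega> * f (X (Suc t) \<omega>) \<partial>M) = (\<integral>\<^sup>+ \<omega>. ?g (\<omega>, \<xi> t \<omega>) \<partial>M)"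
    by (simp add: X_Suc)
  also have "\<dots> = (\<integral>\<^sup>+ p. ?g p \<partial>distr M (past t \<Otimes>\<^sub>M N) (\<lambda>\<omega>. (\<omega>, \<xi> t \<omega>)))"
    using g id_past \<xi>_meas by (intro nn_integral_distr[symmetric] measurable_Pair) auto
  also have "\<dots> = (\<integral>\<^sup>+ \<omega>. (\<integral>\<^sup>+ w. ?g (\<omega>, w) \<partial>\<zeta>) \<partial>distr M (past t) (\<lambda>\<omega>. \<omega>))"
    unfolding J using g measurable_cong_sets[OF s refl] by (intro \<zeta>.nn_integral_fst[symmetric]) blast
  also have "\<dots> = (\<integral>\<^sup>+ \<omega>. (\<integral>\<^sup>+ w. ?g (\<omega>, w) \<partial>\<zeta>) \<partial>M)"
    using g id_past measurable_cong_sets[OF s refl]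
    by (intro nn_integral_distr \<zeta>.borel_measurable_nn_integral_fst)
       (auto simp: measurable_cong_sets[OF sets_pair_measure_cong[OF refl sets_\<zeta>] refl])
  also have "\<dots> = (\<integral>\<^sup>+ \<omega>. indicator A \<omega> * (\<integral>\<^sup>+ y. f y \<partial>distr \<zeta> S (F (X t \<omega>))) \<partial>M)"
  proof (intro nn_integral_cong)
    fix \<omega> assume \<omega>: "\<omega> \<in> space M"
    have F: "F (X t \<omega>) \<in> \<zeta> \<rightarrow>\<^sub>M S"
      using measurable_compose[OF measurable_Pair1'[of "X t \<omega>" S N] F_meas] measurable_space[OF X_meas \<omega>]
      measurable_cong_sets[OF sets_\<zeta> refl] by auto
    then show "(\<integral>\<^sup>+ w. ?g (\<omega>, w) \<partial>\<zeta>) = indicator A \<omega> * (\<integral>\<^sup>+ y. f y \<partial>distr \<zeta> S (F (X t \<omega>)))"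
      using f measurable_compose[OF F f] by (simp add: nn_integral_distr nn_integral_cmult)
  qed
  finally show ?thesis .
qed

lemma kernel_prob: "(\<lambda>x. distr \<zeta> S (F x)) \<in> S \<rightarrow>\<^sub>M prob_algebra S"
proof (rule measurable_distr_prob_space2[where M=N])
  show "(\<lambda>x. \<zeta>) \<in> S \<rightarrow>\<^sub>M prob_algebra N"
    using sets_\<zeta> prob_space_\<zeta> by (intro measurable_const) (simp add: space_prob_algebra)
qed (rule F_meas)

text \<open>A conditional probability is identified by its integrals over the events of the history;
  these are events of \<open>past t\<close>, where \<open>nn_integral_next\<close> applies.\<close>

lemma markov_chain_driven: "markov_chain M S (\<lambda>x. distr \<zeta> S (F x)) X"
  unfolding markov_chain_def
proof (intro conjI allI ballI)
  let ?P = "\<lambda>x. distr \<zeta> S (F x)"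
  show "prob_space M" by (rule prob_space_axioms)
  show "?P \<in> S \<rightarrow>\<^sub>M prob_algebra S" by (rule kernel_prob)
  show "X t \<in> M \<rightarrow>\<^sub>M S" for t by (rule X_meas)
  fix t B assume B: "B \<in> sets S"
  let ?H = "history M S X t"
  have H: "subalgebra M ?H"
    unfolding subalgebra_def
  proof
    show "space ?H = space M" by (rule space_history)
    show "sets ?H \<subseteq> events" using history_subset_past past_subset by (rule order_trans)
  qed
  interpret H: finite_measure_subalgebra M ?H
    by unfold_locales (rule H)
  let ?f = "indicator (X (Suc t) -` B \<inter> space M) :: 'w \<Rightarrow> real" and ?g = "\<lambda>\<omega>. measure (?P (X t \<omega>)) B"
  have XH: "X t \<in> ?H \<rightarrow>\<^sub>M S"
  proof (rule measurableI)
    show "X t \<omega> \<in> space S" if "\<omega> \<in> space ?H" for \<omega>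
      using that measurable_space[OF X_meas] by (simp add: space_history)
    fix C assume "C \<in> sets S"
    then show "X t -` C \<inter> space ?H \<in> sets ?H"
      unfolding sets_history space_history by (intro sigma_sets.Basic) auto
  qed
  have gH: "?g \<in> borel_measurable ?H"
    using measurable_compose[OF XH measurable_compose[OF kernel_prob measurable_measure_prob_algebra[OF B]]] .
  have gM: "?g \<in> borel_measurable M"
    using measurable_compose[OF X_meas measurable_compose[OF kernel_prob measurable_measure_prob_algebra[OF B]]] .
  have P_prob: "prob_space (?P (X t \<omega>))" if "\<omega> \<in> space M" for \<omega>
    using measurable_space[OF kernel_prob measurable_space[OF X_meas that]] by (simp add: space_prob_algebra)
  have XB: "X (Suc t) -` B \<inter> space M \<in> events" using X_meas B by (rule measurable_sets)
  show "AE \<omega> in M. real_cond_exp M ?H ?f \<omega> = ?g \<omega>"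
  proof (rule H.real_cond_exp_charact)
    fix A assume A: "A \<in> sets ?H"
    have A': "A \<in> sets (past t)" "A \<in> events" using A history_subset_past past_subset by blast+
    have "ennreal (\<integral>\<omega>\<in>A. ?f \<omega> \<partial>M) = (\<integral>\<^sup>+ \<omega>. ennreal (indicator A \<omega> * ?f \<omega>) \<partial>M)"
      unfolding set_lebesgue_integral_def real_scaleR_def using A' XB
      by (intro nn_integral_eq_integral[symmetric] integrable_const_bound[where B=1])
         (auto split: split_indicator)
    also have "\<dots> = (\<integral>\<^sup>+ \<omega>. indicator A \<omega> * indicator B (X (Suc t) \<omega>) \<partial>M)"
      by (intro nn_integral_cong) (auto split: split_indicator)
    also have "\<dots> = (\<integral>\<^sup>+ \<omega>. indicator A \<omega> * (\<integral>\<^sup>+ y. indicator B y \<partial>?P (X t \<omega>)) \<partial>M)"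
      using B by (intro nn_integral_next A') auto
    also have "\<dots> = (\<integral>\<^sup>+ \<omega>. ennreal (indicator A \<omega> * ?g \<omega>) \<partial>M)"
      using B P_prob by (intro nn_integral_cong)
        (auto simp: finite_measure.emeasure_eq_measure[OF prob_space.finite_measure] split: split_indicator)
    also have "\<dots> = ennreal (\<integral>\<omega>\<in>A. ?g \<omega> \<partial>M)"
      unfolding set_lebesgue_integral_def real_scaleR_def using A' gM P_prob
      by (intro nn_integral_eq_integral integrable_const_bound[where B=1])
         (auto split: split_indicator intro: prob_space.prob_le_1)
    finally show "(\<integral>\<omega>\<in>A. ?f \<omega> \<partial>M) = (\<integral>\<omega>\<in>A. ?g \<omega> \<partial>M)"
      by (subst (asm) ennreal_inj) (auto simp: set_lebesgue_integral_def intro!: integral_nonneg_AE)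
  next
    show "integrable M ?f" using XB by (intro integrable_const_bound[where B=1]) (auto split: split_indicator)
    show "integrable M ?g"
      using gM P_prob by (intro integrable_const_bound[where B=1]) (auto intro: prob_space.prob_le_1)
  qed (rule gH)
qed

text \<open>The killed kernel discards the mass that lands in \<open>B\<close>, so its
  \<open>n\<close>-fold iterate is the probability of missing \<open>B\<close> at the times 1 to
  \<open>n\<close>. Time 0 is not tested, in agreement with hits being counted from
  \<open>t = 1\<close>.\<close>

lemma AE_hits:
  assumes B: "B \<in> sets S"
    and lim: "(\<lambda>n. kernel_iter (\<lambda>x. density (distr \<zeta> S (F x)) (indicator (space S - B))) n (\<lambda>_. 1) z) \<longlonglongrightarrow> 0"
  shows "AE \<omega> in M. \<exists>t\<ge>1. X t \<omega> \<in> B"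
proof -
  let ?Q = "\<lambda>x. density (distr \<zeta> S (F x)) (indicator (space S - B))"
  define E where "E t = {\<omega> \<in> space M. \<forall>s. 1 \<le> s \<and> s \<le> t \<longrightarrow> X s \<omega> \<notin> B}" for t
  have E_eq: "E t = space M - (\<Union>s\<in>{1..t}. X s -` B \<inter> space M)" for t unfolding E_def by auto
  have E_past: "E t \<in> sets (past t)" for t
  proof -
    have "X s -` B \<inter> space M \<in> sets (past t)" if "s \<in> {1..t}" for s
      using measurable_sets[OF X_past B, of s t] that by (simp add: space_past)
    then show ?thesis
      unfolding E_eq space_past[of t, symmetric] by (intro sets.compl_sets sets.finite_UN) auto
  qed
  \<comment> \<open>A general \<open>f\<close> carries the induction: the last transition is
    absorbed into \<open>f\<close>, and the hypothesis is applied to the integrated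
    function.\<close>
  have eq: "(\<integral>\<^sup>+ \<omega>. indicator (E t) \<omega> * f (X t \<omega>) \<partial>M) = kernel_iter ?Q t f z"
    if "f \<in> borel_measurable S" for f t
    using that
  proof (induction t arbitrary: f)
    case 0
    have "(\<integral>\<^sup>+ \<omega>. indicator (E 0) \<omega> * f (X 0 \<omega>) \<partial>M) = (\<integral>\<^sup>+ \<omega>. f z \<partial>M)"
      by (intro nn_integral_cong) (simp add: E_def X_0)
    then show ?case by (simp add: emeasure_space_1)
  next
    case (Suc t)
    have Bm: "(\<lambda>x. indicator (space S - B) x * f x) \<in> borel_measurable S" using B Suc.prems by measurable
    have "(\<integral>\<^sup>+ \<omega>. indicator (E (Suc t)) \<omega> * f (X (Suc t) \<omega>) \<partial>M)
      = (\<integral>\<^sup>+ \<omega>. indicator (E t) \<omega> * (indicator (space S - B) (X (Suc t) \<omega>) * f (X (Suc t) \<omega>)) \<partial>M)"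
      using measurable_space[OF X_meas[of "Suc t"]]
      by (intro nn_integral_cong) (auto simp: E_def le_Suc_eq split: split_indicator)
    also have "\<dots> = (\<integral>\<^sup>+ \<omega>. indicator (E t) \<omega> * (\<integral>\<^sup>+ y. indicator (space S - B) y * f y \<partial>distr \<zeta> S (F (X t \<omega>))) \<partial>M)"
      using nn_integral_next[OF E_past Bm] .
    also have "\<dots> = (\<integral>\<^sup>+ \<omega>. indicator (E t) \<omega> * (\<integral>\<^sup>+ y. f y \<partial>?Q (X t \<omega>)) \<partial>M)"
      using B Suc.prems by (subst nn_integral_density) auto
    also have "\<dots> = kernel_iter ?Q t (\<lambda>x. \<integral>\<^sup>+ y. f y \<partial>?Q x) z"
    proof (rule Suc.IH)
      have "(\<lambda>x. \<integral>\<^sup>+ y. indicator (space S - B) y * f y \<partial>distr \<zeta> S (F x)) \<in> borel_measurable S"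
        by (rule borel_measurable_kernel_int[OF measurable_prob_algebraD[OF kernel_prob] Bm])
      also have "(\<lambda>x. \<integral>\<^sup>+ y. indicator (space S - B) y * f y \<partial>distr \<zeta> S (F x)) = (\<lambda>x. \<integral>\<^sup>+ y. f y \<partial>?Q x)"
        using B Suc.prems by (subst nn_integral_density) auto
      finally show "(\<lambda>x. \<integral>\<^sup>+ y. f y \<partial>?Q x) \<in> borel_measurable S" .
    qed
    finally show ?case unfolding kernel_iter_Suc2 .
  qed
  have Em: "E t \<in> events" for t using E_past past_subset by blast
  have "emeasure M (E t) = kernel_iter ?Q t (\<lambda>_. 1) z" for t
    using eq[of "\<lambda>_. 1" t] Em by (simp add: nn_integral_indicator)
  with lim have lim: "(\<lambda>t. emeasure M (E t)) \<longlonglongrightarrow> 0" by simp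
  have "emeasure M (\<Inter>t. E t) \<le> emeasure M (E t)" for t
    using Em by (intro emeasure_mono) auto
  with lim have "emeasure M (\<Inter>t. E t) \<le> 0" by (intro LIMSEQ_le_const) auto
  then have "(\<Inter>t. E t) \<in> null_sets M" using Em by (intro null_setsI) auto
  then show ?thesis
    by (rule AE_I') (auto simp: E_def)
qed

end

section \<open>The pairs of disturbance and erasure as an i.i.d. sequence\<close>

context prob_space
begin

text \<open>Two independences combine: that of the two whole processes splits the event into a
  disturbance part and an erasure part, and that within each process factors the parts over
  \<open>J\<close>.\<close>

lemma prob_INT_pair:
  fixes d :: "nat \<Rightarrow> 'a \<Rightarrow> real" and \<Upsilon> :: "nat \<Rightarrow> 'a \<Rightarrow> bool"
  assumes d: "indep_vars (\<lambda>_. borel) d UNIV" and Y: "indep_vars (\<lambda>_. count_space UNIV) \<Upsilon> UNIV"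
    and ind: "indep_set
           {(\<lambda>\<omega> t. d t \<omega>) -` E \<inter> space M |E. E \<in> sets (Pi\<^sub>M UNIV (\<lambda>_. borel))}
           {(\<lambda>\<omega> t. \<Upsilon> t \<omega>) -` E \<inter> space M |E. E \<in> sets (Pi\<^sub>M UNIV (\<lambda>_. count_space UNIV))}"
    and J: "finite J" "J \<noteq> {}" and A: "\<And>i. i \<in> J \<Longrightarrow> A i \<in> sets borel"
  shows "prob (\<Inter>i\<in>J. (d i -` A i \<inter> space M) \<inter> (\<Upsilon> i -` B i \<inter> space M))
     = (\<Prod>i\<in>J. prob (d i -` A i \<inter> space M) * prob (\<Upsilon> i -` B i \<inter> space M))"
proof -
  let ?D = "\<Inter>i\<in>J. (\<lambda>f. f i) -` A i \<inter> space (Pi\<^sub>M UNIV (\<lambda>_. borel :: real measure))"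
  let ?Y = "\<Inter>i\<in>J. (\<lambda>f. f i) -` B i \<inter> space (Pi\<^sub>M UNIV (\<lambda>_. count_space UNIV :: bool measure))"
  have D: "?D \<in> sets (Pi\<^sub>M UNIV (\<lambda>_. borel))"
    using J A by (intro sets.finite_INT measurable_sets[OF measurable_component_singleton]) auto
  have Y': "?Y \<in> sets (Pi\<^sub>M UNIV (\<lambda>_. count_space UNIV))"
    using J by (intro sets.finite_INT measurable_sets[OF measurable_component_singleton]) auto
  have "(\<Inter>i\<in>J. (d i -` A i \<inter> space M) \<inter> (\<Upsilon> i -` B i \<inter> space M))
     = ((\<lambda>\<omega> t. d t \<omega>) -` ?D \<inter> space M) \<inter> ((\<lambda>\<omega> t. \<Upsilon> t \<omega>) -` ?Y \<inter> space M)"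
    using J by (auto simp: space_PiM)
  also have "prob \<dots> = prob ((\<lambda>\<omega> t. d t \<omega>) -` ?D \<inter> space M) * prob ((\<lambda>\<omega> t. \<Upsilon> t \<omega>) -` ?Y \<inter> space M)"
    using D Y' by (intro indep_setD[OF ind]) blast+
  also have "(\<lambda>\<omega> t. d t \<omega>) -` ?D \<inter> space M = (\<Inter>i\<in>J. d i -` A i \<inter> space M)"
    using J by (auto simp: space_PiM)
  also have "(\<lambda>\<omega> t. \<Upsilon> t \<omega>) -` ?Y \<inter> space M = (\<Inter>i\<in>J. \<Upsilon> i -` B i \<inter> space M)"
    using J by (auto simp: space_PiM)
  also have "prob (\<Inter>i\<in>J. d i -` A i \<inter> space M) = (\<Prod>i\<in>J. prob (d i -` A i \<inter> space M))"
    using indep_varsD[OF d J(2,1)] A by auto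
  also have "prob (\<Inter>i\<in>J. \<Upsilon> i -` B i \<inter> space M) = (\<Prod>i\<in>J. prob (\<Upsilon> i -` B i \<inter> space M))"
    using indep_varsD[OF Y J(2,1)] by auto
  finally show ?thesis by (simp add: prod.distrib)
qed

text \<open>Measurable rectangles are stable under intersection and generate the product
  sigma-algebra, so the product formula for rectangles is enough.\<close>

lemma indep_vars_pair:
  fixes d :: "nat \<Rightarrow> 'a \<Rightarrow> real" and \<Upsilon> :: "nat \<Rightarrow> 'a \<Rightarrow> bool"
  assumes d: "indep_vars (\<lambda>_. borel) d UNIV" and Y: "indep_vars (\<lambda>_. count_space UNIV) \<Upsilon> UNIV"
    and ind: "indep_set
           {(\<lambda>\<omega> t. d t \<omega>) -` E \<inter> space M |E. E \<in> sets (Pi\<^sub>M UNIV (\<lambda>_. borel))}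
           {(\<lambda>\<omega> t. \<Upsilon> t \<omega>) -` E \<inter> space M |E. E \<in> sets (Pi\<^sub>M UNIV (\<lambda>_. count_space UNIV))}"
  shows "indep_vars (\<lambda>_. borel \<Otimes>\<^sub>M count_space UNIV) (\<lambda>t \<omega>. (d t \<omega>, \<Upsilon> t \<omega>)) {..t :: nat}"
proof -
  let ?G = "{A \<times> B |A B. A \<in> sets (borel :: real measure) \<and> B \<in> sets (count_space UNIV :: bool measure)}"
  have dm: "random_variable borel (d i)" and Ym: "random_variable (count_space UNIV) (\<Upsilon> i)" for i
    using d Y by (auto simp: indep_vars_def)
  have "prob (\<Inter>i\<in>{..t}. (\<lambda>\<omega>. (d i \<omega>, \<Upsilon> i \<omega>)) -` E i \<inter> space M)
      = (\<Prod>i\<in>{..t}. prob ((\<lambda>\<omega>. (d i \<omega>, \<Upsilon> i \<omega>)) -` E i \<inter> space M))"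
    if E: "E \<in> {..t} \<rightarrow> ?G" for E
  proof -
    have "\<exists>A B. E i = A \<times> B \<and> A \<in> sets borel" if "i \<in> {..t}" for i using E that by blast
    then obtain A B where AB: "\<And>i. i \<in> {..t} \<Longrightarrow> E i = A i \<times> B i" "\<And>i. i \<in> {..t} \<Longrightarrow> A i \<in> sets borel"
      by metis
    have eq: "(\<lambda>\<omega>. (d i \<omega>, \<Upsilon> i \<omega>)) -` E i \<inter> space M = (d i -` A i \<inter> space M) \<inter> (\<Upsilon> i -` B i \<inter> space M)"
      if "i \<in> {..t}" for i
      using AB(1)[OF that] by auto
    have "(\<Inter>i\<in>{..t}. (\<lambda>\<omega>. (d i \<omega>, \<Upsilon> i \<omega>)) -` E i \<inter> space M)
       = (\<Inter>i\<in>{..t}. (d i -` A i \<inter> space M) \<inter> (\<Upsilon> i -` B i \<inter> space M))"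
      using eq by (intro INF_cong) auto
    also have "prob \<dots> = (\<Prod>i\<in>{..t}. prob (d i -` A i \<inter> space M) * prob (\<Upsilon> i -` B i \<inter> space M))"
      using AB(2) by (intro prob_INT_pair[OF d Y ind]) auto
    also have "\<dots> = (\<Prod>i\<in>{..t}. prob ((\<lambda>\<omega>. (d i \<omega>, \<Upsilon> i \<omega>)) -` E i \<inter> space M))"
    proof (rule prod.cong)
      fix i assume i: "i \<in> {..t}"
      have "prob ((d i -` A i \<inter> space M) \<inter> (\<Upsilon> i -` B i \<inter> space M)) = prob (d i -` A i \<inter> space M) * prob (\<Upsilon> i -` B i \<inter> space M)"
        using prob_INT_pair[OF d Y ind, of "{i}" A B] AB(2)[OF i] by simp
      then show "prob (d i -` A i \<inter> space M) * prob (\<Upsilon> i -` B i \<inter> space M)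
          = prob ((\<lambda>\<omega>. (d i \<omega>, \<Upsilon> i \<omega>)) -` E i \<inter> space M)"
        using eq[OF i] by simp
    qed simp
    finally show ?thesis .
  qed
  note * = this
  have G: "Int_stable ?G" by (rule Int_stable_pair_measure_generator)
  have rv: "random_variable (borel \<Otimes>\<^sub>M count_space UNIV) (\<lambda>\<omega>. (d i \<omega>, \<Upsilon> i \<omega>))" for i
    using dm Ym by (rule measurable_Pair)
  show ?thesis
  proof (subst indep_vars_finite[where E="\<lambda>_. ?G"])
    show "\<forall>E\<in>{..t} \<rightarrow> ?G. prob (\<Inter>i\<in>{..t}. (\<lambda>\<omega>. (d i \<omega>, \<Upsilon> i \<omega>)) -` E i \<inter> space M)
      = (\<Prod>i\<in>{..t}. prob ((\<lambda>\<omega>. (d i \<omega>, \<Upsilon> i \<omega>)) -` E i \<inter> space M))"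
      using * by blast
    show "space (borel \<Otimes>\<^sub>M count_space UNIV :: (real \<times> bool) measure) \<in> ?G"
      unfolding space_pair_measure by (intro CollectI exI[of _ UNIV]) auto
  qed (use G rv in \<open>simp_all add: sets_pair_measure space_pair_measure\<close>)
qed

text \<open>The law of a binary variable is determined by its mean, which turns the expectation
  hypothesis into the Bernoulli law; the rectangle formula for a single time then yields the
  product.\<close>

lemma distr_pair:
  fixes d :: "nat \<Rightarrow> 'a \<Rightarrow> real" and \<Upsilon> :: "nat \<Rightarrow> 'a \<Rightarrow> bool"
  assumes d: "indep_vars (\<lambda>_. borel) d UNIV" and Y: "indep_vars (\<lambda>_. count_space UNIV) \<Upsilon> UNIV"
    and ind: "indep_set
           {(\<lambda>\<omega> t. d t \<omega>) -` E \<inter> space M |E. E \<in> sets (Pi\<^sub>M UNIV (\<lambda>_. borel))}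
           {(\<lambda>\<omega> t. \<Upsilon> t \<omega>) -` E \<inter> space M |E. E \<in> sets (Pi\<^sub>M UNIV (\<lambda>_. count_space UNIV))}"
    and dens: "distributed M lborel (d t) f"
    and p: "0 \<le> p" "p \<le> 1" "expectation (\<lambda>\<omega>. of_bool (\<Upsilon> t \<omega>)) = p"
  shows "distr M (borel \<Otimes>\<^sub>M count_space UNIV) (\<lambda>\<omega>. (d t \<omega>, \<Upsilon> t \<omega>))
    = density lborel f \<Otimes>\<^sub>M measure_pmf (bernoulli_pmf p)"
proof -
  have dm: "random_variable borel (d t)" and Ym: "random_variable (count_space UNIV) (\<Upsilon> t)"
    using d Y by (auto simp: indep_vars_def)
  have law_d: "density lborel f = distr M borel (d t)"
    using distributed_distr_eq_density[OF dens] by (simp cong: distr_cong)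
  have law_Y: "measure_pmf (bernoulli_pmf p) = distr M (count_space UNIV) (\<Upsilon> t)"
  proof (rule measure_eqI_finite)
    have "p = expectation (indicator {\<omega>\<in>space M. \<Upsilon> t \<omega>})"
      unfolding p(3)[symmetric] by (intro Bochner_Integration.integral_cong) (auto simp: indicator_def)
    moreover have ev: "{\<omega>\<in>space M. \<Upsilon> t \<omega>} \<in> events"
      using measurable_sets[OF Ym, of "{True}"] by (simp add: vimage_def Int_def conj_commute)
    ultimately have p': "prob {\<omega>\<in>space M. \<Upsilon> t \<omega>} = p" by simp
    have F: "{\<omega>\<in>space M. \<not> \<Upsilon> t \<omega>} = space M - {\<omega>\<in>space M. \<Upsilon> t \<omega>}" by auto
    have q': "prob {\<omega>\<in>space M. \<not> \<Upsilon> t \<omega>} = 1 - p"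
      unfolding F using prob_compl[OF ev] p' by simp
    fix b :: bool
    have "{b} \<in> sets (count_space UNIV)" by simp
    then have "emeasure (distr M (count_space UNIV) (\<Upsilon> t)) {b} = ennreal (prob {\<omega>\<in>space M. \<Upsilon> t \<omega> = b})"
      using emeasure_distr[OF Ym, of "{b}"] by (simp add: emeasure_eq_measure vimage_def Int_def conj_commute)
    also have "\<dots> = emeasure (measure_pmf (bernoulli_pmf p)) {b}"
      using p p' q' by (cases b) (simp_all add: emeasure_pmf_single)
    finally show "emeasure (measure_pmf (bernoulli_pmf p)) {b} = emeasure (distr M (count_space UNIV) (\<Upsilon> t)) {b}" ..
  qed auto
  interpret D: prob_space "distr M borel (d t)" using dm by (rule prob_space_distr)
  interpret Y: prob_space "distr M (count_space UNIV) (\<Upsilon> t)" using Ym by (rule prob_space_distr)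
  show ?thesis
    unfolding law_d law_Y
  proof (rule pair_measure_eqI[symmetric])
    show "sets (distr M borel (d t) \<Otimes>\<^sub>M distr M (count_space UNIV) (\<Upsilon> t)) =
      sets (distr M (borel \<Otimes>\<^sub>M count_space UNIV) (\<lambda>\<omega>. (d t \<omega>, \<Upsilon> t \<omega>)))"
      unfolding sets_distr by (intro sets_pair_measure_cong) auto
    fix A B assume AB: "A \<in> sets (distr M borel (d t))" "B \<in> sets (distr M (count_space UNIV) (\<Upsilon> t))"
    have "emeasure (distr M (borel \<Otimes>\<^sub>M count_space UNIV) (\<lambda>\<omega>. (d t \<omega>, \<Upsilon> t \<omega>))) (A \<times> B)
      = emeasure M ((\<lambda>\<omega>. (d t \<omega>, \<Upsilon> t \<omega>)) -` (A \<times> B) \<inter> space M)"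
      using AB dm Ym by (intro emeasure_distr measurable_Pair) auto
    also have "(\<lambda>\<omega>. (d t \<omega>, \<Upsilon> t \<omega>)) -` (A \<times> B) \<inter> space M = (d t -` A \<inter> space M) \<inter> (\<Upsilon> t -` B \<inter> space M)"
      by auto
    also have "prob \<dots> = prob (d t -` A \<inter> space M) * prob (\<Upsilon> t -` B \<inter> space M)"
      using prob_INT_pair[OF d Y ind, of "{t}" "\<lambda>_. A" "\<lambda>_. B"] AB by simp
    then have "emeasure M ((d t -` A \<inter> space M) \<inter> (\<Upsilon> t -` B \<inter> space M))
      = emeasure M (d t -` A \<inter> space M) * emeasure M (\<Upsilon> t -` B \<inter> space M)"
      by (simp add: emeasure_eq_measure ennreal_mult'')
    also have "emeasure M (d t -` A \<inter> space M) = emeasure (distr M borel (d t)) A"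
      using AB dm by (simp add: emeasure_distr)
    also have "emeasure M (\<Upsilon> t -` B \<inter> space M) = emeasure (distr M (count_space UNIV) (\<Upsilon> t)) B"
      using AB Ym by (simp add: emeasure_distr)
    finally show "emeasure (distr M borel (d t)) A * emeasure (distr M (count_space UNIV) (\<Upsilon> t)) B
      = emeasure (distr M (borel \<Otimes>\<^sub>M count_space UNIV) (\<lambda>\<omega>. (d t \<omega>, \<Upsilon> t \<omega>))) (A \<times> B)" by simp
  qed (rule D.sigma_finite_measure Y.sigma_finite_measure)+
qed

end

section \<open>The closed loop as a Markov kernel\<close>

lemma quantizer_error:
  assumes K: "K \<ge> 2" and \<Delta>: "\<Delta> > 0" and x: "\<bar>x\<bar> \<le> real K / 2 * \<Delta>"
  shows "\<bar>x - quantizer K \<Delta> x\<bar> \<le> \<Delta> / 2"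
proof (cases "x = real K / 2 * \<Delta>")
  case True
  then show ?thesis using \<Delta> by (simp add: quantizer_def field_simps)
next
  case False
  \<comment> \<open>\<open>i\<close> is the zero-based index of the bin that contains
    \<open>x\<close>, so the summand is \<open>k = i + 1\<close>. The right end of the range, which
    would give \<open>i = K\<close>, has been treated above.\<close>
  define i where "i = \<lfloor>x / \<Delta> + real K / 2\<rfloor>"
  have i_le: "of_int i * \<Delta> \<le> x + real K / 2 * \<Delta>" and i_gt: "x + real K / 2 * \<Delta> < (of_int i + 1) * \<Delta>"
  proof -
    have "of_int i \<le> x / \<Delta> + real K / 2" "x / \<Delta> + real K / 2 < of_int i + 1"
      unfolding i_def by linarith+
    moreover have "(x / \<Delta> + real K / 2) * \<Delta> = x + real K / 2 * \<Delta>"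
      using \<Delta> by (simp add: field_simps)
    ultimately show "of_int i * \<Delta> \<le> x + real K / 2 * \<Delta>" "x + real K / 2 * \<Delta> < (of_int i + 1) * \<Delta>"
      using \<Delta> mult_le_cancel_right_pos mult_less_cancel_right_pos by metis+
  qed
  have "0 \<le> x / \<Delta> + real K / 2" using x \<Delta> by (simp add: field_simps abs_le_iff)
  then have i0: "i \<ge> 0" by (simp add: i_def)
  have "x < real K / 2 * \<Delta>" using x False by (auto simp: abs_le_iff)
  then have "of_int i * \<Delta> < real K * \<Delta>" using i_le by (simp add: field_simps)
  then have iK: "i < int K" using \<Delta> by simp
  define k where "k = Suc (nat i)"
  have k: "k \<in> {1..K}" "real k = of_int i + 1" using i0 iK by (auto simp: k_def)
  have bin: "x \<in> {(real j - 1 - real K / 2) * \<Delta> ..< (real j - real K / 2) * \<Delta>} \<longleftrightarrow> j = k"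
    if "j \<in> {1..K}" for j
  proof
    assume "x \<in> {(real j - 1 - real K / 2) * \<Delta> ..< (real j - real K / 2) * \<Delta>}"
    then have "(real j - 1) * \<Delta> \<le> x + real K / 2 * \<Delta>" "x + real K / 2 * \<Delta> < real j * \<Delta>"
      by (auto simp: algebra_simps)
    then have "(real j - 1) * \<Delta> < (of_int i + 1) * \<Delta>" "of_int i * \<Delta> < real j * \<Delta>"
      using i_le i_gt by linarith+
    then have "real j - 1 < of_int i + 1" "of_int i < real j"
      using \<Delta> by simp_all
    then have "real j < real k + 1" "real k < real j + 1" using k by auto
    then show "j = k" by linarith
  next
    assume "j = k"
    then show "x \<in> {(real j - 1 - real K / 2) * \<Delta> ..< (real j - real K / 2) * \<Delta>}"
      using i_le i_gt k by (simp add: algebra_simps)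
  qed
  have "quantizer K \<Delta> x = (\<Sum>j=1..K. if j = k then (real j - (real K + 1) / 2) * \<Delta> else 0)"
    unfolding quantizer_def using False bin by (auto intro!: sum.cong)
  also have "\<dots> = (real k - (real K + 1) / 2) * \<Delta>" using k(1) by (simp add: sum.delta')
  finally have "x - quantizer K \<Delta> x = x + real K / 2 * \<Delta> - of_int i * \<Delta> - \<Delta> / 2"
    using k(2) by (simp add: field_simps)
  then show ?thesis using i_le i_gt unfolding abs_le_iff distrib_right by linarith
qed

lemma quantizer_overflow:
  assumes \<Delta>: "\<Delta> > 0" and x: "\<bar>x\<bar> > real K / 2 * \<Delta>"
  shows "quantizer K \<Delta> x = 0"
proof -
  have "x \<notin> {(real k - 1 - real K / 2) * \<Delta> ..< (real k - real K / 2) * \<Delta>}" if k: "k \<in> {1..K}" for k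
  proof
    assume "x \<in> {(real k - 1 - real K / 2) * \<Delta> ..< (real k - real K / 2) * \<Delta>}"
    moreover have "(real k - real K / 2) * \<Delta> \<le> real K / 2 * \<Delta>" "(- real K / 2) * \<Delta> \<le> (real k - 1 - real K / 2) * \<Delta>"
      using k \<Delta> by (intro mult_right_mono; simp)+
    ultimately show False using x by auto
  qed
  then have "(\<Sum>k=1..K. if x \<in> {(real k - 1 - real K / 2) * \<Delta> ..< (real k - real K / 2) * \<Delta>}
                     then (real k - (real K + 1) / 2) * \<Delta> else 0) = 0"
    by (intro sum.neutral) auto
  moreover have "0 \<le> real K / 2 * \<Delta>" using \<Delta> by simp
  then have "x \<noteq> real K / 2 * \<Delta>" using x by linarith
  ultimately show ?thesis unfolding quantizer_def by presburger
qed

section \<open>The closed loop in terms of integer levels\<close>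

locale quantized_loop =
  fixes a b \<alpha> \<delta> L \<sigma> p s \<Delta>\<^sub>0 :: real and K A B :: nat and n\<^sub>0 :: int
  assumes \<sigma>: "\<sigma> > 0" and p: "0 < p" "p \<le> 1" and a: "\<bar>a\<bar> \<ge> 1" and b: "b \<noteq> 0" and K: "K \<ge> 2"
    and \<alpha>: "0 < \<alpha>" "\<alpha> < 1" and \<delta>: "\<delta> > 0" and L: "L > 0"
    and \<alpha>_gt: "\<alpha> > \<bar>a\<bar> * 2 powr (- log 2 (real K))"
    and drift_cond: "\<alpha> * (\<bar>a\<bar> + \<delta>) powr (1 / p - 1) < 1"
    and \<alpha>L: "\<alpha> * L \<ge> 1" and s: "s > 0"
    and log_\<alpha>: "log 2 \<alpha> = - real A * s" and log_\<beta>: "log 2 (\<bar>a\<bar> + \<delta>) = real B * s"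
    and \<Delta>\<^sub>0: "\<Delta>\<^sub>0 \<ge> L" and log_\<Delta>\<^sub>0: "log 2 \<Delta>\<^sub>0 = of_int n\<^sub>0 * s"
begin

abbreviation \<beta> :: real where "\<beta> \<equiv> \<bar>a\<bar> + \<delta>"
abbreviation bins :: "real set" where "bins \<equiv> admissible_bins s \<alpha> L A B n\<^sub>0"
abbreviation SS :: "(real \<times> real) measure" where "SS \<equiv> state_space s \<alpha> L A B n\<^sub>0"
abbreviation PP :: "real \<times> real \<Rightarrow> (real \<times> real) measure" where
  "PP \<equiv> closed_loop_kernel a b K \<alpha> \<delta> L \<sigma> p SS"
abbreviation NN :: "real measure" where "NN \<equiv> density lborel (normal_density 0 \<sigma>)"
abbreviation nxt :: "real \<times> real \<Rightarrow> real \<times> bool \<Rightarrow> real \<times> real" where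
  "nxt \<equiv> step a b K \<alpha> \<delta> L"

text \<open>Indexed by integers although admissible exponents are natural numbers, so that zooming
  in is a subtraction without truncation.\<close>

definition lev :: "int \<Rightarrow> real" where "lev n = 2 powr (s * of_int n)"

lemma \<beta>_gt_1: "\<beta> > 1"
  using a \<delta> by linarith

lemma A_pos: "A > 0"
proof (rule ccontr)
  assume "\<not> A > 0"
  then have "log 2 \<alpha> = 0" using log_\<alpha> by simp
  then have "\<alpha> = 2 powr 0" using powr_log_cancel[of 2 \<alpha>] \<alpha> by simp
  then show False using \<alpha> by simp
qed

lemma B_pos: "B > 0"
proof (rule ccontr)
  assume "\<not> B > 0"
  then have "log 2 \<beta> = 0" using log_\<beta> by simp
  then have "\<beta> = 2 powr 0" using powr_log_cancel[of 2 \<beta>] \<beta>_gt_1 by simp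
  then show False using \<beta>_gt_1 by simp
qed

lemma lev_add: "lev (m + n) = lev m * lev n"
  by (simp add: lev_def powr_add distrib_left)

lemma lev_A: "lev (- int A) = \<alpha>"
proof -
  have "\<alpha> = 2 powr (log 2 \<alpha>)" using \<alpha> by simp
  then show ?thesis unfolding lev_def log_\<alpha> by (simp add: mult.commute)
qed

lemma lev_B: "lev (int B) = \<beta>"
proof -
  have "\<beta> = 2 powr (log 2 \<beta>)" using \<beta>_gt_1 by simp
  then show ?thesis unfolding lev_def log_\<beta> by (simp add: mult.commute)
qed

lemma lev_n\<^sub>0: "lev n\<^sub>0 = \<Delta>\<^sub>0"
proof -
  have "\<Delta>\<^sub>0 = 2 powr (log 2 \<Delta>\<^sub>0)" using \<Delta>\<^sub>0 L by simp
  then show ?thesis unfolding lev_def log_\<Delta>\<^sub>0 by (simp add: mult.commute)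
qed

lemma lev_le_iff: "lev m \<le> lev n \<longleftrightarrow> m \<le> n"
  using s by (simp add: lev_def)

lemma lev_pos: "lev n > 0"
  by (simp add: lev_def)

text \<open>Since \<open>\<alpha> * L \<ge> 1\<close>, the size condition forces an integer exponent
  to be nonnegative; the natural exponents of the definition are exactly the integer ones that meet
  it.\<close>

lemma bins_iff: "\<Delta> \<in> bins \<longleftrightarrow>
  (\<exists>n. \<Delta> = lev n \<and> \<alpha> * L \<le> lev n \<and> (\<exists>N\<^sub>A N\<^sub>B :: nat. n = n\<^sub>0 - int N\<^sub>A * int A + int N\<^sub>B * int B))"
proof -
  have pos: "\<alpha> * L > 0" using \<alpha> L by simp
  have *: "s * real_of_int n \<ge> log 2 (\<alpha> * L) \<longleftrightarrow> \<alpha> * L \<le> lev n" for n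
    using pos by (simp add: lev_def log_le_iff)
  have **: "lev (int n) = 2 powr (s * real n)" for n by (simp add: lev_def)
  show ?thesis
  proof
    assume "\<Delta> \<in> bins"
    then obtain n :: nat where n: "\<Delta> = lev (int n)" "\<alpha> * L \<le> lev (int n)"
      "\<exists>N\<^sub>A N\<^sub>B :: nat. int n = n\<^sub>0 - int N\<^sub>A * int A + int N\<^sub>B * int B"
      using *[of "int n" for n] unfolding admissible_bins_def ** by auto
    then show "\<exists>n. \<Delta> = lev n \<and> \<alpha> * L \<le> lev n \<and> (\<exists>N\<^sub>A N\<^sub>B :: nat. n = n\<^sub>0 - int N\<^sub>A * int A + int N\<^sub>B * int B)"
      by blast
  next
    assume "\<exists>n. \<Delta> = lev n \<and> \<alpha> * L \<le> lev n \<and> (\<exists>N\<^sub>A N\<^sub>B :: nat. n = n\<^sub>0 - int N\<^sub>A * int A + int N\<^sub>B * int B)"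
    then obtain n where n: "\<Delta> = lev n" "\<alpha> * L \<le> lev n"
      "\<exists>N\<^sub>A N\<^sub>B :: nat. n = n\<^sub>0 - int N\<^sub>A * int A + int N\<^sub>B * int B" by blast
    have "lev 0 \<le> lev n" using n(2) \<alpha>L by (simp add: lev_def)
    then have "n \<ge> 0" by (simp add: lev_le_iff)
    then obtain k where k: "n = int k" by (rule nonneg_int_cases)
    have "\<Delta> = 2 powr (s * real k) \<and> s * real k \<ge> log 2 (\<alpha> * L) \<and>
        (\<exists>N\<^sub>A N\<^sub>B :: nat. int k = n\<^sub>0 - int N\<^sub>A * int A + int N\<^sub>B * int B)"
      using n *[of n] **[of k] k by simp
    then show "\<Delta> \<in> bins" unfolding admissible_bins_def by blast
  qed
qed

lemma bins_ge: "\<Delta> \<in> bins \<Longrightarrow> \<Delta> \<ge> \<alpha> * L"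
  by (auto simp: bins_iff)

lemma bins_ge_1: "\<Delta> \<in> bins \<Longrightarrow> \<Delta> \<ge> 1"
  using bins_ge \<alpha>L by fastforce

lemma countable_bins: "countable bins"
proof (rule countable_subset)
  show "bins \<subseteq> range lev" by (auto simp: bins_iff)
qed auto

text \<open>Levels are discrete and bounded below by 0. This makes the boxes of the drift condition
  finite unions of intervals.\<close>

lemma finite_bins_le: "finite {\<Delta> \<in> bins. \<Delta> \<le> D}"
proof (cases "D > 0")
  case True
  have "{\<Delta> \<in> bins. \<Delta> \<le> D} \<subseteq> lev ` {0..\<lceil>log 2 D / s\<rceil>}"
  proof
    fix \<Delta> assume "\<Delta> \<in> {\<Delta> \<in> bins. \<Delta> \<le> D}"
    then have "\<Delta> \<ge> 1" "\<Delta> \<le> D" "\<exists>n. \<Delta> = lev n" using bins_ge_1 bins_iff by auto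
    then obtain n where n: "\<Delta> = lev n" "\<Delta> \<ge> 1" "\<Delta> \<le> D" by blast
    have "lev 0 \<le> lev n" using n by (simp add: lev_def)
    moreover have "s * of_int n \<le> log 2 D" using n True by (simp add: lev_def le_log_iff)
    then have "of_int n \<le> log 2 D / s" using s by (simp add: field_simps)
    then have "n \<le> \<lceil>log 2 D / s\<rceil>" by linarith
    ultimately show "\<Delta> \<in> lev ` {0..\<lceil>log 2 D / s\<rceil>}" using n by (auto simp: lev_le_iff)
  qed
  then show ?thesis by (rule finite_subset) auto
next
  case False
  then have "{\<Delta> \<in> bins. \<Delta> \<le> D} = {}" using bins_ge_1 by force
  then show ?thesis by (simp only: finite.emptyI)
qed

lemma bins_up: assumes "\<Delta> \<in> bins" shows "\<Delta> * \<beta> \<in> bins"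
proof -
  obtain n N\<^sub>A N\<^sub>B where n: "\<Delta> = lev n" "n = n\<^sub>0 - int N\<^sub>A * int A + int N\<^sub>B * int B"
    using assms by (auto simp: bins_iff)
  have "\<Delta> * \<beta> = lev (n + int B)" by (simp add: lev_add lev_B n)
  moreover have "n + int B = n\<^sub>0 - int N\<^sub>A * int A + int (Suc N\<^sub>B) * int B"
    using n by (simp add: algebra_simps)
  moreover have "\<alpha> * L \<le> \<Delta> * \<beta>"
    using bins_ge[OF assms] bins_ge_1[OF assms] \<beta>_gt_1 mult_left_mono[of 1 \<beta> \<Delta>] by linarith
  ultimately show ?thesis unfolding bins_iff by metis
qed

text \<open>Zooming in happens from \<open>L\<close> upward only, and this is why the bound
  \<open>\<alpha> * L\<close> is never crossed.\<close>

lemma bins_down: assumes "\<Delta> \<in> bins" "\<Delta> \<ge> L" shows "\<Delta> * \<alpha> \<in> bins"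
proof -
  obtain n N\<^sub>A N\<^sub>B where n: "\<Delta> = lev n" "n = n\<^sub>0 - int N\<^sub>A * int A + int N\<^sub>B * int B"
    using assms by (auto simp: bins_iff)
  have "\<Delta> * \<alpha> = lev (n + - int A)" by (simp only: lev_add lev_A n)
  moreover have "n + - int A = n\<^sub>0 - int (Suc N\<^sub>A) * int A + int N\<^sub>B * int B"
    using n by (simp add: algebra_simps)
  moreover have "\<alpha> * L \<le> \<Delta> * \<alpha>"
    using assms \<alpha> by simp
  ultimately show ?thesis unfolding bins_iff by metis
qed

lemma \<Delta>\<^sub>0_bins: "\<Delta>\<^sub>0 \<in> bins"
proof -
  have "n\<^sub>0 = n\<^sub>0 - int 0 * int A + int 0 * int B" by simp
  moreover have "\<alpha> * L \<le> \<Delta>\<^sub>0" using \<alpha> L \<Delta>\<^sub>0 mult_right_mono[of \<alpha> 1 L] by linarith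
  ultimately show ?thesis unfolding bins_iff using lev_n\<^sub>0 by metis
qed

lemma zoom_iff:
  assumes "\<Delta> > 0"
  shows "\<bar>x / (\<Delta> * 2 powr (log 2 (real K) - 1))\<bar> > 1 \<longleftrightarrow> \<bar>x\<bar> > real K / 2 * \<Delta>"
proof -
  have "2 powr (log 2 (real K) - 1) = real K / 2" using K by (simp add: powr_diff)
  then have eq: "\<Delta> * 2 powr (log 2 (real K) - 1) = real K / 2 * \<Delta>" by simp
  have pos: "real K / 2 * \<Delta> > 0" using assms K by simp
  show ?thesis unfolding eq abs_divide abs_of_pos[OF pos] less_divide_eq using pos by simp
qed

text \<open>The gain \<open>b\<close> cancels against the control law, so this is the next plant
  state before the disturbance is added. Neither it nor \<open>scl\<close> sees the disturbance;
  they depend on the erasure bit only.\<close>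

definition mid :: "real \<times> real \<Rightarrow> bool \<Rightarrow> real" where
  "mid z \<upsilon> = a * (fst z - of_bool \<upsilon> * quantizer K (snd z) (fst z))"

definition scl :: "real \<times> real \<Rightarrow> bool \<Rightarrow> real" where
  "scl z \<upsilon> = (if \<bar>fst z\<bar> > real K / 2 * snd z \<or> \<not> \<upsilon> then \<beta> else if snd z \<ge> L then \<alpha> else 1)"

lemma nxt_eq: "snd z > 0 \<Longrightarrow> nxt z (w, \<upsilon>) = (mid z \<upsilon> + w, snd z * scl z \<upsilon>)"
proof (cases z)
  case (Pair x \<Delta>)
  assume "snd z > 0"
  then have "zoom a \<alpha> \<delta> L \<Delta> \<bar>x / (\<Delta> * 2 powr (log 2 (real K) - 1))\<bar> \<upsilon> = scl (x, \<Delta>) \<upsilon>"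
    unfolding zoom_def scl_def fst_conv snd_conv using zoom_iff[of \<Delta> x] Pair by (simp only: snd_conv)
  then show ?thesis
    using b unfolding step_def mid_def Pair Let_def by (simp add: right_diff_distrib)
qed

lemma space_SS: "space SS = UNIV \<times> bins"
  by (simp add: state_space_def space_pair_measure)

lemma sets_SS_Times: "G \<in> sets borel \<Longrightarrow> D \<subseteq> bins \<Longrightarrow> G \<times> D \<in> sets SS"
  unfolding state_space_def by (intro pair_measureI) auto

lemma scl_bins: "\<Delta> \<in> bins \<Longrightarrow> \<Delta> * scl (x, \<Delta>) \<upsilon> \<in> bins"
  using bins_up bins_down by (auto simp: scl_def)

lemma borel_measurable_quantizer[measurable]:
  "(\<lambda>z. quantizer K (f z) (g z)) \<in> borel_measurable M"
  if [measurable]: "f \<in> borel_measurable M" "g \<in> borel_measurable M"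
  unfolding quantizer_def atLeastLessThan_iff by measurable

lemma nxt_measurable: "(\<lambda>(z, n). nxt z n) \<in> SS \<Otimes>\<^sub>M (borel \<Otimes>\<^sub>M count_space UNIV) \<rightarrow>\<^sub>M SS"
proof -
  let ?M = "SS \<Otimes>\<^sub>M (borel \<Otimes>\<^sub>M count_space UNIV :: (real \<times> bool) measure)"
  have x: "(\<lambda>q. fst (fst q)) \<in> borel_measurable ?M"
    unfolding state_space_def by measurable
  have "(\<lambda>q. snd (fst q)) \<in> ?M \<rightarrow>\<^sub>M count_space bins"
    unfolding state_space_def by measurable
  from measurable_compose[OF this, of "\<lambda>x. x" borel]
  have \<Delta>: "(\<lambda>q. snd (fst q)) \<in> borel_measurable ?M" by simp
  have w: "(\<lambda>q. fst (snd q)) \<in> borel_measurable ?M" and \<upsilon>: "(\<lambda>q. snd (snd q)) \<in> ?M \<rightarrow>\<^sub>M count_space UNIV"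
    by measurable
  note [measurable] = x \<Delta> w \<upsilon>
  have 1: "(\<lambda>q. mid (fst q) (snd (snd q)) + fst (snd q)) \<in> borel_measurable ?M"
    unfolding mid_def by measurable
  have 2: "(\<lambda>q. snd (fst q) * scl (fst q) (snd (snd q))) \<in> borel_measurable ?M"
    unfolding scl_def by measurable
  \<comment> \<open>The bin sizes form a countable discrete space, so measurability reduces to
    preimages of single sizes, which Borel measurability supplies.\<close>
  have 3: "(\<lambda>q. snd (fst q) * scl (fst q) (snd (snd q))) \<in> ?M \<rightarrow>\<^sub>M count_space bins"
  proof (subst measurable_count_space_eq_countable[OF countable_bins], intro conjI ballI)
    show "(\<lambda>q. snd (fst q) * scl (fst q) (snd (snd q))) \<in> space ?M \<rightarrow> bins"
      using scl_bins by (auto simp: space_pair_measure space_SS)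
    show "(\<lambda>q. snd (fst q) * scl (fst q) (snd (snd q))) -` {c} \<inter> space ?M \<in> sets ?M" for c
      using measurable_sets[OF 2, of "{c}"] by simp
  qed
  have "(\<lambda>q. (mid (fst q) (snd (snd q)) + fst (snd q), snd (fst q) * scl (fst q) (snd (snd q)))) \<in> ?M \<rightarrow>\<^sub>M SS"
    using measurable_Pair[OF 1 3] by (simp add: state_space_def)
  then show ?thesis
  proof (rule measurable_cong[THEN iffD2, rotated])
    fix q assume "q \<in> space ?M"
    then have "snd (fst q) > 0" using bins_ge_1 by (force simp: space_pair_measure space_SS)
    then show "(case q of (z, n) \<Rightarrow> nxt z n)
      = (mid (fst q) (snd (snd q)) + fst (snd q), snd (fst q) * scl (fst q) (snd (snd q)))"
      using nxt_eq[of "fst q" "fst (snd q)" "snd (snd q)"] by (simp add: split_beta')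
  qed
qed

end

section \<open>Small sets and reachability of the deadband\<close>

lemma nn_integral_gauss_shift:
  fixes f :: "real \<Rightarrow> ennreal"
  assumes f: "f \<in> borel_measurable borel"
  shows "(\<integral>\<^sup>+ w. f (m + w) \<partial>density lborel (normal_density 0 \<sigma>))
    = (\<integral>\<^sup>+ y. ennreal (normal_density 0 \<sigma> (y - m)) * f y \<partial>lborel)"
proof -
  note [measurable] = f
  have "(\<integral>\<^sup>+ w. f (m + w) \<partial>density lborel (normal_density 0 \<sigma>))
      = (\<integral>\<^sup>+ w. ennreal (normal_density 0 \<sigma> w) * f (m + w) \<partial>lborel)"
    by (subst nn_integral_density) auto
  also have "\<dots> = (\<integral>\<^sup>+ y. ennreal (normal_density 0 \<sigma> (y - m)) * f y \<partial>lborel)"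
    by (subst (2) nn_integral_real_affine[where c=1 and t=m]) auto
  finally show ?thesis .
qed

lemma normal_density_antimono:
  assumes "\<bar>x\<bar> \<le> \<bar>y\<bar>"
  shows "normal_density 0 \<sigma> y \<le> normal_density 0 \<sigma> x"
proof -
  have "x\<^sup>2 \<le> y\<^sup>2" using assms by (simp add: abs_le_square_iff)
  then show ?thesis
    unfolding normal_density_def by (intro mult_left_mono) (auto intro: divide_right_mono)
qed

text \<open>Points of \<open>G\<close> and the mean \<open>m\<close> are at most
  \<open>r + R\<close> apart, and the density decreases with the distance.\<close>

lemma gauss_shift_lower:
  assumes G: "G \<in> sets borel" "G \<subseteq> {-r..r}" and m: "\<bar>m\<bar> \<le> R"
  shows "ennreal (normal_density 0 \<sigma> (r + R)) * emeasure lborel G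
    \<le> (\<integral>\<^sup>+ w. indicator G (m + w) \<partial>density lborel (normal_density 0 \<sigma>))"
proof -
  have "ennreal (normal_density 0 \<sigma> (r + R)) * emeasure lborel G
      = (\<integral>\<^sup>+ y. ennreal (normal_density 0 \<sigma> (r + R)) * indicator G y \<partial>lborel)"
    using G by (simp add: nn_integral_cmult_indicator)
  also have "\<dots> \<le> (\<integral>\<^sup>+ y. ennreal (normal_density 0 \<sigma> (y - m)) * indicator G y \<partial>lborel)"
  proof (intro nn_integral_mono)
    fix y
    have "normal_density 0 \<sigma> (r + R) \<le> normal_density 0 \<sigma> (y - m)" if "y \<in> G"
    proof (rule normal_density_antimono)
      have "-r \<le> y" "y \<le> r" using G(2) that by auto
      then show "\<bar>y - m\<bar> \<le> \<bar>r + R\<bar>" using m by linarith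
    qed
    then show "ennreal (normal_density 0 \<sigma> (r + R)) * indicator G y \<le> ennreal (normal_density 0 \<sigma> (y - m)) * indicator G y"
      by (auto split: split_indicator intro: ennreal_leI)
  qed
  also have "\<dots> = (\<integral>\<^sup>+ w. indicator G (m + w) \<partial>density lborel (normal_density 0 \<sigma>))"
    using G by (intro nn_integral_gauss_shift[symmetric]) auto
  finally show ?thesis .
qed

context quantized_loop
begin

lemma snd_pos: "z \<in> space SS \<Longrightarrow> snd z > 0"
  using bins_ge_1[of "snd z"] by (auto simp: space_SS)

lemma prob_space_noise: "prob_space (NN \<Otimes>\<^sub>M measure_pmf (bernoulli_pmf p))"
proof -
  interpret Q: pair_prob_space NN "measure_pmf (bernoulli_pmf p)"
    using prob_space_normal_density[OF \<sigma>] prob_space_measure_pmf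
    by (intro pair_prob_space.intro pair_sigma_finite.intro prob_space_imp_sigma_finite)
  show ?thesis by (rule Q.P.prob_space_axioms)
qed

lemma sets_noise: "sets (NN \<Otimes>\<^sub>M measure_pmf (bernoulli_pmf p)) = sets (borel \<Otimes>\<^sub>M count_space UNIV)"
  by (intro sets_pair_measure_cong) auto

lemma PP_prob: "PP \<in> SS \<rightarrow>\<^sub>M prob_algebra SS"
  unfolding closed_loop_kernel_def[abs_def]
proof (rule measurable_distr_prob_space2[where M="borel \<Otimes>\<^sub>M count_space UNIV"])
  show "(\<lambda>z. NN \<Otimes>\<^sub>M measure_pmf (bernoulli_pmf p)) \<in> SS \<rightarrow>\<^sub>M prob_algebra (borel \<Otimes>\<^sub>M count_space UNIV)"
    using prob_space_noise sets_noise by (intro measurable_const) (simp add: space_prob_algebra)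
qed (rule nxt_measurable)

lemma PP_subprob: "PP \<in> SS \<rightarrow>\<^sub>M subprob_algebra SS"
  using PP_prob by (rule measurable_prob_algebraD)

lemma nn_integral_PP:
  assumes z: "z \<in> space SS" and f: "f \<in> borel_measurable SS"
  shows "(\<integral>\<^sup>+ y. f y \<partial>PP z)
    = ennreal p * (\<integral>\<^sup>+ w. f (mid z True + w, snd z * scl z True) \<partial>NN)
    + ennreal (1 - p) * (\<integral>\<^sup>+ w. f (mid z False + w, snd z * scl z False) \<partial>NN)"
proof -
  interpret Q: pair_prob_space NN "measure_pmf (bernoulli_pmf p)"
    using prob_space_normal_density[OF \<sigma>] prob_space_measure_pmf
    by (intro pair_prob_space.intro pair_sigma_finite.intro prob_space_imp_sigma_finite)
  have nz: "nxt z \<in> borel \<Otimes>\<^sub>M count_space UNIV \<rightarrow>\<^sub>M SS"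
    using measurable_compose[OF measurable_Pair1'[OF z] nxt_measurable] by simp
  then have nz': "nxt z \<in> NN \<Otimes>\<^sub>M measure_pmf (bernoulli_pmf p) \<rightarrow>\<^sub>M SS"
    using measurable_cong_sets[OF sets_noise refl] by blast
  have "(\<integral>\<^sup>+ y. f y \<partial>PP z) = (\<integral>\<^sup>+ n. f (nxt z n) \<partial>(NN \<Otimes>\<^sub>M measure_pmf (bernoulli_pmf p)))"
    unfolding closed_loop_kernel_def using nz' f by (intro nn_integral_distr) auto
  also have "\<dots> = (\<integral>\<^sup>+ \<upsilon>. (\<integral>\<^sup>+ w. f (nxt z (w, \<upsilon>)) \<partial>NN) \<partial>measure_pmf (bernoulli_pmf p))"
    using measurable_compose[OF nz' f] by (intro Q.nn_integral_snd[symmetric]) simp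
  also have "\<dots> = (\<integral>\<^sup>+ w. f (nxt z (w, True)) \<partial>NN) * ennreal p + (\<integral>\<^sup>+ w. f (nxt z (w, False)) \<partial>NN) * ennreal (1 - p)"
    using p by (subst nn_integral_bernoulli_pmf) auto
  finally show ?thesis
    unfolding nxt_eq[OF snd_pos[OF z]] by (simp add: mult.commute)
qed

lemma section_sets:
  assumes "E \<in> sets SS" "\<Delta> \<in> bins"
  shows "{x. (x, \<Delta>) \<in> E} \<in> sets borel"
proof -
  have "(\<lambda>x. (x, \<Delta>)) \<in> borel \<rightarrow>\<^sub>M SS"
    using assms(2) unfolding state_space_def by (intro measurable_Pair) auto
  from measurable_sets[OF this assms(1)] show ?thesis by (simp add: vimage_def)
qed

text \<open>With probability at least \<open>p\<close> the transmission succeeds, and then the next plant state has a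
  Gaussian density bounded below on bounded sets.\<close>

lemma emeasure_PP_ge:
  assumes z: "z \<in> space SS" and E: "E \<in> sets SS" and m: "\<bar>mid z True\<bar> \<le> R"
  shows "ennreal (p * normal_density 0 \<sigma> (r + R)) * emeasure lborel ({-r..r} \<inter> {x. (x, snd z * scl z True) \<in> E})
    \<le> emeasure (PP z) E"
proof -
  let ?\<Delta> = "snd z * scl z True"
  let ?G = "{-r..r} \<inter> {x. (x, ?\<Delta>) \<in> E}"
  have \<Delta>: "?\<Delta> \<in> bins" using scl_bins[of "snd z" "fst z" True] z by (auto simp: space_SS)
  have G: "?G \<in> sets borel" using section_sets[OF E \<Delta>] by auto
  have "ennreal (p * normal_density 0 \<sigma> (r + R)) * emeasure lborel ?G
     = ennreal p * (ennreal (normal_density 0 \<sigma> (r + R)) * emeasure lborel ?G)"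
    using p by (simp add: ennreal_mult' mult.assoc)
  also have "\<dots> \<le> ennreal p * (\<integral>\<^sup>+ w. indicator ?G (mid z True + w) \<partial>NN)"
    by (intro mult_left_mono gauss_shift_lower G m) auto
  also have "\<dots> \<le> ennreal p * (\<integral>\<^sup>+ w. indicator E (mid z True + w, ?\<Delta>) \<partial>NN)"
    by (intro mult_left_mono nn_integral_mono) (auto split: split_indicator)
  also have "\<dots> \<le> (\<integral>\<^sup>+ y. indicator E y \<partial>PP z)"
    using nn_integral_PP[OF z, of "indicator E"] E by simp
  also have "\<dots> = emeasure (PP z) E"
    using E by (intro nn_integral_indicator) (simp add: closed_loop_kernel_def)
  finally show ?thesis .
qed

section \<open>Elementary moves between bins\<close>

definition In :: "real \<Rightarrow> (real \<times> real) set" where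
  "In \<Delta> = {- (real K / 2 * \<Delta>)..real K / 2 * \<Delta>} \<times> {\<Delta>}"

lemma In_sets: "\<Delta> \<in> bins \<Longrightarrow> In \<Delta> \<in> sets SS"
  unfolding In_def by (intro sets_SS_Times) auto

lemma mid_in:
  assumes "z \<in> In \<Delta>" "\<Delta> > 0"
  shows "\<bar>mid z True\<bar> \<le> \<bar>a\<bar> * (\<Delta> / 2)"
proof -
  have "\<bar>fst z\<bar> \<le> real K / 2 * \<Delta>" "snd z = \<Delta>" using assms by (auto simp: In_def)
  from quantizer_error[OF K assms(2) this(1)] this(2) show ?thesis
    unfolding mid_def abs_mult by (intro mult_left_mono) auto
qed

lemma mid_out:
  assumes "snd z > 0" "\<bar>fst z\<bar> > real K / 2 * snd z"
  shows "mid z \<upsilon> = a * fst z"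
  using quantizer_overflow[OF assms] by (simp add: mid_def)

text \<open>On a successful transmission the mean stays bounded over \<open>F\<close> and the new
  bin is fixed, so an interval of positive length is met with a probability bounded below uniformly
  in the start.\<close>

lemma uniformly_reaches_interval:
  assumes C: "C \<in> sets SS"
    and F: "\<And>z. z \<in> F \<Longrightarrow> z \<in> space SS \<Longrightarrow> \<bar>mid z True\<bar> \<le> R \<and> snd z * scl z True = \<Delta>" and \<Delta>: "\<Delta> \<in> bins"
    and uv: "u < v" and G: "uniformly_reaches SS PP C ({u..v} \<times> {\<Delta>})"
  shows "uniformly_reaches SS PP C F"
proof (rule uniformly_reaches_step[OF PP_subprob C G])
  let ?r = "max \<bar>u\<bar> \<bar>v\<bar>"
  let ?c = "p * normal_density 0 \<sigma> (?r + R) * (v - u)"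
  show E: "{u..v} \<times> {\<Delta>} \<in> sets SS" using \<Delta> by (intro sets_SS_Times) auto
  show "0 < ?c" using p uv \<sigma> normal_density_pos[OF \<sigma>] by simp
  fix z assume z: "z \<in> F" "z \<in> space SS"
  have G: "{-?r..?r} \<inter> {x. (x, snd z * scl z True) \<in> {u..v} \<times> {\<Delta>}} = {u..v}"
    using F[OF z] by auto
  have "ennreal ?c = ennreal (p * normal_density 0 \<sigma> (?r + R)) * emeasure lborel {u..v}"
    using uv p by (simp add: ennreal_mult)
  also have "\<dots> \<le> emeasure (PP z) ({u..v} \<times> {\<Delta>})"
    using emeasure_PP_ge[OF z(2) E, of R ?r] F[OF z] unfolding G by blast
  finally show "ennreal ?c \<le> emeasure (PP z) ({u..v} \<times> {\<Delta>})" .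
qed

definition Out :: "real \<Rightarrow> real \<Rightarrow> (real \<times> real) set" where
  "Out X \<Delta> = {z. real K / 2 * \<Delta> < \<bar>fst z\<bar> \<and> \<bar>fst z\<bar> \<le> X \<and> snd z = \<Delta>}"

text \<open>An overflow forces the zoom-out, and the quantizer output is 0 there. The bound
  \<open>X\<close> keeps the mean \<open>a * x\<close> bounded, so the noise can carry the state
  into the enlarged range.\<close>

lemma reaches_Out:
  assumes C: "C \<in> sets SS" and \<Delta>: "\<Delta> \<in> bins" and up: "uniformly_reaches SS PP C (In (\<Delta> * \<beta>))"
  shows "uniformly_reaches SS PP C (Out X \<Delta>)"
proof (rule uniformly_reaches_interval[OF C])
  have \<Delta>1: "\<Delta> \<ge> 1" using bins_ge_1[OF \<Delta>] .
  show "\<Delta> * \<beta> \<in> bins" using bins_up[OF \<Delta>] .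
  have "0 < real K / 2 * (\<Delta> * \<beta>)" using K \<Delta>1 \<beta>_gt_1 by simp
  then show "- (real K / 2 * (\<Delta> * \<beta>)) < real K / 2 * (\<Delta> * \<beta>)" by linarith
  show "uniformly_reaches SS PP C ({- (real K / 2 * (\<Delta> * \<beta>))..real K / 2 * (\<Delta> * \<beta>)} \<times> {\<Delta> * \<beta>})"
    using up by (simp only: In_def)
  fix z assume z: "z \<in> Out X \<Delta>"
  then have "mid z True = a * fst z" using \<Delta>1 by (intro mid_out) (auto simp: Out_def)
  moreover have "\<bar>a\<bar> * \<bar>fst z\<bar> \<le> \<bar>a\<bar> * X" using z by (intro mult_left_mono) (auto simp: Out_def)
  ultimately show "\<bar>mid z True\<bar> \<le> \<bar>a\<bar> * X \<and> snd z * scl z True = \<Delta> * \<beta>"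
    using z by (auto simp: Out_def scl_def abs_mult)
qed

lemma scl_In: "z \<in> In \<Delta> \<Longrightarrow> scl z True = (if \<Delta> \<ge> L then \<alpha> else 1)"
  by (auto simp: In_def scl_def abs_le_iff)

text \<open>One successful in-range transmission zooms in; the quantization error bounds the new
  mean by \<open>\<bar>a\<bar> * (\<Delta> / 2)\<close> over the whole range.\<close>

lemma reaches_In_high:
  assumes C: "C \<in> sets SS" and \<Delta>: "\<Delta> \<in> bins" "\<Delta> \<ge> L" and down: "uniformly_reaches SS PP C (In (\<Delta> * \<alpha>))"
  shows "uniformly_reaches SS PP C (In \<Delta>)"
proof (rule uniformly_reaches_interval[OF C])
  have \<Delta>1: "\<Delta> \<ge> 1" using bins_ge_1[OF \<Delta>(1)] .
  show "\<Delta> * \<alpha> \<in> bins" using bins_down[OF \<Delta>] .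
  have "0 < real K / 2 * (\<Delta> * \<alpha>)" using K \<Delta>1 \<alpha> by simp
  then show "- (real K / 2 * (\<Delta> * \<alpha>)) < real K / 2 * (\<Delta> * \<alpha>)" by linarith
  show "uniformly_reaches SS PP C ({- (real K / 2 * (\<Delta> * \<alpha>))..real K / 2 * (\<Delta> * \<alpha>)} \<times> {\<Delta> * \<alpha>})"
    using down by (simp only: In_def)
  fix z assume z: "z \<in> In \<Delta>"
  then show "\<bar>mid z True\<bar> \<le> \<bar>a\<bar> * (\<Delta> / 2) \<and> snd z * scl z True = \<Delta> * \<alpha>"
    using mid_in[OF z] \<Delta>1 scl_In[OF z] \<Delta>(2) by (auto simp: In_def)
qed

text \<open>Below \<open>L\<close> a successful in-range transmission keeps the bin, and erasures
  may have probability 0. The way up therefore goes through the noise: it first pushes the state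
  just beyond the range, and the overflow then enlarges the bin.\<close>

lemma reaches_In_low:
  assumes C: "C \<in> sets SS" and \<Delta>: "\<Delta> \<in> bins" "\<Delta> < L" and up: "uniformly_reaches SS PP C (In (\<Delta> * \<beta>))"
  shows "uniformly_reaches SS PP C (In \<Delta>)"
proof (rule uniformly_reaches_interval[OF C])
  let ?u = "real K / 2 * \<Delta>"
  have \<Delta>1: "\<Delta> \<ge> 1" using bins_ge_1[OF \<Delta>(1)] .
  have u: "?u > 0" using \<Delta>1 K by simp
  show "\<Delta> \<in> bins" by fact
  show "?u + 1 < ?u + 2" by simp
  show "uniformly_reaches SS PP C ({?u + 1..?u + 2} \<times> {\<Delta>})"
    by (rule uniformly_reaches_subset[OF reaches_Out[OF C \<Delta>(1) up, of "?u + 2"]]) (use u in \<open>auto simp: Out_def\<close>)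
  fix z assume z: "z \<in> In \<Delta>"
  then show "\<bar>mid z True\<bar> \<le> \<bar>a\<bar> * (\<Delta> / 2) \<and> snd z * scl z True = \<Delta>"
    using mid_in[OF z] \<Delta>1 scl_In[OF z] \<Delta>(2) by (auto simp: In_def)
qed

text \<open>Zooming in from \<open>\<Delta>\<^sub>0\<close> stops at the first level below
  \<open>L\<close>. Its predecessor is still at least \<open>L\<close>, so the level is at least
  \<open>\<alpha> * L\<close> and hence admissible.\<close>

lemma ex_low_level:
  obtains nl where "lev nl \<in> bins" "lev nl < L" "int A dvd nl - n\<^sub>0"
proof -
  have ex: "\<exists>j. lev (n\<^sub>0 - int j * int A) < L"
  proof -
    obtain N where N: "\<alpha> ^ N < L / \<Delta>\<^sub>0"
      using real_arch_pow_inv[of "L / \<Delta>\<^sub>0" \<alpha>] L \<Delta>\<^sub>0 \<alpha> by auto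
    have "lev (n\<^sub>0 - int j * int A) = \<Delta>\<^sub>0 * \<alpha> ^ j" for j
    proof (induction j)
      case (Suc j)
      have "n\<^sub>0 - int (Suc j) * int A = (n\<^sub>0 - int j * int A) + - int A" by (simp add: algebra_simps)
      then have "lev (n\<^sub>0 - int (Suc j) * int A) = lev (n\<^sub>0 - int j * int A) * \<alpha>"
        by (simp only: lev_add lev_A)
      then show ?case using Suc by simp
    qed (simp add: lev_n\<^sub>0)
    moreover have "\<Delta>\<^sub>0 * \<alpha> ^ N < L" using N L \<Delta>\<^sub>0 by (simp add: field_simps)
    ultimately show ?thesis by metis
  qed
  define j where "j = (LEAST j. lev (n\<^sub>0 - int j * int A) < L)"
  have j: "lev (n\<^sub>0 - int j * int A) < L" unfolding j_def using LeastI_ex[OF ex] .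
  then have "j \<noteq> 0" using \<Delta>\<^sub>0 lev_n\<^sub>0 by (intro notI) simp
  then obtain i where i: "j = Suc i" using not0_implies_Suc by blast
  have "\<not> lev (n\<^sub>0 - int i * int A) < L"
    using not_less_Least[of i "\<lambda>j. lev (n\<^sub>0 - int j * int A) < L"] i unfolding j_def by simp
  then have iL: "lev (n\<^sub>0 - int i * int A) \<ge> L" by simp
  have "n\<^sub>0 - int j * int A = (n\<^sub>0 - int i * int A) + - int A" using i by (simp add: algebra_simps)
  then have "lev (n\<^sub>0 - int j * int A) = lev (n\<^sub>0 - int i * int A) * \<alpha>" by (simp only: lev_add lev_A)
  then have ge: "\<alpha> * L \<le> lev (n\<^sub>0 - int j * int A)" using iL \<alpha> by (simp add: mult.commute)
  have "n\<^sub>0 - int j * int A = n\<^sub>0 - int j * int A + int 0 * int B" by simp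
  then have "lev (n\<^sub>0 - int j * int A) \<in> bins" unfolding bins_iff using ge by blast
  moreover have "int A dvd (n\<^sub>0 - int j * int A) - n\<^sub>0" by simp
  ultimately show ?thesis using j that by blast
qed

text \<open>Admissible levels below \<open>L\<close> lie in the window from
  \<open>\<alpha> * L\<close> to \<open>L\<close>. Its ratio \<open>1 / \<alpha>\<close> corresponds
  to \<open>A\<close> levels, so each residue class modulo \<open>A\<close> occurs at most
  once.\<close>

lemma low_level_unique:
  assumes "lev m \<in> bins" "lev m < L" "lev n \<in> bins" "lev n < L" "int A dvd m - n"
  shows "m = n"
proof -
  have *: "i < j + int A" if "lev j \<in> bins" "lev i < L" for i j
  proof (rule ccontr)
    assume "\<not> i < j + int A"
    then have "lev j \<le> lev (i + - int A)" by (simp add: lev_le_iff)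
    also have "\<dots> = lev i * \<alpha>" by (simp only: lev_add lev_A)
    also have "\<dots> < L * \<alpha>" using that \<alpha> by simp
    also have "L * \<alpha> \<le> lev j" using bins_ge[OF that(1)] by (simp add: mult.commute)
    finally show False by simp
  qed
  obtain k where k: "m - n = int A * k" using assms(5) by blast
  have "int A * k < int A * 1" "int A * (-1) < int A * k"
    using *[OF assms(3,2)] *[OF assms(1,4)] k by linarith+
  then have "k < 1" "-1 < k" using A_pos unfolding mult_less_cancel_left by linarith+
  then have "k = 0" by linarith
  then show ?thesis using k by simp
qed

text \<open>The outer induction is over the number \<open>k\<close> of zoom-outs still to be made,
  the inner one over the level while zooming in. Zooming in preserves the residue modulo
  \<open>A\<close>, and each zoom-out adds \<open>B\<close>; once \<open>k = 0\<close> and the level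
  is below \<open>L\<close>, the residue singles out \<open>nl\<close>.\<close>

lemma reaches_In:
  assumes nl: "lev nl \<in> bins" "lev nl < L" "int A dvd nl - n\<^sub>0" and n: "lev n \<in> bins"
  shows "uniformly_reaches SS PP (In (lev nl)) (In (lev n))"
proof -
  let ?C = "In (lev nl)"
  have C: "?C \<in> sets SS" using In_sets nl by blast
  have *: "uniformly_reaches SS PP ?C (In (lev m))"
    if "lev m \<in> bins" "int A dvd m + int k * int B - nl" for k m
    using that
  proof (induction k arbitrary: m)
    case 0
    then show ?case
    proof (induction "nat m" arbitrary: m rule: less_induct)
      case less
      show ?case
      proof (cases "lev m < L")
        case True
        then have "m = nl" using less.prems nl by (intro low_level_unique) auto
        then show ?thesis by (simp add: uniformly_reaches_self)
      next
        case False
        have m: "lev (m + - int A) = lev m * \<alpha>" by (simp only: lev_add lev_A)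
        have d: "lev (m + - int A) \<in> bins" unfolding m using less.prems False by (intro bins_down) auto
        have "lev 0 \<le> lev (m + - int A)" using bins_ge_1[OF d] by (simp add: lev_def)
        then have "nat (m + - int A) < nat m" using A_pos by (simp add: lev_le_iff)
        moreover have "int A dvd m + - int A + int 0 * int B - nl"
          using dvd_diff[OF less.prems(2) dvd_refl] by (simp add: algebra_simps)
        ultimately have "uniformly_reaches SS PP ?C (In (lev m * \<alpha>))"
          using less.hyps[OF _ d] unfolding m by blast
        moreover have "L \<le> lev m" using False by simp
        ultimately show ?thesis by (intro reaches_In_high[OF C less.prems(1)])
      qed
    qed
  next
    case (Suc k)
    note IHk = Suc.IH
    from Suc.prems show ?case
    proof (induction "nat m" arbitrary: m rule: less_induct)
      case less
      show ?case
      proof (cases "lev m < L")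
        case True
        have m: "lev (m + int B) = lev m * \<beta>" by (simp only: lev_add lev_B)
        have "uniformly_reaches SS PP ?C (In (lev (m + int B)))"
        proof (rule IHk)
          show "lev (m + int B) \<in> bins" unfolding m by (intro bins_up less.prems)
          show "int A dvd m + int B + int k * int B - nl" using less.prems(2) by (simp add: algebra_simps)
        qed
        then show ?thesis unfolding m by (rule reaches_In_low[OF C less.prems(1) True])
      next
        case False
        have m: "lev (m + - int A) = lev m * \<alpha>" by (simp only: lev_add lev_A)
        have d: "lev (m + - int A) \<in> bins" unfolding m using less.prems False by (intro bins_down) auto
        have "lev 0 \<le> lev (m + - int A)" using bins_ge_1[OF d] by (simp add: lev_def)
        then have "nat (m + - int A) < nat m" using A_pos by (simp add: lev_le_iff)
        moreover have "int A dvd m + - int A + int (Suc k) * int B - nl"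
          using dvd_diff[OF less.prems(2) dvd_refl] by (simp add: algebra_simps)
        ultimately have "uniformly_reaches SS PP ?C (In (lev m * \<alpha>))"
          using less.hyps[OF _ d] unfolding m by blast
        moreover have "L \<le> lev m" using False by simp
        ultimately show ?thesis by (intro reaches_In_high[OF C less.prems(1)])
      qed
    qed
  qed
  obtain m N\<^sub>A N\<^sub>B where m: "lev n = lev m" "m = n\<^sub>0 - int N\<^sub>A * int A + int N\<^sub>B * int B"
    using n by (auto simp: bins_iff)
  \<comment> \<open>The level already contains \<open>N\<^sub>B\<close> zoom-outs; another
    \<open>N\<^sub>B * (A - 1)\<close> of them complete the number to \<open>N\<^sub>B * A\<close>,
    whose effect is 0 modulo \<open>A\<close>. This holds for arbitrary positive \<open>A\<close>
    and \<open>B\<close>.\<close>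
  have "m + int (N\<^sub>B * (A - 1)) * int B - nl = int A * (int N\<^sub>B * int B - int N\<^sub>A) - (nl - n\<^sub>0)"
    using A_pos m(2) by (simp add: of_nat_diff algebra_simps)
  moreover have "int A dvd int A * (int N\<^sub>B * int B - int N\<^sub>A) - (nl - n\<^sub>0)"
    by (intro dvd_diff dvd_triv_left nl(3))
  ultimately have "int A dvd m + int (N\<^sub>B * (A - 1)) * int B - nl" by (simp only:)
  then show ?thesis using *[of m] n unfolding m(1) by blast
qed

text \<open>The box meets finitely many bins, and within each bin its states are either in range or
  in bounded overflow.\<close>

lemma reaches_compact:
  assumes nl: "lev nl \<in> bins" "lev nl < L" "int A dvd nl - n\<^sub>0"
  shows "uniformly_reaches SS PP (In (lev nl)) ({-X..X} \<times> {\<Delta> \<in> bins. \<Delta> \<le> D})"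
proof (rule uniformly_reaches_subset[OF uniformly_reaches_UN[OF PP_subprob finite_bins_le[of D]]])
  let ?C = "In (lev nl)"
  have C: "?C \<in> sets SS" using In_sets nl by blast
  show "uniformly_reaches SS PP ?C (In \<Delta> \<union> Out X \<Delta>)" if \<Delta>: "\<Delta> \<in> {\<Delta> \<in> bins. \<Delta> \<le> D}" for \<Delta>
  proof -
    have b: "\<Delta> \<in> bins" "\<Delta> * \<beta> \<in> bins" using \<Delta> bins_up by auto
    then obtain m n where "\<Delta> = lev m" "\<Delta> * \<beta> = lev n" by (auto simp: bins_iff)
    then have "uniformly_reaches SS PP ?C (In \<Delta>)" "uniformly_reaches SS PP ?C (In (\<Delta> * \<beta>))"
      using reaches_In[OF nl] b by metis+
    then show ?thesis using reaches_Out[OF C b(1)] uniformly_reaches_Un[OF PP_subprob] by blast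
  qed
  show "{-X..X} \<times> {\<Delta> \<in> bins. \<Delta> \<le> D} \<subseteq> (\<Union>\<Delta>\<in>{\<Delta> \<in> bins. \<Delta> \<le> D}. In \<Delta> \<union> Out X \<Delta>)"
  proof
    fix z assume z: "z \<in> {-X..X} \<times> {\<Delta> \<in> bins. \<Delta> \<le> D}"
    then have "z \<in> In (snd z) \<or> z \<in> Out X (snd z)"
      by (cases "real K / 2 * snd z < \<bar>fst z\<bar>") (auto simp: In_def Out_def abs_le_iff)
    then show "z \<in> (\<Union>\<Delta>\<in>{\<Delta> \<in> bins. \<Delta> \<le> D}. In \<Delta> \<union> Out X \<Delta>)"
      using z by auto
  qed
qed

end

section \<open>The Lyapunov function\<close>

lemma nn_integral_affine_abs_gauss:
  assumes "\<sigma> > 0" "u \<ge> 0" "v \<ge> 0"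
  shows "(\<integral>\<^sup>+ w. ennreal (u + v * \<bar>w\<bar>) \<partial>density lborel (normal_density 0 \<sigma>))
    = ennreal (u + v * (\<integral>w. normal_density 0 \<sigma> w * \<bar>w\<bar> \<partial>lborel))"
proof -
  have 1: "integrable lborel (\<lambda>w. normal_density 0 \<sigma> w * \<bar>w\<bar>)"
    using integrable_normal_moment_abs[OF assms(1), of 0 1] by simp
  have i: "integrable lborel (\<lambda>w. u * normal_density 0 \<sigma> w + v * (normal_density 0 \<sigma> w * \<bar>w\<bar>))"
    using 1 integrable_normal_density[OF assms(1), of 0] by (intro Bochner_Integration.integrable_add) auto
  have "(\<integral>\<^sup>+ w. ennreal (u + v * \<bar>w\<bar>) \<partial>density lborel (normal_density 0 \<sigma>))
      = (\<integral>\<^sup>+ w. ennreal (u * normal_density 0 \<sigma> w + v * (normal_density 0 \<sigma> w * \<bar>w\<bar>)) \<partial>lborel)"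
    using assms by (subst nn_integral_density) (auto simp: ennreal_mult' [symmetric] algebra_simps intro!: nn_integral_cong)
  also have "\<dots> = ennreal (\<integral>w. u * normal_density 0 \<sigma> w + v * (normal_density 0 \<sigma> w * \<bar>w\<bar>) \<partial>lborel)"
    using i assms by (intro nn_integral_eq_integral AE_I2) auto
  also have "(\<integral>w. u * normal_density 0 \<sigma> w + v * (normal_density 0 \<sigma> w * \<bar>w\<bar>) \<partial>lborel)
      = u + v * (\<integral>w. normal_density 0 \<sigma> w * \<bar>w\<bar> \<partial>lborel)"
    using 1 integrable_normal_density[OF assms(1), of 0] integral_normal_density[OF assms(1), of 0]
    by (subst Bochner_Integration.integral_add) auto
  finally show ?thesis .
qed

context quantized_loop
begin

text \<open>In overflow the plant state is multiplied by \<open>a\<close> and the bin by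
  \<open>\<beta>\<close>: noise aside, \<open>\<kappa>\<close> is the amount by which the logarithm
  of the relative size falls per zoom-out.\<close>

definition \<kappa> :: real where "\<kappa> = ln (\<beta> / \<bar>a\<bar>)"

text \<open>The number of zoom-out steps needed to catch a plant state of relative size \<open>h\<close>.\<close>

definition \<phi> :: "real \<Rightarrow> real" where
  "\<phi> h = (if h \<le> 1 then 0 else 1 + ln h / \<kappa>)"

definition rel_size :: "real \<times> real \<Rightarrow> real" where
  "rel_size z = 2 * \<bar>fst z\<bar> / (real K * snd z)"

lemma \<kappa>_pos: "\<kappa> > 0"
  unfolding \<kappa>_def using a \<delta> by (intro ln_gt_zero) (simp add: less_divide_eq)

lemma \<phi>_nonneg: "\<phi> h \<ge> 0"
  using \<kappa>_pos by (simp add: \<phi>_def)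

lemma rel_size_gt_1_iff: "snd z > 0 \<Longrightarrow> rel_size z > 1 \<longleftrightarrow> \<bar>fst z\<bar> > real K / 2 * snd z"
  using K by (auto simp: rel_size_def field_simps)

lemma \<alpha>K: "\<bar>a\<bar> / (real K * \<alpha>) < 1"
proof -
  have "2 powr (- log 2 (real K)) = 1 / real K" using K by (simp add: powr_minus_divide)
  then have "\<bar>a\<bar> / real K < \<alpha>" using \<alpha>_gt by simp
  then show ?thesis using K \<alpha> by (simp add: field_simps)
qed

text \<open>Bounds the noise-free relative size after an in-range step: on success an error of half
  a bin is compared with a range scaled by at least \<open>\<alpha>\<close>; after an erasure the
  growth \<open>\<bar>a\<bar>\<close> is compared with the zoom-out \<open>\<beta>\<close>.\<close>

definition \<theta> :: real where "\<theta> = max (\<bar>a\<bar> / (real K * \<alpha>)) (\<bar>a\<bar> / \<beta>)"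
text \<open>Collects three factors: a linear bound on \<open>\<phi>\<close> beyond 1, the size of
  the noise relative to the range, and the inverse of the gap \<open>1 - \<theta>\<close>.\<close>

definition c\<^sub>1 :: real where "c\<^sub>1 = (1 + 1 / \<kappa>) * (2 / (real K * \<alpha>)) / (1 - \<theta>)"

lemma \<theta>: "0 \<le> \<theta>" "\<theta> < 1"
  using \<alpha>K \<delta> a \<alpha> K by (auto simp: \<theta>_def le_max_iff_disj)

lemma c\<^sub>1_nonneg: "c\<^sub>1 \<ge> 0"
  using \<kappa>_pos \<theta> \<alpha> by (simp add: c\<^sub>1_def)

text \<open>To exceed 1 from at most \<open>\<theta>\<close>, the noise term must exceed the gap
  \<open>1 - \<theta>\<close>; then it dominates \<open>h\<close> and the jump of
  \<open>\<phi>\<close> up to a constant. So the jump is paid for linearly by the noise.\<close>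

lemma \<phi>_le_near:
  assumes "\<Delta> > 0" and h: "h \<le> \<theta> + 2 / (real K * \<alpha>) * w / \<Delta>" and w: "w \<ge> 0"
  shows "\<phi> h \<le> c\<^sub>1 * w / \<Delta>"
proof (cases "h \<le> 1")
  case True
  then show ?thesis using c\<^sub>1_nonneg w assms(1) by (simp add: \<phi>_def)
next
  case False
  define u where "u = 2 / (real K * \<alpha>) * w / \<Delta>"
  have u: "1 - \<theta> < u" using h False by (simp add: u_def)
  have "h \<le> \<theta> + u" using h by (simp add: u_def)
  \<comment> \<open>Since \<open>u > 1 - \<theta>\<close>, the summand \<open>\<theta>\<close> can
    be charged to \<open>u\<close>.\<close>
  also have "\<dots> \<le> u / (1 - \<theta>)"
  proof -
    have "\<theta> * (1 - \<theta>) \<le> \<theta> * u" using u \<theta> by (intro mult_left_mono) auto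
    then have "(\<theta> + u) * (1 - \<theta>) \<le> u" by (simp add: algebra_simps)
    then show ?thesis using \<theta> by (simp add: le_divide_eq)
  qed
  finally have hu: "h \<le> u / (1 - \<theta>)" .
  have "\<phi> h = 1 + ln h / \<kappa>" using False by (simp add: \<phi>_def)
  \<comment> \<open>As \<open>h > 1\<close>, both the jump 1 and \<open>ln h\<close> are at most
    \<open>h\<close>.\<close>
  also have "\<dots> \<le> h + h / \<kappa>"
    using False \<kappa>_pos ln_le_minus_one[of h] by (intro add_mono divide_right_mono) auto
  also have "\<dots> = (1 + 1 / \<kappa>) * h" by (simp add: algebra_simps)
  also have "\<dots> \<le> (1 + 1 / \<kappa>) * (u / (1 - \<theta>))" using hu \<kappa>_pos by (intro mult_left_mono) auto
  also have "(1 + 1 / \<kappa>) * (u / (1 - \<theta>)) = c\<^sub>1 * w / \<Delta>"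
  proof -
    have "x * (y * w / \<Delta> / t) = x * y / t * w / \<Delta>" for x y t :: real by (simp add: mult_ac)
    then show ?thesis unfolding c\<^sub>1_def u_def .
  qed
  finally show ?thesis .
qed

lemma \<phi>_next_in:
  assumes z: "snd z \<ge> 1" "\<bar>fst z\<bar> \<le> real K / 2 * snd z"
  shows "\<phi> (rel_size (mid z \<upsilon> + w, snd z * scl z \<upsilon>)) \<le> c\<^sub>1 * \<bar>w\<bar> / snd z"
proof (rule \<phi>_le_near)
  have \<Delta>: "snd z > 0" using z by simp
  have K0: "real K > 0" using K by simp
  show "snd z > 0" by fact
  show "\<bar>w\<bar> \<ge> 0" by simp
  let ?x = "\<bar>mid z \<upsilon> + w\<bar>"
  have x: "?x \<le> \<bar>mid z \<upsilon>\<bar> + \<bar>w\<bar>" by simp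
  show "rel_size (mid z \<upsilon> + w, snd z * scl z \<upsilon>) \<le> \<theta> + 2 / (real K * \<alpha>) * \<bar>w\<bar> / snd z"
  proof (cases \<upsilon>)
    case True
    have scl: "scl z \<upsilon> \<ge> \<alpha>" using \<alpha> True z by (auto simp: scl_def)
    have "\<bar>mid z \<upsilon>\<bar> \<le> \<bar>a\<bar> * (snd z / 2)"
      using quantizer_error[OF K \<Delta> z(2)] True unfolding mid_def abs_mult by (intro mult_left_mono) auto
    with x have x': "2 * ?x \<le> \<bar>a\<bar> * snd z + 2 * \<bar>w\<bar>" by simp
    have "rel_size (mid z \<upsilon> + w, snd z * scl z \<upsilon>) \<le> 2 * ?x / (real K * (snd z * \<alpha>))"
      unfolding rel_size_def using scl \<Delta> K0 \<alpha> by (auto intro!: divide_left_mono mult_left_mono)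
    also have "\<dots> \<le> (\<bar>a\<bar> * snd z + 2 * \<bar>w\<bar>) / (real K * (snd z * \<alpha>))"
      using x' \<Delta> K0 \<alpha> by (intro divide_right_mono) auto
    also have "\<dots> = \<bar>a\<bar> / (real K * \<alpha>) + 2 / (real K * \<alpha>) * \<bar>w\<bar> / snd z"
      using \<Delta> K0 \<alpha> by (simp add: field_simps)
    also have "\<dots> \<le> \<theta> + 2 / (real K * \<alpha>) * \<bar>w\<bar> / snd z" by (simp add: \<theta>_def)
    finally show ?thesis .
  next
    case False
    have scl: "scl z \<upsilon> = \<beta>" using False by (simp add: scl_def)
    have "\<bar>mid z \<upsilon>\<bar> \<le> \<bar>a\<bar> * (real K / 2 * snd z)"
      using z(2) False unfolding mid_def abs_mult by (intro mult_left_mono) auto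
    with x have x': "2 * ?x \<le> \<bar>a\<bar> * (real K * snd z) + 2 * \<bar>w\<bar>" by simp
    have "rel_size (mid z \<upsilon> + w, snd z * scl z \<upsilon>) \<le> (\<bar>a\<bar> * (real K * snd z) + 2 * \<bar>w\<bar>) / (real K * (snd z * \<beta>))"
      unfolding rel_size_def fst_conv snd_conv scl using x' \<Delta> K0 \<beta>_gt_1 by (intro divide_right_mono) auto
    also have "\<dots> = \<bar>a\<bar> / \<beta> + 2 / (real K * \<beta>) * \<bar>w\<bar> / snd z"
    proof -
      have "(\<bar>a\<bar> * (real K * snd z) + 2 * \<bar>w\<bar>) / (real K * (snd z * y))
        = \<bar>a\<bar> / y + 2 / (real K * y) * \<bar>w\<bar> / snd z" if "y > 0" for y
      using \<Delta> K0 that by (simp add: field_simps)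
      then show ?thesis using \<beta>_gt_1 by simp
    qed
    also have "2 / (real K * \<beta>) * \<bar>w\<bar> / snd z \<le> 2 / (real K * \<alpha>) * \<bar>w\<bar> / snd z"
      using \<alpha> \<beta>_gt_1 \<Delta> K0 by (intro divide_right_mono mult_right_mono divide_left_mono mult_left_mono) auto
    also have "\<bar>a\<bar> / \<beta> \<le> \<theta>" by (simp add: \<theta>_def)
    finally show ?thesis by simp
  qed
qed

lemma \<phi>_next_out:
  assumes z: "snd z \<ge> 1" "\<bar>fst z\<bar> > real K / 2 * snd z"
  shows "\<phi> (rel_size (mid z \<upsilon> + w, snd z * scl z \<upsilon>)) \<le> \<phi> (rel_size z) - 1 + \<bar>w\<bar> / (\<kappa> * \<bar>fst z\<bar>)"
proof -
  have \<Delta>: "snd z > 0" using z by simp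
  have K0: "real K > 0" using K by simp
  have h: "rel_size z > 1" using rel_size_gt_1_iff[OF \<Delta>] z(2) by simp
  have fz: "\<bar>fst z\<bar> > 0" using z(2) \<Delta> K0 by (smt (verit) mult_nonneg_nonneg divide_nonneg_nonneg)
  have scl: "scl z \<upsilon> = \<beta>" using z by (simp add: scl_def)
  have mid: "mid z \<upsilon> = a * fst z" using quantizer_overflow[OF \<Delta> z(2)] by (simp add: mid_def)
  let ?h = "rel_size (mid z \<upsilon> + w, snd z * scl z \<upsilon>)"
  have \<phi>z: "\<phi> (rel_size z) - 1 = ln (rel_size z) / \<kappa>" using h by (simp add: \<phi>_def)
  show ?thesis
  proof (cases "?h \<le> 1")
    case True
    \<comment> \<open>Because \<open>\<phi>\<close> is at least 1 in overflow, re-entry into the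
      range, where it is 0, also lowers it by at least one.\<close>
    have "0 \<le> ln (rel_size z) / \<kappa> + \<bar>w\<bar> / (\<kappa> * \<bar>fst z\<bar>)" using h \<kappa>_pos by simp
    then show ?thesis unfolding \<phi>z using True by (simp add: \<phi>_def)
  next
    case False
    have "\<bar>mid z \<upsilon> + w\<bar> \<le> \<bar>a\<bar> * \<bar>fst z\<bar> + \<bar>w\<bar>"
      unfolding mid abs_mult[symmetric] by (rule abs_triangle_ineq)
    \<comment> \<open>\<open>\<bar>a\<bar> \<ge> 1\<close> lets the noise share the factor
      \<open>\<bar>a\<bar>\<close>; the logarithm then splits into \<open>- \<kappa>\<close>, the
      old size and a term at most linear in the noise.\<close>
    also have "\<dots> \<le> \<bar>a\<bar> * \<bar>fst z\<bar> + \<bar>a\<bar> * \<bar>w\<bar>" using a mult_right_mono[of 1 "\<bar>a\<bar>" "\<bar>w\<bar>"] by simp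
    also have "\<dots> = \<bar>a\<bar> * \<bar>fst z\<bar> * (1 + \<bar>w\<bar> / \<bar>fst z\<bar>)" using fz by (simp add: field_simps)
    finally have "?h \<le> 2 * (\<bar>a\<bar> * \<bar>fst z\<bar> * (1 + \<bar>w\<bar> / \<bar>fst z\<bar>)) / (real K * (snd z * \<beta>))"
      unfolding rel_size_def fst_conv snd_conv scl using \<Delta> K0 \<beta>_gt_1 by (intro divide_right_mono mult_left_mono) auto
    also have "\<dots> = \<bar>a\<bar> / \<beta> * rel_size z * (1 + \<bar>w\<bar> / \<bar>fst z\<bar>)"
      unfolding rel_size_def using \<beta>_gt_1 by (simp add: mult_ac)
    finally have hle: "?h \<le> \<bar>a\<bar> / \<beta> * rel_size z * (1 + \<bar>w\<bar> / \<bar>fst z\<bar>)" .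
    have q: "0 < 1 + \<bar>w\<bar> / \<bar>fst z\<bar>" using fz by (simp add: add_pos_nonneg)
    have "ln ?h \<le> ln (\<bar>a\<bar> / \<beta> * rel_size z * (1 + \<bar>w\<bar> / \<bar>fst z\<bar>))" using hle False by simp
    also have "\<dots> = ln (\<bar>a\<bar> / \<beta>) + ln (rel_size z) + ln (1 + \<bar>w\<bar> / \<bar>fst z\<bar>)"
    proof -
      have "\<bar>a\<bar> / \<beta> > 0" using a \<beta>_gt_1 by simp
      moreover have "ln (x * y * t) = ln x + ln y + ln t" if "x > 0" "y > 0" "t > 0" for x y t :: real
        using that by (simp add: ln_mult)
      ultimately show ?thesis using h q by (metis less_trans zero_less_one)
    qed
    also have "ln (\<bar>a\<bar> / \<beta>) = - \<kappa>" unfolding \<kappa>_def using a \<beta>_gt_1 by (simp add: ln_div)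
    also have "ln (1 + \<bar>w\<bar> / \<bar>fst z\<bar>) \<le> \<bar>w\<bar> / \<bar>fst z\<bar>" by (rule ln_add_one_self_le_self) simp
    finally have "ln ?h \<le> - \<kappa> + ln (rel_size z) + \<bar>w\<bar> / \<bar>fst z\<bar>" by simp
    then have "ln ?h / \<kappa> \<le> (- \<kappa> + ln (rel_size z) + \<bar>w\<bar> / \<bar>fst z\<bar>) / \<kappa>"
      using \<kappa>_pos by (intro divide_right_mono) auto
    also have "\<dots> = - 1 + ln (rel_size z) / \<kappa> + \<bar>w\<bar> / (\<kappa> * \<bar>fst z\<bar>)" using \<kappa>_pos fz by (simp add: field_simps)
    finally show ?thesis unfolding \<phi>z using False by (simp add: \<phi>_def)
  qed
qed

definition \<eta> :: real where "\<eta> = - (p * ln \<alpha> + (1 - p) * ln \<beta>)"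
text \<open>Chosen so that \<open>ln \<beta> - c\<^sub>0 = - \<eta>\<close>: overflow states then
  drift down at the same rate as in-range states with a bin of at least \<open>L\<close>.\<close>

definition c\<^sub>0 :: real where "c\<^sub>0 = ln \<beta> + \<eta>"

text \<open>Taking the logarithm of \<open>drift_cond\<close> and multiplying by \<open>p\<close>
  turns the exponent \<open>1 / p - 1\<close> into the erasure probability
  \<open>1 - p\<close>.\<close>

lemma \<eta>_pos: "\<eta> > 0"
proof -
  have "\<alpha> * \<beta> powr (1 / p - 1) > 0" using \<alpha> \<beta>_gt_1 by simp
  then have "ln (\<alpha> * \<beta> powr (1 / p - 1)) < 0" using drift_cond by (simp add: ln_less_zero_iff)
  then have "ln \<alpha> + (1 / p - 1) * ln \<beta> < 0" using \<alpha> \<beta>_gt_1 by (simp add: ln_mult ln_powr)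
  then have "p * (ln \<alpha> + (1 / p - 1) * ln \<beta>) < 0" using p by (simp add: mult_less_0_iff)
  also have "p * (ln \<alpha> + (1 / p - 1) * ln \<beta>) = p * ln \<alpha> + (p * (1 / p - 1)) * ln \<beta>"
    by (simp only: distrib_left mult.assoc)
  also have "p * (1 / p - 1) = 1 - p" using p by (simp add: right_diff_distrib)
  finally show ?thesis unfolding \<eta>_def by simp
qed

lemma ln_\<beta>_pos: "ln \<beta> > 0" using \<beta>_gt_1 by simp

section \<open>The Lyapunov function and its drift inequalities\<close>

definition V :: "real \<times> real \<Rightarrow> real" where "V z = ln (snd z) + c\<^sub>0 * \<phi> (rel_size z)"

lemma V_measurable: "V \<in> borel_measurable SS"
proof -
  have 1: "fst \<in> borel_measurable SS" unfolding state_space_def by measurable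
  have "snd \<in> SS \<rightarrow>\<^sub>M count_space bins" unfolding state_space_def by measurable
  from measurable_compose[OF this, of "\<lambda>x. x" borel] have 2: "snd \<in> borel_measurable SS" by simp
  note [measurable] = 1 2
  show ?thesis unfolding V_def[abs_def] \<phi>_def rel_size_def by measurable
qed


definition \<mu>\<^sub>w :: real where "\<mu>\<^sub>w = (\<integral>w. normal_density 0 \<sigma> w * \<bar>w\<bar> \<partial>lborel)"

lemma \<mu>\<^sub>w_nonneg: "\<mu>\<^sub>w \<ge> 0"
  unfolding \<mu>\<^sub>w_def by (intro integral_nonneg_AE AE_I2) auto

lemma c\<^sub>0_pos: "c\<^sub>0 > 0"
  using \<eta>_pos ln_\<beta>_pos by (simp add: c\<^sub>0_def)

lemma V_nonneg: "snd z \<ge> 1 \<Longrightarrow> V z \<ge> 0"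
  using c\<^sub>0_pos \<phi>_nonneg by (simp add: V_def)

lemma nn_integral_V_branch:
  assumes "\<And>w. V (mid z \<upsilon> + w, snd z * scl z \<upsilon>) \<le> u + v * \<bar>w\<bar>" "u \<ge> 0" "v \<ge> 0"
  shows "(\<integral>\<^sup>+ w. ennreal (V (mid z \<upsilon> + w, snd z * scl z \<upsilon>)) \<partial>NN) \<le> ennreal (u + v * \<mu>\<^sub>w)"
proof -
  have "(\<integral>\<^sup>+ w. ennreal (V (mid z \<upsilon> + w, snd z * scl z \<upsilon>)) \<partial>NN) \<le> (\<integral>\<^sup>+ w. ennreal (u + v * \<bar>w\<bar>) \<partial>NN)"
    using assms(1) by (intro nn_integral_mono ennreal_leI)
  also have "\<dots> = ennreal (u + v * \<mu>\<^sub>w)"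
    unfolding \<mu>\<^sub>w_def by (rule nn_integral_affine_abs_gauss[OF \<sigma> assms(2,3)])
  finally show ?thesis .
qed

text \<open>With one slope \<open>v\<close> for both branches the noise contributes
  \<open>v * \<mu>\<^sub>w\<close> whatever the weights, and only the offsets are averaged.\<close>

lemma PV_le:
  assumes z: "z \<in> space SS"
    and T: "\<And>w. V (mid z True + w, snd z * scl z True) \<le> u + v * \<bar>w\<bar>" "u \<ge> 0" "v \<ge> 0"
    and F: "\<And>w. V (mid z False + w, snd z * scl z False) \<le> u' + v * \<bar>w\<bar>" "u' \<ge> 0"
  shows "(\<integral>\<^sup>+ y. ennreal (V y) \<partial>PP z) \<le> ennreal (p * u + (1 - p) * u' + v * \<mu>\<^sub>w)"
proof -
  have "(\<integral>\<^sup>+ y. ennreal (V y) \<partial>PP z) \<le> ennreal p * ennreal (u + v * \<mu>\<^sub>w) + ennreal (1 - p) * ennreal (u' + v * \<mu>\<^sub>w)"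
    using V_measurable by (subst nn_integral_PP[OF z])
      (auto intro!: add_mono mult_left_mono nn_integral_V_branch T F)
  also have "\<dots> = ennreal (p * (u + v * \<mu>\<^sub>w) + (1 - p) * (u' + v * \<mu>\<^sub>w))"
    using p T F \<mu>\<^sub>w_nonneg by (simp add: ennreal_mult' ennreal_plus)
  also have "p * (u + v * \<mu>\<^sub>w) + (1 - p) * (u' + v * \<mu>\<^sub>w) = p * u + (1 - p) * u' + v * \<mu>\<^sub>w"
    by (simp add: algebra_simps)
  finally show ?thesis .
qed

lemma V_in:
  assumes "snd z \<ge> 1" "\<bar>fst z\<bar> \<le> real K / 2 * snd z"
  shows "V z = ln (snd z)"
proof -
  have "\<not> rel_size z > 1" using rel_size_gt_1_iff[of z] assms by simp
  then show ?thesis by (simp add: V_def \<phi>_def)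
qed

text \<open>Below \<open>L\<close> there is no zoom-in, so the logarithm of the bin may rise in
  mean, by at most \<open>ln \<beta>\<close>; in-range states of this kind are bounded and will be
  covered by the exceptional box.\<close>

lemma drift_in:
  assumes z: "z \<in> space SS" and i: "\<bar>fst z\<bar> \<le> real K / 2 * snd z"
  shows "(\<integral>\<^sup>+ y. ennreal (V y) \<partial>PP z) \<le> ennreal (V z + (if snd z \<ge> L then - \<eta> else ln \<beta>) + c\<^sub>0 * c\<^sub>1 / snd z * \<mu>\<^sub>w)"
proof -
  have \<Delta>: "snd z \<in> bins" "snd z \<ge> 1" using z bins_ge_1 by (auto simp: space_SS)
  let ?v = "c\<^sub>0 * c\<^sub>1 / snd z"
  let ?u = "ln (snd z) + (if snd z \<ge> L then ln \<alpha> else 0)" and ?u' = "ln (snd z) + ln \<beta>"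
  have v: "?v \<ge> 0" using c\<^sub>0_pos c\<^sub>1_nonneg \<Delta> by simp
  have sT: "snd z * scl z True \<ge> 1" using scl_bins[of "snd z" "fst z" True] \<Delta> bins_ge_1 by simp
  have lT: "ln (snd z * scl z True) = ?u" using i \<Delta> \<alpha> by (auto simp: scl_def ln_mult)
  have lF: "ln (snd z * scl z False) = ?u'" using \<Delta> \<beta>_gt_1 by (auto simp: scl_def ln_mult)
  have b: "V (mid z \<upsilon> + w, snd z * scl z \<upsilon>) \<le> ln (snd z * scl z \<upsilon>) + ?v * \<bar>w\<bar>" for \<upsilon> w
    using mult_left_mono[OF \<phi>_next_in[OF \<Delta>(2) i, of \<upsilon> w], of c\<^sub>0] c\<^sub>0_pos by (simp add: V_def mult.assoc)
  have "?u \<ge> 0" using ln_ge_zero[OF sT] lT by simp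
  moreover have "?u' \<ge> 0" using \<Delta> ln_\<beta>_pos by simp
  ultimately have "(\<integral>\<^sup>+ y. ennreal (V y) \<partial>PP z) \<le> ennreal (p * ?u + (1 - p) * ?u' + ?v * \<mu>\<^sub>w)"
    using b[of True] b[of False] lT lF v by (intro PV_le[OF z]) auto
  also have "p * ?u + (1 - p) * ?u' \<le> V z + (if snd z \<ge> L then - \<eta> else ln \<beta>)"
  proof (cases "snd z \<ge> L")
    case True
    then show ?thesis using V_in[OF \<Delta>(2) i] by (simp add: \<eta>_def algebra_simps)
  next
    case False
    have "p * ?u + (1 - p) * ?u' = ln (snd z) + (1 - p) * ln \<beta>" using False by (simp add: algebra_simps)
    also have "\<dots> \<le> ln (snd z) + ln \<beta>" using p ln_\<beta>_pos mult_right_mono[of "1 - p" 1 "ln \<beta>"] by simp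
    finally show ?thesis using V_in[OF \<Delta>(2) i] False by simp
  qed
  finally show ?thesis by (simp add: ennreal_leI)
qed

text \<open>In overflow the quantizer output is 0 and the bin grows by \<open>\<beta>\<close> in any
  case, so success and erasure obey the same bound and their weights play out to 1.\<close>

lemma drift_out:
  assumes z: "z \<in> space SS" and i: "\<bar>fst z\<bar> > real K / 2 * snd z"
  shows "(\<integral>\<^sup>+ y. ennreal (V y) \<partial>PP z) \<le> ennreal (V z - \<eta> + c\<^sub>0 / (\<kappa> * \<bar>fst z\<bar>) * \<mu>\<^sub>w)"
proof -
  have \<Delta>: "snd z \<in> bins" "snd z \<ge> 1" using z bins_ge_1 by (auto simp: space_SS)
  let ?v = "c\<^sub>0 / (\<kappa> * \<bar>fst z\<bar>)" and ?u = "V z - \<eta>"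
  have v: "?v \<ge> 0" using c\<^sub>0_pos \<kappa>_pos by simp
  have l: "ln (snd z * scl z \<upsilon>) = ln (snd z) + ln \<beta>" for \<upsilon>
    using i \<Delta> \<beta>_gt_1 by (auto simp: scl_def ln_mult)
  have b: "V (mid z \<upsilon> + w, snd z * scl z \<upsilon>) \<le> ?u + ?v * \<bar>w\<bar>" for \<upsilon> w
  proof -
    have "V (mid z \<upsilon> + w, snd z * scl z \<upsilon>) \<le> ln (snd z) + ln \<beta> + c\<^sub>0 * (\<phi> (rel_size z) - 1 + \<bar>w\<bar> / (\<kappa> * \<bar>fst z\<bar>))"
      using mult_left_mono[OF \<phi>_next_out[OF \<Delta>(2) i, of \<upsilon> w], of c\<^sub>0] c\<^sub>0_pos l by (simp add: V_def)
    also have "\<dots> = (ln (snd z) + c\<^sub>0 * \<phi> (rel_size z)) + (ln \<beta> - c\<^sub>0) + ?v * \<bar>w\<bar>"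
      by (simp add: distrib_left right_diff_distrib)
    also have "\<dots> = ?u + ?v * \<bar>w\<bar>" by (simp add: V_def c\<^sub>0_def)
    finally show ?thesis .
  qed
  have "rel_size z > 1" using rel_size_gt_1_iff[of z] \<Delta> i by simp
  then have "\<phi> (rel_size z) \<ge> 1" using \<kappa>_pos by (simp add: \<phi>_def)
  then have "V z \<ge> 0 + c\<^sub>0 * 1" unfolding V_def using \<Delta> c\<^sub>0_pos by (intro add_mono mult_left_mono) auto
  then have "?u \<ge> 0" using ln_\<beta>_pos by (simp add: c\<^sub>0_def)
  then have "(\<integral>\<^sup>+ y. ennreal (V y) \<partial>PP z) \<le> ennreal (p * ?u + (1 - p) * ?u + ?v * \<mu>\<^sub>w)"
    using b v by (intro PV_le[OF z]) auto
  then show ?thesis by (simp add: algebra_simps)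
qed

lemma drift_to_compact:
  obtains X D e V' where "e \<ge> 0" "V' \<in> borel_measurable SS" "\<And>z. z \<in> space SS \<Longrightarrow> V' z < \<infinity>"
    "\<And>z. z \<in> space SS \<Longrightarrow> (\<integral>\<^sup>+ y. V' y \<partial>PP z) + 1
      \<le> V' z + ennreal e * indicator ({-X..X} \<times> {\<Delta> \<in> bins. \<Delta> \<le> D}) z"
proof -
  \<comment> \<open>Both noise errors are at most \<open>m\<close> divided by the bin size or by the
    modulus of the plant state, so they fall below \<open>\<eta> / 2\<close> once that divisor
    exceeds \<open>2 * m / \<eta>\<close>.\<close>
  define m where "m = c\<^sub>0 * (c\<^sub>1 + 1 / \<kappa>) * \<mu>\<^sub>w"
  have m0: "m \<ge> 0" using c\<^sub>0_pos c\<^sub>1_nonneg \<kappa>_pos \<mu>\<^sub>w_nonneg by (simp add: m_def)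
  have m1: "c\<^sub>0 * c\<^sub>1 * \<mu>\<^sub>w \<le> m" "c\<^sub>0 / \<kappa> * \<mu>\<^sub>w \<le> m"
    using c\<^sub>0_pos c\<^sub>1_nonneg \<kappa>_pos \<mu>\<^sub>w_nonneg by (auto simp: m_def algebra_simps)
  \<comment> \<open>In-range states with a bin above \<open>D\<^sub>1\<close> zoom in on success and
    have a small error. \<open>X\<close> covers the ranges of all smaller bins, and overflow beyond
    \<open>X\<close> has a small error. An overflow state within \<open>X\<close> has a bin below
    \<open>2 * X / K\<close>, which \<open>D\<close> includes. So the box contains every state where
    the drift may fail.\<close>
  define D\<^sub>1 where "D\<^sub>1 = max L (2 * m / \<eta>)"
  define X where "X = max (max 1 (2 * m / \<eta>)) (real K / 2 * D\<^sub>1)"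
  define D where "D = max D\<^sub>1 (2 * X / real K)"
  \<comment> \<open>The largest increase \<open>ln \<beta> + m\<close> in one step, plus the
    decrease \<open>\<eta> / 2\<close> that is demanded everywhere.\<close>
  define e where "e = ln \<beta> + m + \<eta> / 2"
  let ?D = "{-X..X} \<times> {\<Delta> \<in> bins. \<Delta> \<le> D}"
  have K0: "real K > 0" using K by simp
  have small: "m / y \<le> \<eta> / 2" if "y > 2 * m / \<eta>" "y > 0" for y
    using that \<eta>_pos by (simp add: field_simps)
  have e0: "e \<ge> 0" using m0 \<eta>_pos ln_\<beta>_pos by (simp add: e_def)
  have PV: "(\<integral>\<^sup>+ y. ennreal (V y) \<partial>PP z) + ennreal (\<eta> / 2) \<le> ennreal (V z) + ennreal e * indicator ?D z"
    if z: "z \<in> space SS" for z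
  proof -
    have \<Delta>: "snd z \<in> bins" "snd z \<ge> 1" using z bins_ge_1 by (auto simp: space_SS)
    have Vz: "V z \<ge> 0" using V_nonneg \<Delta> by simp
    have in_D: "z \<in> ?D" if "\<bar>fst z\<bar> \<le> X" "snd z \<le> D"
      using that \<Delta> by (cases z) (auto simp: abs_le_iff)
    have big: "snd z > D\<^sub>1" if "\<bar>fst z\<bar> \<le> real K / 2 * snd z" "z \<notin> ?D"
    proof (rule ccontr)
      assume *: "\<not> snd z > D\<^sub>1"
      then have "real K / 2 * snd z \<le> real K / 2 * D\<^sub>1" by (intro mult_left_mono) auto
      then have "\<bar>fst z\<bar> \<le> X" "snd z \<le> D" using that * by (auto simp: X_def D_def)
      then show False using in_D that by blast
    qed
    have *: ?thesis if r: "(\<integral>\<^sup>+ y. ennreal (V y) \<partial>PP z) \<le> ennreal r" "r \<le> V z - \<eta> / 2 + (if z \<in> ?D then e else 0)" for r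
    proof (cases "z \<in> ?D")
      case True
      have "(\<integral>\<^sup>+ y. ennreal (V y) \<partial>PP z) + ennreal (\<eta> / 2) \<le> ennreal (V z - \<eta> / 2 + e) + ennreal (\<eta> / 2)"
        using r True by (intro add_right_mono) (auto intro: order_trans ennreal_leI)
      also have "\<dots> = ennreal (V z + e)" using Vz m0 \<eta>_pos ln_\<beta>_pos by (simp add: e_def flip: ennreal_plus)
      finally show ?thesis using True Vz e0 by (simp add: ennreal_plus)
    next
      case zD: False
      \<comment> \<open>Without this, \<open>ennreal\<close> would cut the difference off at 0. In
        range outside the box, the successor bin \<open>\<Delta> * \<alpha>\<close> is at least 1,
        whence \<open>ln \<Delta> \<ge> - ln \<alpha> \<ge> \<eta>\<close>; in overflow
        \<open>V\<close> is at least \<open>c\<^sub>0 > \<eta>\<close>.\<close>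
      have "V z - \<eta> / 2 \<ge> 0"
      proof (rule ccontr)
        assume neg: "\<not> V z - \<eta> / 2 \<ge> 0"
        show False
        proof (cases "\<bar>fst z\<bar> \<le> real K / 2 * snd z")
          case True
          have "snd z > D\<^sub>1" using big[OF True zD] .
          then have "snd z * scl z True \<in> bins" "snd z \<ge> L" using scl_bins[OF \<Delta>(1), of "fst z" True] by (auto simp: D\<^sub>1_def)
          then have "snd z * scl z True \<ge> 1" using bins_ge_1 by blast
          then have "snd z * \<alpha> \<ge> 1" using True \<open>snd z \<ge> L\<close> by (simp add: scl_def)
          then have "ln (snd z * \<alpha>) \<ge> 0" by simp
          then have "ln (snd z) + ln \<alpha> \<ge> 0" using \<alpha> \<Delta> by (simp add: ln_mult)
          moreover have "\<eta> \<le> - ln \<alpha>"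
          proof -
            have "\<eta> \<le> - (p * ln \<alpha>)" using p ln_\<beta>_pos by (simp add: \<eta>_def)
            also have "- (p * ln \<alpha>) \<le> - ln \<alpha>" using p \<alpha> mult_right_mono_neg[of p 1 "ln \<alpha>"] by simp
            finally show ?thesis .
          qed
          ultimately show False using neg V_in[OF \<Delta>(2) True] \<eta>_pos by simp
        next
          case False
          then have "rel_size z > 1" using rel_size_gt_1_iff[of z] \<Delta> by simp
          then have "\<phi> (rel_size z) \<ge> 1" using \<kappa>_pos by (simp add: \<phi>_def)
          then have "V z \<ge> 0 + c\<^sub>0 * 1" unfolding V_def using \<Delta> c\<^sub>0_pos by (intro add_mono mult_left_mono) auto
          then show False using neg ln_\<beta>_pos \<eta>_pos by (simp add: c\<^sub>0_def)
        qed
      qed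
      moreover have "(\<integral>\<^sup>+ y. ennreal (V y) \<partial>PP z) + ennreal (\<eta> / 2) \<le> ennreal (V z - \<eta> / 2) + ennreal (\<eta> / 2)"
        using r zD by (intro add_right_mono) (auto intro: order_trans ennreal_leI)
      ultimately show ?thesis using zD \<eta>_pos by (simp flip: ennreal_plus)
    qed
    show ?thesis
    proof (cases "\<bar>fst z\<bar> \<le> real K / 2 * snd z")
      case True
      let ?q = "c\<^sub>0 * c\<^sub>1 / snd z * \<mu>\<^sub>w"
      have q: "?q \<le> m / snd z" using m1(1) \<Delta> divide_right_mono[of "c\<^sub>0 * c\<^sub>1 * \<mu>\<^sub>w" m "snd z"] by simp
      have qm: "?q \<le> m" using q m0 \<Delta> divide_left_mono[of 1 "snd z" m] by simp
      note in_range = True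
      show ?thesis
      proof (rule *[OF drift_in[OF z in_range]])
        show "V z + (if snd z \<ge> L then - \<eta> else ln \<beta>) + ?q \<le> V z - \<eta> / 2 + (if z \<in> ?D then e else 0)"
        proof (cases "z \<in> ?D")
          case True
          then show ?thesis using qm \<eta>_pos ln_\<beta>_pos by (simp add: e_def)
        next
          case False
          have "snd z > D\<^sub>1" using big[OF in_range False] .
          then have "snd z > 2 * m / \<eta>" "snd z \<ge> L" by (auto simp: D\<^sub>1_def)
          then have "?q \<le> \<eta> / 2" using small[of "snd z"] q \<Delta> by linarith
          then show ?thesis
            unfolding if_P[OF \<open>snd z \<ge> L\<close>] if_not_P[OF False] by linarith
        qed
      qed
    next
      case False
      then have out: "\<bar>fst z\<bar> > real K / 2 * snd z" by simp
      have "1 * 1 \<le> real K / 2 * snd z" using K \<Delta> by (intro mult_mono) auto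
      then have x1: "\<bar>fst z\<bar> \<ge> 1" using out by linarith
      let ?q = "c\<^sub>0 / (\<kappa> * \<bar>fst z\<bar>) * \<mu>\<^sub>w"
      have q: "?q \<le> m / \<bar>fst z\<bar>" using m1(2) x1 divide_right_mono[of "c\<^sub>0 / \<kappa> * \<mu>\<^sub>w" m "\<bar>fst z\<bar>"] by simp
      have "fst z \<noteq> 0" using x1 by auto
      then have qm: "?q \<le> m" using q m0 x1 divide_left_mono[of 1 "\<bar>fst z\<bar>" m] by simp
      show ?thesis
      proof (rule *[OF drift_out[OF z out]])
        show "V z - \<eta> + ?q \<le> V z - \<eta> / 2 + (if z \<in> ?D then e else 0)"
        proof (cases "z \<in> ?D")
          case True
          then show ?thesis using qm \<eta>_pos ln_\<beta>_pos by (simp add: e_def)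
        next
          case False
          have "\<bar>fst z\<bar> > X"
          proof (rule ccontr)
            assume nx: "\<not> \<bar>fst z\<bar> > X"
            then have "real K / 2 * snd z \<le> X" using out by linarith
            then have "snd z \<le> 2 * X / real K" using K0 by (simp add: field_simps)
            then have "snd z \<le> D" by (simp add: D_def)
            then show False using in_D False nx by simp
          qed
          then have "\<bar>fst z\<bar> > 2 * m / \<eta>" by (simp add: X_def)
          then have "?q \<le> \<eta> / 2" using small[of "\<bar>fst z\<bar>"] q x1 by linarith
          then show ?thesis unfolding if_not_P[OF False] by linarith
        qed
      qed
    qed
  qed
  \<comment> \<open>Rescaling turns the decrease \<open>\<eta> / 2\<close> into the unit decrease of
    the drift condition.\<close>
  define V' where "V' z = ennreal (2 / \<eta>) * ennreal (V z)" for z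
  show ?thesis
  proof (rule that[of "2 / \<eta> * e" V' X D])
    show "2 / \<eta> * e \<ge> 0" using e0 \<eta>_pos by simp
    show "V' \<in> borel_measurable SS" unfolding V'_def using V_measurable by auto
    show "V' z < \<infinity>" for z by (simp add: V'_def ennreal_mult_less_top)
    fix z assume z: "z \<in> space SS"
    have "V \<in> borel_measurable (PP z)"
      using V_measurable by (simp add: closed_loop_kernel_def)
    then have "(\<integral>\<^sup>+ y. V' y \<partial>PP z) = ennreal (2 / \<eta>) * (\<integral>\<^sup>+ y. ennreal (V y) \<partial>PP z)"
      unfolding V'_def by (intro nn_integral_cmult) auto
    moreover have "ennreal (2 / \<eta>) * ennreal (\<eta> / 2) = 1" using \<eta>_pos by (simp flip: ennreal_mult')
    ultimately have "(\<integral>\<^sup>+ y. V' y \<partial>PP z) + 1 = ennreal (2 / \<eta>) * ((\<integral>\<^sup>+ y. ennreal (V y) \<partial>PP z) + ennreal (\<eta> / 2))"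
      by (simp add: distrib_left)
    also have "\<dots> \<le> ennreal (2 / \<eta>) * (ennreal (V z) + ennreal e * indicator ?D z)"
      by (intro mult_left_mono PV z) simp
    also have "\<dots> = V' z + ennreal (2 / \<eta> * e) * indicator ?D z"
    proof -
      have "ennreal (2 / \<eta> * e) = ennreal (2 / \<eta>) * ennreal e" using \<eta>_pos e0 by (intro ennreal_mult) auto
      then show ?thesis by (simp only: V'_def distrib_left mult.assoc)
    qed
    finally show "(\<integral>\<^sup>+ y. V' y \<partial>PP z) + 1 \<le> V' z + ennreal (2 / \<eta> * e) * indicator ?D z" .
  qed
qed

end

section \<open>Positive Harris recurrence\<close>

context quantized_loop
begin

lemma harris_chain:
  obtains \<nu> \<epsilon> e V' C where "drift_to_small_set SS PP C \<nu> \<epsilon> e V'"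
proof -
  obtain nl where nl: "lev nl \<in> bins" "lev nl < L" "int A dvd nl - n\<^sub>0" by (rule ex_low_level)
  let ?C = "In (lev nl)"
  obtain X D e V' where V': "e \<ge> 0" "V' \<in> borel_measurable SS" "\<And>z. z \<in> space SS \<Longrightarrow> V' z < \<infinity>"
    "\<And>z. z \<in> space SS \<Longrightarrow> (\<integral>\<^sup>+ y. V' y \<partial>PP z) + 1
      \<le> V' z + ennreal e * indicator ({-X..X} \<times> {\<Delta> \<in> bins. \<Delta> \<le> D}) z"
    by (rule drift_to_compact) (rule that, assumption+)
  have C: "?C \<in> sets SS" using In_sets nl by blast
  have pr: "prob_space (PP z)" if "z \<in> space SS" for z
    using measurable_space[OF PP_prob that] by (simp add: space_prob_algebra)
  obtain V'' e' where V'': "V'' \<in> borel_measurable SS" "\<And>z. z \<in> space SS \<Longrightarrow> V'' z < \<infinity>"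
    "\<And>z. z \<in> space SS \<Longrightarrow> (\<integral>\<^sup>+ y. V'' y \<partial>PP z) + 1 \<le> V'' z + ennreal e' * indicator ?C z"
    by (rule drift_transfer[OF PP_subprob pr C reaches_compact[OF nl, of X D] V']) (assumption | rule that)+
  define r where "r = real K / 2 * lev nl"
  have r0: "r > 0" unfolding r_def using K lev_pos by simp
  have C_eq: "?C = {-r..r} \<times> {lev nl}" by (simp add: In_def r_def)
  define U where "U = uniform_measure lborel {-r..r}"
  have pU: "prob_space U" unfolding U_def using r0 by (intro prob_space_uniform_measure) auto
  have sU: "sets U = sets borel" by (simp add: U_def)
  have pair: "(\<lambda>x. (x, lev nl)) \<in> U \<rightarrow>\<^sub>M SS"
    unfolding measurable_cong_sets[OF sU refl] state_space_def using nl(1)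
    by (intro measurable_Pair) auto
  define \<nu> where "\<nu> = distr U SS (\<lambda>x. (x, lev nl))"
  \<comment> \<open>The factor \<open>2 * r\<close> is the length of the range, since
    \<open>\<nu>\<close> is uniform there. The density is taken at the largest distance between a
    point of the range and a mean, which the quantization error bounds by
    \<open>\<bar>a\<bar> * (lev nl / 2)\<close>.\<close>
  define \<epsilon> where "\<epsilon> = p * normal_density 0 \<sigma> (r + \<bar>a\<bar> * (lev nl / 2)) * (2 * r)"
  have em: "emeasure \<nu> E = emeasure lborel ({-r..r} \<inter> {x. (x, lev nl) \<in> E}) / ennreal (2 * r)"
    if E: "E \<in> sets SS" for E
  proof -
    have "emeasure \<nu> E = emeasure U {x. (x, lev nl) \<in> E}"
      unfolding \<nu>_def using pair E by (subst emeasure_distr) (auto simp: U_def vimage_def)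
    also have "\<dots> = emeasure lborel ({-r..r} \<inter> {x. (x, lev nl) \<in> E}) / emeasure lborel {-r..r}"
      unfolding U_def using section_sets[OF E nl(1)] by (intro emeasure_uniform_measure) auto
    also have "emeasure lborel {-r..r} = ennreal (2 * r)" using r0 by simp
    finally show ?thesis .
  qed
  have "drift_to_small_set SS PP ?C \<nu> \<epsilon> e' V''"
  proof (rule drift_to_small_set.intro)
    show "PP \<in> SS \<rightarrow>\<^sub>M prob_algebra SS" by (rule PP_prob)
    show "?C \<in> sets SS" by (rule C)
    show "?C \<noteq> {}" using r0 by (auto simp: C_eq)
    show "prob_space \<nu>" unfolding \<nu>_def by (rule prob_space.prob_space_distr[OF pU pair])
    show "sets \<nu> = sets SS" by (simp add: \<nu>_def)
    show "0 < \<epsilon>" unfolding \<epsilon>_def using p r0 normal_density_pos[OF \<sigma>] by (intro mult_pos_pos) auto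
    fix z E assume z: "z \<in> ?C" and E: "E \<in> sets SS"
    have zS: "z \<in> space SS" using z nl by (auto simp: In_def space_SS)
    let ?G = "{-r..r} \<inter> {x. (x, lev nl) \<in> E}" and ?c = "p * normal_density 0 \<sigma> (r + \<bar>a\<bar> * (lev nl / 2))"
    have "snd z * scl z True = lev nl" using z scl_In[OF z] nl(2) by (auto simp: In_def)
    then have "ennreal ?c * emeasure lborel ?G \<le> emeasure (PP z) E"
      using emeasure_PP_ge[OF zS E mid_in[OF z lev_pos], of r] by simp
    also have "ennreal ?c * emeasure lborel ?G = ennreal \<epsilon> * emeasure \<nu> E"
    proof -
      have "ennreal \<epsilon> = ennreal ?c * ennreal (2 * r)"
        unfolding \<epsilon>_def using p r0 by (intro ennreal_mult) auto
      then have "ennreal \<epsilon> * emeasure \<nu> E = ennreal ?c * (ennreal (2 * r) * (emeasure lborel ?G / ennreal (2 * r)))"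
        unfolding em[OF E] by (simp add: mult.assoc)
      also have "ennreal (2 * r) * (emeasure lborel ?G / ennreal (2 * r)) = emeasure lborel ?G"
        using r0 by (subst ennreal_times_divide, subst mult.commute) (simp add: ennreal_mult_divide_eq)
      finally show ?thesis ..
    qed
    finally show "ennreal \<epsilon> * emeasure \<nu> E \<le> emeasure (PP z) E" .
  qed (use V'' in auto)
  then show ?thesis by (rule that)
qed

lemma state_space_coprime:
  assumes "coprime A B" and "\<Delta>\<^sub>1 \<ge> L" "log 2 \<Delta>\<^sub>1 = of_int n\<^sub>1 * s"
  shows "state_space s \<alpha> L A B n\<^sub>1 = SS"
proof -
  have ex: "\<exists>N\<^sub>A N\<^sub>B :: nat. n = m - int N\<^sub>A * int A + int N\<^sub>B * int B" for n m :: int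
  proof -
    have "coprime (int A) (int B)" using assms(1) by simp
    then obtain u v where uv: "u * int A + v * int B = 1"
      using bezout_int[of "int A" "int B"] by (auto simp: coprime_iff_gcd_eq_1)
    \<comment> \<open>Bezout coefficients may be negative. Adding \<open>t * B\<close> steps of size
      \<open>A\<close> down and \<open>t * A\<close> steps of size \<open>B\<close> up changes
      nothing, and \<open>t\<close> is large enough to make both counts nonnegative.\<close>
    define c t where "c = n - m" and "t = \<bar>c * u\<bar> + \<bar>c * v\<bar>"
    have A1: "int A \<ge> 1" and B1: "int B \<ge> 1" using A_pos B_pos by auto
    have t0: "t \<ge> 0" by (simp add: t_def)
    have "t * 1 \<le> t * int B" "t * 1 \<le> t * int A" using A1 B1 t0 by (intro mult_left_mono; simp)+
    moreover have "\<bar>c * u\<bar> \<le> t" "\<bar>c * v\<bar> \<le> t" by (simp_all add: t_def)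
    ultimately have "t * int B - c * u \<ge> 0" "t * int A + c * v \<ge> 0" by linarith+
    then obtain N\<^sub>A N\<^sub>B where N: "t * int B - c * u = int N\<^sub>A" "t * int A + c * v = int N\<^sub>B"
      by (metis nonneg_int_cases)
    have "m - (t * int B - c * u) * int A + (t * int A + c * v) * int B = m + c * (u * int A + v * int B)"
      by (simp add: algebra_simps)
    then have "n = m - int N\<^sub>A * int A + int N\<^sub>B * int B" unfolding N uv by (simp add: c_def)
    then show ?thesis by blast
  qed
  have "admissible_bins s \<alpha> L A B n\<^sub>1 = bins"
    unfolding admissible_bins_def using ex by simp
  then show ?thesis by (simp add: state_space_def)
qed

lemma positive_harris:
  fixes M :: "'w measure" and d :: "nat \<Rightarrow> 'w \<Rightarrow> real" and \<Upsilon> :: "nat \<Rightarrow> 'w \<Rightarrow> bool"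
  assumes "prob_space M"
    and d: "prob_space.indep_vars M (\<lambda>_. borel) d UNIV"
    and dist: "\<And>t. distributed M lborel (d t) (normal_density 0 \<sigma>)"
    and Y: "prob_space.indep_vars M (\<lambda>_. count_space UNIV) \<Upsilon> UNIV"
    and ex: "\<And>t. prob_space.expectation M (\<lambda>\<omega>. of_bool (\<Upsilon> t \<omega>)) = p"
    and ind: "prob_space.indep_set M
           {(\<lambda>\<omega> t. d t \<omega>) -` E \<inter> space M |E. E \<in> sets (Pi\<^sub>M UNIV (\<lambda>_. borel))}
           {(\<lambda>\<omega> t. \<Upsilon> t \<omega>) -` E \<inter> space M |E. E \<in> sets (Pi\<^sub>M UNIV (\<lambda>_. count_space UNIV))}"
  shows "positive_harris_recurrent M SS PP (closed_loop a b K \<alpha> \<delta> L d \<Upsilon>)"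
    and "\<exists>!\<pi>. invariant_prob SS PP \<pi>"
proof -
  interpret prob_space M by fact
  obtain \<nu> \<epsilon> e V' C where "drift_to_small_set SS PP C \<nu> \<epsilon> e V'" by (rule harris_chain)
  then interpret H: drift_to_small_set SS PP C \<nu> \<epsilon> e V' .
  let ?\<zeta> = "NN \<Otimes>\<^sub>M measure_pmf (bernoulli_pmf p)" and ?X = "closed_loop a b K \<alpha> \<delta> L d \<Upsilon>"
  have chain: "driven_chain M (borel \<Otimes>\<^sub>M count_space UNIV) ?\<zeta> (\<lambda>t \<omega>. (d t \<omega>, \<Upsilon> t \<omega>)) SS nxt (?X z) z"
    if "z \<in> space SS" for z
    using that p nxt_measurable
    by unfold_locales (auto intro: indep_vars_pair[OF d Y ind] distr_pair[OF d Y ind dist _ _ ex])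
  have PP: "PP = (\<lambda>x. distr ?\<zeta> SS (nxt x))"
    by (simp add: closed_loop_kernel_def fun_eq_iff)
  show "\<exists>!\<pi>. invariant_prob SS PP \<pi>" by (rule H.ex1_invariant_prob)
  then have "\<exists>\<pi>. invariant_prob SS PP \<pi>" by blast
  moreover have "markov_chain M SS PP (?X z) \<and> (\<forall>\<omega>\<in>space M. ?X z 0 \<omega> = z)" if "z \<in> space SS" for z
    using driven_chain.markov_chain_driven[OF chain[OF that]] unfolding PP by simp
  moreover have "AE \<omega> in M. \<exists>t\<ge>1. ?X z t \<omega> \<in> E" if "z \<in> space SS" "E \<in> sets SS" "emeasure \<nu> E > 0" for z E
    using driven_chain.AE_hits[OF chain[OF that(1)] that(2)] H.avoid_set_tendsto_0[OF that(2,3,1)]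
    unfolding PP by blast
  moreover have "sigma_finite_measure \<nu>" "emeasure \<nu> (space \<nu>) \<noteq> 0"
    using H.\<nu>_prob by (auto simp: prob_space_imp_sigma_finite prob_space.emeasure_space_1)
  ultimately show "positive_harris_recurrent M SS PP ?X"
    unfolding positive_harris_recurrent_def using H.\<nu>_sets by blast
qed

end

theorem mainTheorem4:
  fixes M :: "'w measure"
    and d :: "nat \<Rightarrow> 'w \<Rightarrow> real" and \<Upsilon> :: "nat \<Rightarrow> 'w \<Rightarrow> bool"
    and a b \<alpha> \<delta> L \<sigma> p s x\<^sub>0 \<Delta>\<^sub>0 :: real and K A B :: nat and n\<^sub>0 :: int
  assumes "prob_space M"
    \<comment> \<open>the disturbance and erasure processes\<close>
    and "prob_space.indep_vars M (\<lambda>_. borel) d UNIV"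
    and "\<sigma> > 0"
    and "\<And>t. distributed M lborel (d t) (normal_density 0 \<sigma>)"
    and "prob_space.indep_vars M (\<lambda>_. count_space UNIV) \<Upsilon> UNIV"
    and "0 < p" and "p \<le> 1"
    and "\<And>t. prob_space.expectation M (\<lambda>\<omega>. of_bool (\<Upsilon> t \<omega>)) = p"
    and "prob_space.indep_set M
           {(\<lambda>\<omega> t. d t \<omega>) -` E \<inter> space M |E. E \<in> sets (Pi\<^sub>M UNIV (\<lambda>_. borel))}
           {(\<lambda>\<omega> t. \<Upsilon> t \<omega>) -` E \<inter> space M |E. E \<in> sets (Pi\<^sub>M UNIV (\<lambda>_. count_space UNIV))}"
    \<comment> \<open>system and quantizer parameters\<close>
    and "\<bar>a\<bar> \<ge> 1" and "b \<noteq> 0"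
    and "K \<ge> 2" and "even K"
    and "0 < \<alpha>" and "\<alpha> < 1" and "\<delta> > 0" and "L > 0"
    and "\<alpha> > \<bar>a\<bar> * 2 powr (- log 2 (real K))"
    and "\<alpha> * (\<bar>a\<bar> + \<delta>) powr (1 / p - 1) < 1"
    and "\<alpha> * L \<ge> 1"
    \<comment> \<open>integer multiples of a common scalar\<close>
    and "s > 0"
    and "log 2 \<alpha> = - real A * s"
    and "log 2 (\<bar>a\<bar> + \<delta>) = real B * s"
    and "\<Delta>\<^sub>0 \<ge> L" and "log 2 \<Delta>\<^sub>0 = of_int n\<^sub>0 * s"
  defines "S \<equiv> state_space s \<alpha> L A B"
  defines "P \<equiv> (\<lambda>n. closed_loop_kernel a b K \<alpha> \<delta> L \<sigma> p (S n))"
  shows "(x\<^sub>0, \<Delta>\<^sub>0) \<in> space (S n\<^sub>0) \<and>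
    positive_harris_recurrent M (S n\<^sub>0) (P n\<^sub>0) (closed_loop a b K \<alpha> \<delta> L d \<Upsilon>) \<and>
    (\<exists>!\<pi>. invariant_prob (S n\<^sub>0) (P n\<^sub>0) \<pi>) \<and>
    (coprime A B \<longrightarrow>
      (\<forall>n\<^sub>1 \<Delta>\<^sub>1. \<Delta>\<^sub>1 \<ge> L \<and> log 2 \<Delta>\<^sub>1 = of_int n\<^sub>1 * s \<longrightarrow>
        (\<forall>\<pi>\<^sub>0 \<pi>\<^sub>1. invariant_prob (S n\<^sub>0) (P n\<^sub>0) \<pi>\<^sub>0 \<and> invariant_prob (S n\<^sub>1) (P n\<^sub>1) \<pi>\<^sub>1
          \<longrightarrow> \<pi>\<^sub>0 = \<pi>\<^sub>1)))"
proof -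
  interpret quantized_loop a b \<alpha> \<delta> L \<sigma> p s \<Delta>\<^sub>0 K A B n\<^sub>0
    using assms(3,6,7,10-12,14-25) by unfold_locales
  note PH = positive_harris[OF assms(1,2,4,5,8,9)]
  have SP: "S n\<^sub>0 = SS" "P n\<^sub>0 = PP" by (simp_all add: S_def P_def)
  have "(x\<^sub>0, \<Delta>\<^sub>0) \<in> space SS" using \<Delta>\<^sub>0_bins by (simp add: space_SS)
  moreover have "\<pi>\<^sub>0 = \<pi>\<^sub>1"
    if "coprime A B" "\<Delta>\<^sub>1 \<ge> L" "log 2 \<Delta>\<^sub>1 = of_int n\<^sub>1 * s"
      "invariant_prob (S n\<^sub>0) (P n\<^sub>0) \<pi>\<^sub>0" "invariant_prob (S n\<^sub>1) (P n\<^sub>1) \<pi>\<^sub>1" for n\<^sub>1 \<Delta>\<^sub>1 \<pi>\<^sub>0 \<pi>\<^sub>1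
  proof -
    \<comment> \<open>The integer of the initial bin enters the state space, and through it the
      kernel, only by way of the admissible bins; uniqueness for one common chain then
      finishes.\<close>
    have S1: "S n\<^sub>1 = SS" unfolding S_def by (rule state_space_coprime[OF that(1-3)])
    then have P1: "P n\<^sub>1 = PP" by (simp add: P_def)
    show ?thesis using that(4,5) PH(2) unfolding SP S1 P1 by blast
  qed
  ultimately show ?thesis using PH unfolding SP by blast
qed

end
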